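(* There is an absolute constant $C>0$ such that the following holds. Let $n\in\mathbb{N}$, $\delta\in(0,1]$ and $c\in(0,1]$ satisfy $n\ge C\sqrt{\log\frac{1}{c\delta}}$, and let $\{\mathcal{O}_k\}_{1\le k\le n}$ be oracles with $\mathcal{O}_k:\mathbb{C}^{k\times k}\to\mathbb{C}$. Then the procedure $\mathsf{PTest}$ (with parameters $n,\delta,c$ and oracle access to $\{\mathcal{O}_k\}$) satisfies: 1. (Completeness) If for every $k\le n$ and every $X\in\mathbb{C}^{k\times k}$ we have $|\mathcal{O}_k(X)-\mathrm{Per}_k(X)|^2\le\delta^2 k!$, then $\mathsf{PTest}$ accepts with probability at least $1-c$. 2. (Soundness) For every $1\le k\le n$, either there exists an indicator function $1_k:\mathbb{C}^{k\times k}\to\{0,1\}$ with $\mathbb{E}_X[1_k(X)]\ge 1-\frac{\delta^4 c}{64n}$ and $\mathbb{E}_X[1_k(X)\,|\mathcal{O}_k(X)-\mathrm{Per}_k(X)|^2]\le(2nk\delta)^2 k!$, or else $\mathsf{PTest}$ outputs Reject with probability at least $1-e^{-n}$. 3. (Complexity) The total number of oracle queries made by $\mathsf{PTest}$ is $O(n^4\delta^{-4}c^{-1})$, and, assuming each oracle query takes constant time, the running time of $\mathsf{PTest}$ is also $O(n^4\delta^{-4}c^{-1})$.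
   Context: For a $k\times k$ complex matrix $X=(x_{i,j})$, $\mathrm{Per}_k(X)=\sum_{\pi}\prod_{i=1}^k x_{i,\pi(i)}$, the sum over all permutations $\pi$ of $[k]$. $\mathbb{E}_X$ and $\Pr_X$ denote expectation/probability over $X\in\mathbb{C}^{k\times k}$ drawn from the Gaussian ensemble: entries i.i.d. standard complex Gaussians (mean $0$, $\mathbb{E}|x|^2=1$). An indicator function is a function to $\{0,1\}$. For $X\in\mathbb{C}^{k\times k}$, $x_{11},\dots,x_{1k}$ denote the entries of the first row and $X_i$ denotes the $(k-1)\times(k-1)$ minor obtained by deleting the first row and the $i$-th column. Procedure $\mathsf{LinearityTest}(n,k,\delta)$: sample $X\in\mathbb{C}^{k\times k}$ from the Gaussian ensemble. If $k=1$, output Reject unless $|\mathcal{O}_1(X)-X|^2\le n^2\delta^2$. If $k\ge2$, output Reject unless $|\mathcal{O}_k(X)-\sum_{i=1}^k x_{1i}\mathcal{O}_{k-1}(X_i)|^2\le n^2\delta^2 k!$. Procedure $\mathsf{TailTest}(k,T)$: sample $X\in\mathbb{C}^{k\times k}$ from the Gaussian ensemble; output Reject unless $|\mathcal{O}_k(X)|^2\le T^2 k!$. Procedure $\mathsf{PTest}$ with parameters $n,\delta,c$: set $T=\frac{4n}{\delta\sqrt{c}}$ and $d=\frac{192n^2}{\delta^4 c}$. For each $1\le k\le n$, run $\mathsf{LinearityTest}(n,k,\delta)$ $d$ times and $\mathsf{TailTest}(k,T)$ $d$ times (all with independent samples). If none of these outputs Reject, output Accept; otherwise output Reject. Probabilities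 for $\mathsf{PTest}$ are over its internal random samples.
   Formalization: The repetition count d is rounded up to an integer; oracles are assumed Borel measurable; in the running time (n ≥ 1) drawing a whole k×k Gaussian matrix counts as one step and forming a minor is part of its constant-time query, since entrywise sampling alone would cost order n^5. *)

theory Defs
  imports "HOL-Probability.Probability"
begin

section \<open>Matrices, permanents and the Gaussian ensemble\<close>

text \<open>
  Since the dimension \<open>k\<close> varies inside the statement, a \<open>k \<times> k\<close> matrix is an extensional function
  on the index set \<open>{1..k} \<times> {1..k}\<close>.
\<close>

type_synonym cmatrix = "nat \<times> nat \<Rightarrow> complex"

definition indices :: "nat \<Rightarrow> (nat \<times> nat) set" where
  "indices k = {1..k} \<times> {1..k}"

definition cmatrices :: "nat \<Rightarrow> cmatrix set" where
  "cmatrices k = indices k \<rightarrow>\<^sub>E UNIV"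

definition Per :: "nat \<Rightarrow> cmatrix \<Rightarrow> complex" where
  "Per k X = (\<Sum>\<pi> | \<pi> permutes {1..k}. \<Prod>i = 1..k. X (i, \<pi> i))"

definition minor :: "nat \<Rightarrow> nat \<Rightarrow> cmatrix \<Rightarrow> cmatrix" where
  "minor k i X = (\<lambda>(a, b) \<in> indices (k - 1). X (a + 1, if b < i then b else b + 1))"

definition std_complex_gaussian :: "complex measure" where
  "std_complex_gaussian = density lborel (\<lambda>z. ennreal (exp (- (cmod z)\<^sup>2) / pi))"

definition gauss :: "nat \<Rightarrow> cmatrix measure" where
  "gauss k = PiM (indices k) (\<lambda>_. std_complex_gaussian)"


section \<open>Randomized oracle algorithms\<close>

text \<open>
  An algorithm is a tree of instructions: draw a fresh matrix from the Gaussian ensemble of a given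
  dimension, query an oracle, or perform one elementary computation step (\<open>Tick\<close>).
\<close>

type_synonym oracles = "nat \<Rightarrow> cmatrix \<Rightarrow> complex"

datatype 'a alg =
    Return 'a
  | Tick "'a alg"
  | Sample nat "cmatrix \<Rightarrow> 'a alg"
  | Query nat cmatrix "complex \<Rightarrow> 'a alg"

primrec bind_alg :: "'a alg \<Rightarrow> ('a \<Rightarrow> 'b alg) \<Rightarrow> 'b alg" where
  "bind_alg (Return a) g = g a"
| "bind_alg (Tick p) g = Tick (bind_alg p g)"
| "bind_alg (Sample k f) g = Sample k (\<lambda>X. bind_alg (f X) g)"
| "bind_alg (Query k X f) g = Query k X (\<lambda>y. bind_alg (f y) g)"

adhoc_overloading Monad_Syntax.bind \<rightleftharpoons> bind_alg

definition sample :: "nat \<Rightarrow> cmatrix alg" where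
  "sample k = Sample k Return"

definition query :: "nat \<Rightarrow> cmatrix \<Rightarrow> complex alg" where
  "query k X = Query k X Return"

text \<open>
  \<open>compute\<close> charges one step, and is to be applied only to expressions consisting of a bounded number
  of elementary operations on values already computed.  A loop charges one step per
  iteration in addition to the cost of its body.
\<close>

definition compute :: "'a \<Rightarrow> 'a alg" where
  "compute v = Tick (Return v)"

primrec for_loop :: "nat list \<Rightarrow> (nat \<Rightarrow> 's \<Rightarrow> 's alg) \<Rightarrow> 's \<Rightarrow> 's alg" where
  "for_loop [] body s = Return s"
| "for_loop (i # is) body s = Tick (bind_alg (body i s) (for_loop is body))"

primrec outcome :: "oracles \<Rightarrow> 'a alg \<Rightarrow> 'a measure" where
  "outcome \<O> (Return a) = return (count_space UNIV) a"
| "outcome \<O> (Tick p) = outcome \<O> p"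
| "outcome \<O> (Sample k f) = Giry_Monad.bind (gauss k) (\<lambda>X. outcome \<O> (f X))"
| "outcome \<O> (Query k X f) = outcome \<O> (f (\<O> k X))"

text \<open>
  Number of oracle queries and running time, in the worst case over the random samples.  In
  \<open>runtime \<tau>\<close> an oracle query (including the assembly of its argument) takes time \<open>\<tau>\<close>; drawing a
  matrix from the Gaussian ensemble is a single step.
\<close>

primrec queries :: "oracles \<Rightarrow> 'a alg \<Rightarrow> enat" where
  "queries \<O> (Return a) = 0"
| "queries \<O> (Tick p) = queries \<O> p"
| "queries \<O> (Sample k f) = (SUP X\<in>cmatrices k. queries \<O> (f X))"
| "queries \<O> (Query k X f) = 1 + queries \<O> (f (\<O> k X))"

primrec runtime :: "nat \<Rightarrow> oracles \<Rightarrow> 'a alg \<Rightarrow> enat" where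
  "runtime \<tau> \<O> (Return a) = 0"
| "runtime \<tau> \<O> (Tick p) = 1 + runtime \<tau> \<O> p"
| "runtime \<tau> \<O> (Sample k f) = 1 + (SUP X\<in>cmatrices k. runtime \<tau> \<O> (f X))"
| "runtime \<tau> \<O> (Query k X f) = enat \<tau> + runtime \<tau> \<O> (f (\<O> k X))"


section \<open>The permanent test\<close>

datatype verdict = Accept | Reject

definition factorial :: "nat \<Rightarrow> real alg" where
  "factorial k = for_loop [1..<k + 1] (\<lambda>i f. compute (real i * f)) 1"

definition LinearityTest :: "nat \<Rightarrow> nat \<Rightarrow> real \<Rightarrow> verdict alg" where
  "LinearityTest n k \<delta> = do {
     X \<leftarrow> sample k;
     v \<leftarrow> query k X;
     w \<leftarrow> (if k = 1 then compute (X (1, 1))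
          else for_loop [1..<k + 1]
            (\<lambda>i s. do {
               y \<leftarrow> query (k - 1) (minor k i X);
               compute (s + X (1, i) * y)
             }) 0);
     f \<leftarrow> factorial k;
     compute (if (cmod (v - w))\<^sup>2 \<le> (real n)\<^sup>2 * \<delta>\<^sup>2 * f then Accept else Reject)
   }"

definition TailTest :: "nat \<Rightarrow> real \<Rightarrow> verdict alg" where
  "TailTest k T = do {
     X \<leftarrow> sample k;
     v \<leftarrow> query k X;
     f \<leftarrow> factorial k;
     compute (if (cmod v)\<^sup>2 \<le> T\<^sup>2 * f then Accept else Reject)
   }"

text \<open>All \<open>d\<close> runs are executed; the result is \<open>Reject\<close> iff \<open>r\<close> or some run is \<open>Reject\<close>.\<close>

definition run_times :: "nat \<Rightarrow> verdict alg \<Rightarrow> verdict \<Rightarrow> verdict alg" where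
  "run_times d test r = for_loop [0..<d]
     (\<lambda>_ r. do {
        t \<leftarrow> test;
        compute (if t = Reject then Reject else r)
      }) r"

text \<open>The number of repetitions \<open>192 n\<^sup>2 / (\<delta>\<^sup>4 c)\<close> is rounded up to an integer.\<close>

definition PTest :: "nat \<Rightarrow> real \<Rightarrow> real \<Rightarrow> verdict alg" where
  "PTest n \<delta> c = do {
     T \<leftarrow> compute (4 * real n / (\<delta> * sqrt c));
     d \<leftarrow> compute (nat \<lceil>192 * (real n)\<^sup>2 / (\<delta> ^ 4 * c)\<rceil>);
     for_loop [1..<n + 1]
       (\<lambda>k r. do {
          r' \<leftarrow> run_times d (LinearityTest n k \<delta>) r;
          run_times d (TailTest k T) r'
        }) Accept
   }"

end

theory Submission
  imports Defs "HOL-Real_Asymp.Real_Asymp"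
begin

text \<open>
  Soundness: if \<open>PTest\<close> accepts with probability above \<open>e\<^sup>-\<^sup>n\<close>, then every single test fails with
  probability at most \<open>\<delta>\<^sup>4c / 192n\<close>; the indicator of both tests of size \<open>k\<close> passing works, by
  induction on \<open>k\<close>.  Linearity bounds the error at \<open>k\<close> by \<open>n\<delta>\<surd>k!\<close> plus a random linear form in the
  errors of the minors, whose second moment is \<open>k\<close> times that of a single minor.  On the rare event
  that some minor is bad, the tail test controls the oracle, and the fourth moment
  \<open>E|Per|\<^sup>4 \<le> (k + 1) (k!)\<^sup>2\<close> controls the permanent.

  Completeness: a linearity test can only fail if the first row has norm above \<open>n - 1\<close>, which has
  probability \<open>e\<close> to the \<open>-\<Omega>(n\<^sup>2)\<close>; a tail test fails with probability \<open>O(n / T\<^sup>4)\<close> by the same fourth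
  moment.  A union bound settles all large \<open>n\<close>.  For the finitely many remaining \<open>n\<close>, the constant \<open>C\<close>
  is chosen so large that \<open>1 - c\<close> is below the (positive) acceptance probability.
\<close>

section \<open>Moments of the complex Gaussian\<close>

text \<open>The error must grow only polynomially in \<open>k\<close>. Splitting squares with a
  factor 2 would double the bound at every level. Measured in units of \<open>D\<close> = n^2
  \<delta>^2 k!, a weighted split with weight 2 (k - 1) gives (2k - 1)^2 when all minors are good;
  the bad event costs at most one more unit, and (2k - 1)^2 + 1 \<le> (2k)^2. A matrix passing the
  tests may have failing minors, and the minors of one matrix are dependent. Only their common law
  and their independence of the first row enter: a union bound for bad minors, and orthogonality of
  the row entries for the second moment. The threshold T serves two sides. On the bad event, T^2
  times its probability must be O(n^2 \<delta>^2), and 16 n^2 / (\<delta>^2 c) times \<delta>^4 c /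
  96 is. In completeness, about n d tail tests, each failing with probability about n / T^4, must
  total less than c; the sum is about 193 c / 256. A second-moment bound 1 / T^2 would give order n
  / \<delta>^2 there, hence the fourth moment of the permanent.\<close>

lemma lborel_complex_eq_distr:
  "(lborel :: complex measure) = distr (lborel \<Otimes>\<^sub>M lborel) borel (\<lambda>(x, y). Complex x y)"
proof (rule lborel_eqI)
  have m[measurable]: "(\<lambda>(x, y). Complex x y) \<in> borel_measurable (lborel \<Otimes>\<^sub>M lborel)"
    by (simp add: Complex_eq split_beta')
  fix l u :: complex
  assume le: "\<And>b. b \<in> Basis \<Longrightarrow> l \<bullet> b \<le> u \<bullet> b"
  have vim: "(\<lambda>(x, y). Complex x y) -` box l u \<inter> space (lborel \<Otimes>\<^sub>M lborel)
      = {Re l <..< Re u} \<times> {Im l <..< Im u}"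
    by (auto simp: box_def Basis_complex_def space_pair_measure inner_complex_def)
  have "emeasure (distr (lborel \<Otimes>\<^sub>M lborel) borel (\<lambda>(x, y). Complex x y)) (box l u)
      = emeasure (lborel \<Otimes>\<^sub>M lborel) ({Re l <..< Re u} \<times> {Im l <..< Im u})"
    by (subst emeasure_distr) (auto simp: vim)
  also have "\<dots> = ennreal ((Re u - Re l) * (Im u - Im l))"
    using le[of 1] le[of \<i>]
    by (subst lborel.emeasure_pair_measure_Times)
      (auto simp: Basis_complex_def inner_complex_def ennreal_mult)
  finally show "emeasure (distr (lborel \<Otimes>\<^sub>M lborel) borel (\<lambda>(x, y). Complex x y)) (box l u)
      = (\<Prod>b\<in>Basis. (u - l) \<bullet> b)"
    by (simp add: Basis_complex_def inner_complex_def)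
qed simp

text \<open>Variance 1/2 in each of the two real coordinates makes E|z|^2 = 1.\<close>

abbreviation real_part_gaussian :: "real measure" where
  "real_part_gaussian \<equiv> density lborel (normal_density 0 (1 / sqrt 2))"

lemma normal_density_half: "normal_density 0 (1 / sqrt 2) x = exp (- x\<^sup>2) / sqrt pi"
  by (simp add: normal_density_def power_divide)

text \<open>The density factorises over the two coordinates, so real and imaginary part are
  independent real Gaussians. All moments are computed through this description.\<close>

lemma std_complex_gaussian_eq_distr:
  "std_complex_gaussian =
    distr (real_part_gaussian \<Otimes>\<^sub>M real_part_gaussian) borel (\<lambda>(x, y). Complex x y)"
proof -
  have m[measurable]: "(\<lambda>(x, y). Complex x y) \<in> borel_measurable (lborel \<Otimes>\<^sub>M lborel)"
    by (simp add: Complex_eq split_beta')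
  have "std_complex_gaussian = density (distr (lborel \<Otimes>\<^sub>M lborel) borel (\<lambda>(x, y). Complex x y))
      (\<lambda>z. ennreal (exp (- (cmod z)\<^sup>2) / pi))"
    unfolding std_complex_gaussian_def by (subst lborel_complex_eq_distr) simp
  also have "\<dots> = distr (density (lborel \<Otimes>\<^sub>M lborel)
      ((\<lambda>z. ennreal (exp (- (cmod z)\<^sup>2) / pi)) \<circ> (\<lambda>(x, y). Complex x y)))
      borel (\<lambda>(x, y). Complex x y)"
    by (subst density_distr) (auto simp: comp_def)
  also have "(\<lambda>z. ennreal (exp (- (cmod z)\<^sup>2) / pi)) \<circ> (\<lambda>(x, y). Complex x y)
      = (\<lambda>(x, y). ennreal (normal_density 0 (1 / sqrt 2) x) * ennreal (normal_density 0 (1 / sqrt 2) y))"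
    by (auto simp: fun_eq_iff normal_density_half cmod_def ennreal_mult[symmetric] exp_add[symmetric])
  also have "density (lborel \<Otimes>\<^sub>M lborel) \<dots> = real_part_gaussian \<Otimes>\<^sub>M real_part_gaussian"
    by (subst pair_measure_density)
      (auto intro!: prob_space_imp_sigma_finite[OF prob_space_normal_density] sigma_finite_lborel)
  finally show ?thesis .
qed

lemma sets_std_complex_gaussian[simp, measurable_cong]: "sets std_complex_gaussian = sets borel"
  by (simp add: std_complex_gaussian_def)

lemma space_std_complex_gaussian[simp]: "space std_complex_gaussian = UNIV"
  by (simp add: std_complex_gaussian_def)

lemma prob_space_std_complex_gaussian: "prob_space std_complex_gaussian"
proof -
  interpret N: prob_space real_part_gaussian by (rule prob_space_normal_density) simp
  interpret P: pair_prob_space real_part_gaussian real_part_gaussian ..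
  show ?thesis
    unfolding std_complex_gaussian_eq_distr
    by (rule P.prob_space_distr) (simp add: Complex_eq split_beta')
qed

lemma real_part_gaussian_moments:
  "integrable real_part_gaussian (\<lambda>x. x ^ j)"
  "(\<integral>x. x ^ 0 \<partial>real_part_gaussian) = 1"
  "(\<integral>x. x ^ 1 \<partial>real_part_gaussian) = 0"
  "(\<integral>x. x ^ 2 \<partial>real_part_gaussian) = 1 / 2"
  "(\<integral>x. x ^ 3 \<partial>real_part_gaussian) = 0"
  "(\<integral>x. x ^ 4 \<partial>real_part_gaussian) = 3 / 4"
proof -
  have s: "0 < 1 / sqrt 2" by simp
  have int: "(\<integral>x. x ^ j \<partial>real_part_gaussian)
      = (\<integral>x. normal_density 0 (1 / sqrt 2) x * (x - 0) ^ j \<partial>lborel)" for j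
    by (subst integral_density) (auto simp: normal_density_nonneg)
  show "integrable real_part_gaussian (\<lambda>x. x ^ j)"
    using integrable_normal_moment[OF s, of 0 j]
    by (subst integrable_density) (auto simp: normal_density_nonneg)
  show "(\<integral>x. x ^ 0 \<partial>real_part_gaussian) = 1"
    unfolding int using integral_normal_moment_even[OF s, of 0 0] by simp
  show "(\<integral>x. x ^ 1 \<partial>real_part_gaussian) = 0"
    unfolding int using integral_normal_moment_odd[OF s, of 0 0] by simp
  show "(\<integral>x. x ^ 2 \<partial>real_part_gaussian) = 1 / 2"
    unfolding int using integral_normal_moment_even[OF s, of 0 1] by (simp add: power_divide)
  show "(\<integral>x. x ^ 3 \<partial>real_part_gaussian) = 0"
    unfolding int using integral_normal_moment_odd[OF s, of 0 1] by (simp add: numeral_3_eq_3)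
  show "(\<integral>x. x ^ 4 \<partial>real_part_gaussian) = 3 / 4"
    unfolding int using integral_normal_moment_even[OF s, of 0 2]
    by (simp add: power_divide fact_numeral)
qed

lemma has_bochner_integral_gaussian_monomial:
  "has_bochner_integral std_complex_gaussian
    (\<lambda>z. complex_of_real (Re z ^ i * Im z ^ j))
    (complex_of_real ((\<integral>x. x ^ i \<partial>real_part_gaussian) * (\<integral>x. x ^ j \<partial>real_part_gaussian)))"
proof -
  interpret N: prob_space real_part_gaussian by (rule prob_space_normal_density) simp
  interpret P: pair_prob_space real_part_gaussian real_part_gaussian ..
  have m[measurable]: "(\<lambda>(x, y). Complex x y)
      \<in> borel_measurable (real_part_gaussian \<Otimes>\<^sub>M real_part_gaussian)"
    by (simp add: Complex_eq split_beta')
  have i: "integrable (real_part_gaussian \<Otimes>\<^sub>M real_part_gaussian) (\<lambda>(x, y). x ^ i * y ^ j)"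
  proof (rule P.Fubini_integrable)
    have "integrable real_part_gaussian (\<lambda>x. \<bar>x ^ i\<bar> * (\<integral>y. \<bar>y ^ j\<bar> \<partial>real_part_gaussian))"
      by (intro integrable_mult_left integrable_abs real_part_gaussian_moments)
    then show "integrable real_part_gaussian
        (\<lambda>x. \<integral>y. norm (case (x, y) of (x, y) \<Rightarrow> x ^ i * y ^ j) \<partial>real_part_gaussian)"
      by (simp add: abs_mult)
  qed (auto intro!: integrable_mult_right real_part_gaussian_moments)
  have "has_bochner_integral (real_part_gaussian \<Otimes>\<^sub>M real_part_gaussian) (\<lambda>(x, y). x ^ i * y ^ j)
    ((\<integral>x. x ^ i \<partial>real_part_gaussian) * (\<integral>x. x ^ j \<partial>real_part_gaussian))"
    using i P.integral_fst'[OF i] by (simp add: has_bochner_integral_iff)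
  then have "has_bochner_integral std_complex_gaussian (\<lambda>z. Re z ^ i * Im z ^ j)
    ((\<integral>x. x ^ i \<partial>real_part_gaussian) * (\<integral>x. x ^ j \<partial>real_part_gaussian))"
    unfolding std_complex_gaussian_eq_distr
    by (intro has_bochner_integral_distr) (auto simp: split_beta')
  then show ?thesis by (intro has_bochner_integral_of_real)
qed

text \<open>Behind the formula: rotation invariance kills the moments with
  \<open>p \<noteq> q\<close>, and |z|^2 is exponentially distributed. The proof just expands the
  nine cases in real coordinates. Exponents up to 2 suffice because in |Per|^4 each entry occurs at
  most twice plain and at most twice conjugated.\<close>

lemma std_complex_gaussian_moments:
  assumes "p \<le> 2" "q \<le> 2"
  shows "integrable std_complex_gaussian (\<lambda>z. z ^ p * cnj z ^ q)"
    and "(\<integral>z. z ^ p * cnj z ^ q \<partial>std_complex_gaussian) = (if p = q then fact p else 0)"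
proof -
  define \<mu> where "\<mu> j = (\<integral>x. x ^ j \<partial>real_part_gaussian)" for j :: nat
  define m where "m i j z = complex_of_real (Re z ^ i * Im z ^ j)" for i j z
  have \<mu>: "\<mu> 0 = 1" "\<mu> 1 = 0" "\<mu> 2 = 1 / 2" "\<mu> 3 = 0" "\<mu> 4 = 3 / 4"
    unfolding \<mu>_def by (rule real_part_gaussian_moments)+
  have H: "has_bochner_integral std_complex_gaussian (m i j) (complex_of_real (\<mu> i * \<mu> j))" for i j
    unfolding \<mu>_def m_def by (rule has_bochner_integral_gaussian_monomial)
  note rules = has_bochner_integral_add has_bochner_integral_diff has_bochner_integral_mult_right H
  let ?P = "\<lambda>p q. has_bochner_integral std_complex_gaussian (\<lambda>z. z ^ p * cnj z ^ q)
    (if p = q then fact p else 0)"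
  have e00: "(\<lambda>z. z ^ 0 * cnj z ^ 0) = m 0 0" by (auto simp: m_def)
  have e10: "(\<lambda>z. z ^ 1 * cnj z ^ 0) = (\<lambda>z. m 1 0 z + \<i> * m 0 1 z)"
    by (auto simp: complex_eq_iff m_def)
  have e01: "(\<lambda>z. z ^ 0 * cnj z ^ 1) = (\<lambda>z. m 1 0 z - \<i> * m 0 1 z)"
    by (auto simp: complex_eq_iff m_def)
  have e20: "(\<lambda>z. z ^ 2 * cnj z ^ 0) = (\<lambda>z. m 2 0 z - m 0 2 z + \<i> * (2 * m 1 1 z))"
    by (auto simp: complex_eq_iff power2_eq_square m_def)
  have e02: "(\<lambda>z. z ^ 0 * cnj z ^ 2) = (\<lambda>z. m 2 0 z - m 0 2 z - \<i> * (2 * m 1 1 z))"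
    by (auto simp: complex_eq_iff power2_eq_square m_def)
  have e11: "(\<lambda>z. z ^ 1 * cnj z ^ 1) = (\<lambda>z. m 2 0 z + m 0 2 z)"
    by (auto simp: complex_eq_iff power2_eq_square m_def)
  have e21: "(\<lambda>z. z ^ 2 * cnj z ^ 1) = (\<lambda>z. m 3 0 z + m 1 2 z + \<i> * (m 2 1 z + m 0 3 z))"
    by (auto simp: complex_eq_iff power2_eq_square power3_eq_cube algebra_simps m_def)
  have e12: "(\<lambda>z. z ^ 1 * cnj z ^ 2) = (\<lambda>z. m 3 0 z + m 1 2 z - \<i> * (m 2 1 z + m 0 3 z))"
    by (auto simp: complex_eq_iff power2_eq_square power3_eq_cube algebra_simps m_def)
  have e22: "(\<lambda>z. z ^ 2 * cnj z ^ 2) = (\<lambda>z. m 4 0 z + 2 * m 2 2 z + m 0 4 z)"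
    by (auto simp: complex_eq_iff power2_eq_square power4_eq_xxxx algebra_simps m_def)
  have P: "?P 0 0" "?P 1 0" "?P 0 1" "?P 2 0" "?P 0 2" "?P 1 1" "?P 2 1" "?P 1 2" "?P 2 2"
    unfolding e00 e10 e01 e20 e02 e11 e21 e12 e22
    \<comment> \<open>The integration rules produce the value as an unevaluated expression in
      \<open>\<mu>\<close>; the rotated substitution leaves its equality with the claimed value as a
      separate goal.\<close>
    by (rule subst[where P = "has_bochner_integral _ _", rotated], (rule rules)+,
        simp add: \<mu>[unfolded One_nat_def] del: of_real_mult of_real_add)+
  have "p \<in> {0, 1, 2}" "q \<in> {0, 1, 2}" using assms by auto
  then have "?P p q"
    by (elim insertE emptyE) (use P in \<open>simp_all only:\<close>)
  then show "integrable std_complex_gaussian (\<lambda>z. z ^ p * cnj z ^ q)"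
    "(\<integral>z. z ^ p * cnj z ^ q \<partial>std_complex_gaussian) = (if p = q then fact p else 0)"
    unfolding has_bochner_integral_iff by auto
qed

text \<open>Input for a Chernoff bound. With exponent 1/2, each real coordinate contributes sqrt 2
  times the total mass of the standard normal density.\<close>

lemma gaussian_exp_moment: "(\<integral>\<^sup>+z. ennreal (exp ((cmod z)\<^sup>2 / 2)) \<partial>std_complex_gaussian) = 2"
proof -
  interpret N: prob_space real_part_gaussian by (rule prob_space_normal_density) simp
  interpret P: pair_prob_space real_part_gaussian real_part_gaussian ..
  have m[measurable]: "(\<lambda>(x, y). Complex x y)
      \<in> borel_measurable (real_part_gaussian \<Otimes>\<^sub>M real_part_gaussian)"
    by (simp add: Complex_eq split_beta')
  have one: "(\<integral>\<^sup>+x. ennreal (exp (x\<^sup>2 / 2)) \<partial>real_part_gaussian) = ennreal (sqrt 2)"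
  proof -
    have "(\<integral>\<^sup>+x. ennreal (exp (x\<^sup>2 / 2)) \<partial>real_part_gaussian)
        = (\<integral>\<^sup>+x. ennreal (normal_density 0 (1 / sqrt 2) x) * ennreal (exp (x\<^sup>2 / 2)) \<partial>lborel)"
      by (subst nn_integral_density) auto
    also have "\<dots> = (\<integral>\<^sup>+x. ennreal (sqrt 2) * ennreal (std_normal_density x) \<partial>lborel)"
    proof (intro nn_integral_cong)
      fix x :: real
      have "exp (- x\<^sup>2) * exp (x\<^sup>2 / 2) = exp (- (x\<^sup>2 / 2))"
        by (simp add: exp_add[symmetric])
      then show "ennreal (normal_density 0 (1 / sqrt 2) x) * ennreal (exp (x\<^sup>2 / 2))
          = ennreal (sqrt 2) * ennreal (std_normal_density x)"
        by (simp add: normal_density_half ennreal_mult[symmetric] std_normal_density_def real_sqrt_mult)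
    qed
    also have "\<dots> = ennreal (sqrt 2) * ennreal (\<integral>x. std_normal_density x \<partial>lborel)"
      by (subst nn_integral_cmult) (auto simp: nn_integral_eq_integral)
    finally show ?thesis by simp
  qed
  have "(\<integral>\<^sup>+z. ennreal (exp ((cmod z)\<^sup>2 / 2)) \<partial>std_complex_gaussian)
      = (\<integral>\<^sup>+(x, y). ennreal (exp (x\<^sup>2 / 2)) * ennreal (exp (y\<^sup>2 / 2))
          \<partial>(real_part_gaussian \<Otimes>\<^sub>M real_part_gaussian))"
    unfolding std_complex_gaussian_eq_distr
    by (subst nn_integral_distr)
      (auto simp: cmod_def ennreal_mult[symmetric] exp_add[symmetric] add_divide_distrib split_beta')
  also have "\<dots> = (\<integral>\<^sup>+x. (\<integral>\<^sup>+y. ennreal (exp (x\<^sup>2 / 2)) * ennreal (exp (y\<^sup>2 / 2)) \<partial>real_part_gaussian)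
      \<partial>real_part_gaussian)"
    by (subst N.nn_integral_fst[symmetric]) auto
  also have "\<dots> = ennreal (sqrt 2) * ennreal (sqrt 2)"
    by (simp add: nn_integral_cmult nn_integral_multc one)
  also have "\<dots> = 2" by (simp add: ennreal_mult[symmetric])
  finally show ?thesis .
qed

text \<open>The density vanishes nowhere, so a null disc would be Lebesgue null, although it
  contains a ball of positive volume.\<close>

lemma gaussian_disc_pos:
  assumes "0 < r"
  shows "0 < measure std_complex_gaussian {z. (cmod z)\<^sup>2 \<le> r}"
proof -
  interpret prob_space std_complex_gaussian by (rule prob_space_std_complex_gaussian)
  have "emeasure std_complex_gaussian {z. (cmod z)\<^sup>2 \<le> r} \<noteq> 0"
  proof
    let ?A = "{z :: complex. (cmod z)\<^sup>2 \<le> r}"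
    assume "emeasure std_complex_gaussian ?A = 0"
    then have "?A \<in> null_sets std_complex_gaussian" by (auto simp: null_sets_def)
    then have "AE z in lborel. z \<notin> ?A"
      unfolding std_complex_gaussian_def by (subst (asm) null_sets_density_iff) auto
    moreover have "AE z in lborel. z \<in> ball 0 (sqrt r) \<longrightarrow> z \<in> ?A"
      by (intro AE_I2) (auto simp: real_less_rsqrt less_imp_le dest!: less_imp_le real_le_rsqrt
          intro: real_sqrt_le_iff[THEN iffD1])
    ultimately have "AE z in lborel. z \<notin> ball (0 :: complex) (sqrt r)" by auto
    then have "emeasure lborel (ball (0 :: complex) (sqrt r)) = 0"
      by (subst (asm) AE_iff_null_sets[symmetric]) auto
    then show False
      using assms emeasure_lborel_ball_finite content_ball_pos[of "sqrt r" "0 :: complex"]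
      by (simp add: measure_def)
  qed
  then show ?thesis by (simp add: emeasure_eq_measure zero_less_measure_iff)
qed

section \<open>Families of independent complex Gaussians\<close>

lemma product_prob_space_std_complex_gaussian: "product_prob_space (\<lambda>_. std_complex_gaussian)"
  by (intro product_prob_spaceI prob_space_std_complex_gaussian)

lemma PiM_gaussian_moments:
  assumes "finite I" "\<And>e. e \<in> I \<Longrightarrow> p e \<le> 2" "\<And>e. e \<in> I \<Longrightarrow> q e \<le> 2"
  shows "has_bochner_integral (PiM I (\<lambda>_. std_complex_gaussian))
    (\<lambda>X. \<Prod>e\<in>I. X e ^ p e * cnj (X e) ^ q e) (\<Prod>e\<in>I. if p e = q e then fact (p e) else 0)"
proof -
  interpret product_prob_space "\<lambda>_. std_complex_gaussian" I
    by (rule product_prob_space_std_complex_gaussian)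
  have "(\<integral>X. (\<Prod>e\<in>I. X e ^ p e * cnj (X e) ^ q e) \<partial>PiM I (\<lambda>_. std_complex_gaussian))
      = (\<Prod>e\<in>I. \<integral>z. z ^ p e * cnj z ^ q e \<partial>std_complex_gaussian)"
    using assms by (intro product_integral_prod std_complex_gaussian_moments) auto
  also have "\<dots> = (\<Prod>e\<in>I. if p e = q e then fact (p e) else 0)"
    using assms by (intro prod.cong std_complex_gaussian_moments) auto
  finally show ?thesis
    using assms unfolding has_bochner_integral_iff
    by (intro conjI product_integrable_prod std_complex_gaussian_moments) auto
qed

text \<open>Special case of the product moments with 0/1 exponents: if \<open>e \<noteq> f\<close>,
  the coordinate \<open>e\<close> carries exponents 1 and 0, and its factor is 0.\<close>

lemma PiM_gaussian_covariance:
  assumes "finite I" "e \<in> I" "f \<in> I"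
  shows "has_bochner_integral (PiM I (\<lambda>_. std_complex_gaussian))
    (\<lambda>X. X e * cnj (X f)) (of_bool (e = f))"
proof -
  have X: "(\<Prod>g\<in>I. X g ^ of_bool (g = e) * cnj (X g) ^ of_bool (g = f)) = X e * cnj (X f)" for X
    using assms by (simp add: prod.distrib of_bool_def if_distrib[where f = "(^) _"] prod.delta'
        cong: if_cong)
  have "(\<Prod>g\<in>I. if of_bool (g = e) = (of_bool (g = f) :: nat)
      then fact (of_bool (g = e) :: nat) else 0) = (of_bool (e = f) :: complex)"
  proof (cases "e = f")
    case False
    then show ?thesis using assms by (auto intro!: prod_zero bexI[of _ e])
  qed (auto simp: of_bool_def intro!: prod.neutral)
  with PiM_gaussian_moments[OF assms(1), of "\<lambda>g. of_bool (g = e)" "\<lambda>g. of_bool (g = f)"]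
  show ?thesis by (simp add: X)
qed

text \<open>The coordinates are orthonormal, so only the diagonal terms survive. The coefficients
  \<open>a\<close> will be values at the minors, frozen while the first row is integrated.\<close>

lemma PiM_gaussian_linear_form:
  assumes I: "finite I"
  shows "(\<integral>\<^sup>+X. ennreal ((cmod (\<Sum>e\<in>I. X e * a e))\<^sup>2) \<partial>PiM I (\<lambda>_. std_complex_gaussian))
    = ennreal (\<Sum>e\<in>I. (cmod (a e))\<^sup>2)"
proof -
  let ?M = "PiM I (\<lambda>_. std_complex_gaussian)"
  have sq: "complex_of_real ((cmod (\<Sum>e\<in>I. X e * a e))\<^sup>2)
      = (\<Sum>e\<in>I. \<Sum>f\<in>I. a e * cnj (a f) * (X e * cnj (X f)))" for X
    unfolding complex_norm_square by (simp add: sum_product algebra_simps)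
  have "has_bochner_integral ?M (\<lambda>X. complex_of_real ((cmod (\<Sum>e\<in>I. X e * a e))\<^sup>2))
      (\<Sum>e\<in>I. \<Sum>f\<in>I. a e * cnj (a f) * of_bool (e = f))"
    unfolding sq
    by (intro has_bochner_integral_sum has_bochner_integral_mult_right PiM_gaussian_covariance I)
  also have "(\<Sum>e\<in>I. \<Sum>f\<in>I. a e * cnj (a f) * of_bool (e = f))
      = complex_of_real (\<Sum>e\<in>I. (cmod (a e))\<^sup>2)"
    using I by (simp add: of_bool_def if_distrib sum.delta complex_norm_square cong: if_cong del: of_real_power)
  finally have "has_bochner_integral ?M (\<lambda>X. (cmod (\<Sum>e\<in>I. X e * a e))\<^sup>2)
      (\<Sum>e\<in>I. (cmod (a e))\<^sup>2)"
    by (auto dest!: has_bochner_integral_bounded_linear[OF bounded_linear_Re]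
        simp del: of_real_power of_real_sum)
  then show ?thesis
    by (subst nn_integral_eq_integral) (auto simp: has_bochner_integral_iff)
qed

section \<open>Moments and expansion of the permanent\<close>

text \<open>Such a permutation is determined by its restrictions to \<open>S\<close> and
  \<open>A - S\<close>, which are injections into sets of the same sizes. Injectivity of this map
  already gives the upper bound.\<close>

lemma card_permutes_image_eq_le:
  assumes A: "finite A" and S: "S \<subseteq> A" and \<sigma>: "\<sigma> permutes A"
  shows "card {\<tau>. \<tau> permutes A \<and> \<tau> ` S = \<sigma> ` S} \<le> fact (card S) * fact (card A - card S)"
proof -
  let ?T = "{\<tau>. \<tau> permutes A \<and> \<tau> ` S = \<sigma> ` S}"
  let ?F = "\<lambda>B C. {f \<in> B \<rightarrow>\<^sub>E C. inj_on f B}"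
  let ?U = "\<sigma> ` S"
  have fin: "finite S" "finite ?U" using A S finite_subset by auto
  have inj: "inj_on \<tau> B" if "\<tau> permutes A" for \<tau> B
    using permutes_inj[OF that] by (rule inj_on_subset) simp
  have cU: "card ?U = card S" using inj[OF \<sigma>] by (rule card_image)
  have US: "?U \<subseteq> A" using S \<sigma> permutes_image by blast
  have diff: "\<tau> ` (A - S) = A - \<tau> ` S" if "\<tau> permutes A" for \<tau>
    using S permutes_image[OF that] inj[OF that, of A] by (auto simp: inj_on_image_set_diff)
  have cF: "card (?F B C) = fact (card B)" if "card B = card C" "finite B" "finite C" for B C :: "'a set"
    using card_inj_on_subset_funcset[of B C B] that by (simp add: fact_prod_rev)
  have finF: "finite (?F B C)" if "finite B" "finite C" for B C :: "'a set"
    by (rule finite_subset[of _ "B \<rightarrow>\<^sub>E C"]) (use that in \<open>auto intro: finite_PiE\<close>)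
  have "card ?T \<le> card (?F S ?U \<times> ?F (A - S) (A - ?U))"
  proof (rule card_inj_on_le)
    show "inj_on (\<lambda>\<tau>. (restrict \<tau> S, restrict \<tau> (A - S))) ?T"
    proof (rule inj_onI, clarsimp)
      fix \<tau> \<tau>' assume t: "\<tau> permutes A" "\<tau>' permutes A"
        "restrict \<tau> S = restrict \<tau>' S" "restrict \<tau> (A - S) = restrict \<tau>' (A - S)"
      show "\<tau> = \<tau>'"
      proof
        fix x show "\<tau> x = \<tau>' x"
          using t(3,4)[THEN fun_cong, of x] permutes_not_in[OF t(1), of x] permutes_not_in[OF t(2), of x]
          by (cases "x \<in> S"; cases "x \<in> A") auto
      qed
    qed
    show "(\<lambda>\<tau>. (restrict \<tau> S, restrict \<tau> (A - S))) ` ?T \<subseteq> ?F S ?U \<times> ?F (A - S) (A - ?U)"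
    proof clarify
      fix \<tau> assume t: "\<tau> permutes A" "\<tau> ` S = ?U"
      have "\<tau> ` (A - S) = A - ?U" using diff[OF t(1)] t(2) by simp
      then show "restrict \<tau> S \<in> ?F S ?U \<and> restrict \<tau> (A - S) \<in> ?F (A - S) (A - ?U)"
        using t inj[OF t(1)] by (auto simp: inj_on_restrict_eq)
    qed
    show "finite (?F S ?U \<times> ?F (A - S) (A - ?U))"
      using A fin by (intro finite_cartesian_product finF) auto
  qed
  also have "\<dots> = fact (card S) * fact (card (A - S))"
    using A S US fin cU by (simp add: card_cartesian_product cF card_Diff_subset)
  finally show ?thesis
    using A S fin by (simp add: card_Diff_subset)
qed

text \<open>The subsets of each fixed size m contribute binomial (card A) m times m! (card A - m)!,
  that is (card A)!, and there are card A + 1 sizes. This is the source of the factor k + 1 in the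
  fourth moment.\<close>

lemma sum_fact_card_Pow:
  assumes A: "finite A"
  shows "(\<Sum>S\<in>Pow A. fact (card S) * fact (card A - card S)) = (Suc (card A) * fact (card A) :: nat)"
proof -
  have "(\<Sum>S\<in>Pow A. fact (card S) * fact (card A - card S))
      = (\<Sum>m\<in>{..card A}. \<Sum>S | S \<in> Pow A \<and> card S = m. fact (card S) * fact (card A - card S) :: nat)"
    using A by (intro sum.group[symmetric]) (auto intro: card_mono)
  also have "\<dots> = (\<Sum>m\<in>{..card A}. fact (card A))"
  proof (intro sum.cong refl)
    fix m assume m: "m \<in> {..card A}"
    have "(\<Sum>S | S \<in> Pow A \<and> card S = m. fact (card S) * fact (card A - card S) :: nat)
      = (\<Sum>S | S \<in> Pow A \<and> card S = m. fact m * fact (card A - m))"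
      by (intro sum.cong) auto
    also have "\<dots> = fact (card A)"
      using m binomial_fact_lemma[of m "card A"] n_subsets[OF A, of m] by (simp add: algebra_simps)
    finally show "(\<Sum>S | S \<in> Pow A \<and> card S = m. fact (card S) * fact (card A - card S) :: nat) = fact (card A)" .
  qed
  finally show ?thesis by simp
qed

text \<open>Wick (Isserlis) formula: this is E[x_a x_b cnj x_c cnj x_d] for independent standard
  complex Gaussians, a sum over the two pairings of plain with conjugated factors. At a = b = c = d
  it equals E|x|^4 = 2.\<close>

definition wick :: "'a \<Rightarrow> 'a \<Rightarrow> 'a \<Rightarrow> 'a \<Rightarrow> real" where
  "wick a b c d = of_bool (a = c) * of_bool (b = d) + of_bool (a = d) * of_bool (b = c)"

text \<open>
  Expanding the product over the rows, each subset \<open>S\<close> of rows (those where \<open>\<sigma>\<close> is paired with \<open>\<alpha>\<close>)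
  forces \<open>\<alpha>\<close> and \<open>\<beta>\<close>, and they are permutations only if \<open>\<sigma>\<close> and \<open>\<tau>\<close> agree on the set \<open>S\<close>.
\<close>

lemma sum_wick_permutes_le:
  assumes A: "finite A"
  shows "(\<Sum>\<sigma> | \<sigma> permutes A. \<Sum>\<tau> | \<tau> permutes A. \<Sum>\<alpha> | \<alpha> permutes A. \<Sum>\<beta> | \<beta> permutes A.
      \<Prod>i\<in>A. wick (\<sigma> i) (\<tau> i) (\<alpha> i) (\<beta> i)) \<le> (card A + 1) * (fact (card A))\<^sup>2"
proof -
  let ?P = "{\<sigma>. \<sigma> permutes A}"
  have finP: "finite ?P" using A by (rule finite_permutations)
  define t where "t S \<sigma> \<tau> \<alpha> \<beta> = (\<Prod>i\<in>S. of_bool (\<sigma> i = \<alpha> i) * of_bool (\<tau> i = \<beta> i)) *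
      (\<Prod>i\<in>A - S. of_bool (\<sigma> i = \<beta> i) * of_bool (\<tau> i = \<alpha> i) :: real)"
    for S and \<sigma> \<tau> \<alpha> \<beta> :: "'a \<Rightarrow> 'a"
  have t: "t S \<sigma> \<tau> \<alpha> \<beta> = of_bool ((\<forall>i\<in>S. \<sigma> i = \<alpha> i \<and> \<tau> i = \<beta> i) \<and> (\<forall>i\<in>A - S. \<sigma> i = \<beta> i \<and> \<tau> i = \<alpha> i))"
    if "S \<subseteq> A" for S \<sigma> \<tau> \<alpha> \<beta>
  proof -
    have "finite S" "finite (A - S)" using that A finite_subset by auto
    then have "t S \<sigma> \<tau> \<alpha> \<beta> = of_bool (\<forall>i\<in>S. \<sigma> i = \<alpha> i \<and> \<tau> i = \<beta> i) *
        of_bool (\<forall>i\<in>A - S. \<sigma> i = \<beta> i \<and> \<tau> i = \<alpha> i)"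
      unfolding t_def of_bool_conj[symmetric] of_bool_def
      by (intro arg_cong2[where f = "(*)"]) (auto intro: prod.neutral)
    then show ?thesis by (simp only: of_bool_conj)
  qed
  have inner: "(\<Sum>\<alpha>\<in>?P. \<Sum>\<beta>\<in>?P. t S \<sigma> \<tau> \<alpha> \<beta>) \<le> of_bool (\<tau> ` S = \<sigma> ` S)"
    if S: "S \<subseteq> A" and st: "\<sigma> \<in> ?P" "\<tau> \<in> ?P" for S \<sigma> \<tau>
  proof -
    \<comment> \<open>Given \<open>S\<close>, \<open>\<sigma>\<close> and \<open>\<tau>\<close>,
      these are the only candidates for \<open>\<alpha>\<close> and \<open>\<beta>\<close>, so the
      inner double sum has at most one nonzero term.\<close>
    define \<alpha>0 where "\<alpha>0 i = (if i \<in> S then \<sigma> i else if i \<in> A then \<tau> i else i)" for i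
    define \<beta>0 where "\<beta>0 i = (if i \<in> S then \<tau> i else if i \<in> A then \<sigma> i else i)" for i
    have le: "t S \<sigma> \<tau> \<alpha> \<beta> \<le> (if \<alpha> = \<alpha>0 then (if \<beta> = \<beta>0 then of_bool (\<tau> ` S = \<sigma> ` S) else 0) else 0)"
      if ab: "\<alpha> \<in> ?P" "\<beta> \<in> ?P" for \<alpha> \<beta>
    proof (cases "(\<forall>i\<in>S. \<sigma> i = \<alpha> i \<and> \<tau> i = \<beta> i) \<and> (\<forall>i\<in>A - S. \<sigma> i = \<beta> i \<and> \<tau> i = \<alpha> i)")
      case True
      have "\<alpha> = \<alpha>0" "\<beta> = \<beta>0"
        using True ab by (auto simp: fun_eq_iff \<alpha>0_def \<beta>0_def permutes_not_in)
      have diff: "\<pi> ` (A - S) = A - \<pi> ` S" if "\<pi> permutes A" for \<pi>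
        using S permutes_image[OF that] permutes_inj_on[OF that, of A] by (auto simp: inj_on_image_set_diff)
      \<comment> \<open>\<open>\<alpha>\<close> follows \<open>\<sigma>\<close> on \<open>S\<close>
        and \<open>\<tau>\<close> off \<open>S\<close>. Since \<open>\<alpha>\<close> and
        \<open>\<tau>\<close> are permutations that agree off \<open>S\<close>, they have the same
        image of \<open>S\<close>.\<close>
      have "\<sigma> ` S = \<alpha> ` S" using True by (auto simp: image_iff)
      moreover have "\<tau> ` (A - S) = \<alpha> ` (A - S)" using True by (auto simp: image_iff)
      then have "A - \<tau> ` S = A - \<alpha> ` S" using diff st(2) ab(1) by auto
      then have "\<tau> ` S = \<alpha> ` S"
        using S st(2) ab(1) permutes_image[of \<tau> A] permutes_image[of \<alpha> A] by blast
      ultimately show ?thesis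
        using \<open>\<alpha> = \<alpha>0\<close> \<open>\<beta> = \<beta>0\<close> by (simp add: t[OF S])
    next
      case False
      then show ?thesis by (simp only: t[OF S]) auto
    qed
    have "(\<Sum>\<alpha>\<in>?P. \<Sum>\<beta>\<in>?P. t S \<sigma> \<tau> \<alpha> \<beta>)
        \<le> (\<Sum>\<alpha>\<in>?P. \<Sum>\<beta>\<in>?P. (if \<alpha> = \<alpha>0 then (if \<beta> = \<beta>0 then of_bool (\<tau> ` S = \<sigma> ` S) else 0) else 0))"
      by (intro sum_mono le)
    also have "\<dots> = (\<Sum>\<alpha>\<in>?P. if \<alpha> = \<alpha>0 then (\<Sum>\<beta>\<in>?P. if \<beta> = \<beta>0 then of_bool (\<tau> ` S = \<sigma> ` S) else 0) else 0)"
      by (intro sum.cong) auto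
    also have "\<dots> \<le> of_bool (\<tau> ` S = \<sigma> ` S)"
      unfolding sum.delta[OF finP] by auto
    finally show ?thesis .
  qed
  have "(\<Sum>\<sigma>\<in>?P. \<Sum>\<tau>\<in>?P. \<Sum>\<alpha>\<in>?P. \<Sum>\<beta>\<in>?P. \<Prod>i\<in>A. wick (\<sigma> i) (\<tau> i) (\<alpha> i) (\<beta> i))
      = (\<Sum>\<sigma>\<in>?P. \<Sum>\<tau>\<in>?P. \<Sum>\<alpha>\<in>?P. \<Sum>\<beta>\<in>?P. \<Sum>S\<in>Pow A. t S \<sigma> \<tau> \<alpha> \<beta>)"
    unfolding wick_def t_def prod_add[OF A] ..
  also have "\<dots> = (\<Sum>S\<in>Pow A. \<Sum>\<sigma>\<in>?P. \<Sum>\<tau>\<in>?P. \<Sum>\<alpha>\<in>?P. \<Sum>\<beta>\<in>?P. t S \<sigma> \<tau> \<alpha> \<beta>)"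
    by (simp only: sum.swap[where B = "Pow A"])
  also have "\<dots> \<le> (\<Sum>S\<in>Pow A. \<Sum>\<sigma>\<in>?P. \<Sum>\<tau>\<in>?P. of_bool (\<tau> ` S = \<sigma> ` S))"
    by (intro sum_mono inner) auto
  also have "\<dots> = (\<Sum>S\<in>Pow A. \<Sum>\<sigma>\<in>?P. real (card {\<tau>. \<tau> permutes A \<and> \<tau> ` S = \<sigma> ` S}))"
  proof (intro sum.cong refl)
    fix S \<sigma>
    have "{\<tau>. \<tau> permutes A \<and> \<tau> ` S = \<sigma> ` S} = ?P \<inter> {\<tau>. \<tau> ` S = \<sigma> ` S}" by auto
    then show "(\<Sum>\<tau>\<in>?P. of_bool (\<tau> ` S = \<sigma> ` S)) = real (card {\<tau>. \<tau> permutes A \<and> \<tau> ` S = \<sigma> ` S})"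
      using finP by (simp only: sum_of_bool_eq)
  qed
  also have "\<dots> \<le> (\<Sum>S\<in>Pow A. \<Sum>\<sigma>\<in>?P. real (fact (card S) * fact (card A - card S)))"
    using A by (intro sum_mono of_nat_mono card_permutes_image_eq_le) auto
  also have "\<dots> = fact (card A) * real (\<Sum>S\<in>Pow A. fact (card S) * fact (card A - card S))"
    using A by (simp add: card_permutations sum_distrib_left)
  also have "\<dots> = (card A + 1) * (fact (card A))\<^sup>2"
    unfolding sum_fact_card_Pow[OF A] by (simp add: power2_eq_square algebra_simps)
  finally show ?thesis .
qed

text \<open>\<open>p\<close> and \<open>q\<close> are the multiplicity functions of the multisets
  {a, b} and {c, d}. The product is nonzero only if these agree, and is then 2 or 1 according to
  whether \<open>a = b\<close>, just as one or both pairings count.\<close>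

lemma prod_gaussian_moments_eq_wick:
  assumes J: "finite J" "a \<in> J" "b \<in> J" "c \<in> J" "d \<in> J"
  defines "p \<equiv> \<lambda>j. of_bool (j = a) + of_bool (j = b) :: nat"
    and "q \<equiv> \<lambda>j. of_bool (j = c) + of_bool (j = d) :: nat"
  shows "(\<Prod>j\<in>J. if p j = q j then fact (p j) else 0) = complex_of_real (wick a b c d)"
proof (cases "(a = c \<and> b = d) \<or> (a = d \<and> b = c)")
  case True
  then have pq: "p j = q j" for j
    by (elim disjE conjE) (simp_all add: p_def q_def)
  have "fact (p j) = (if j = a then (if a = b then 2 else 1) else (1 :: complex))" for j
    by (simp add: p_def)
  then have "(\<Prod>j\<in>J. if p j = q j then fact (p j) else 0) = (if a = b then 2 else (1 :: complex))"
    using J(1,2) by (simp add: pq)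
  moreover have "wick a b c d = (if a = b then 2 else 1)"
    using True by (elim disjE conjE) (simp_all add: wick_def)
  ultimately show ?thesis by simp
next
  case False
  then have "\<exists>j\<in>J. p j \<noteq> q j"
  proof -
    have "p a \<noteq> q a \<or> p b \<noteq> q b"
    proof (cases "a = c")
      case True
      then show ?thesis using False by (simp add: p_def q_def)
    next
      case False': False
      show ?thesis
      proof (cases "a = d")
        case True
        then show ?thesis using False by (simp add: p_def q_def)
      next
        case False
        then show ?thesis using False' by (simp add: p_def q_def)
      qed
    qed
    then show ?thesis using J by blast
  qed
  then have "(\<Prod>j\<in>J. if p j = q j then fact (p j) else (0 :: complex)) = 0"
    using J by (auto intro!: prod_zero)
  moreover have "wick a b c d = 0"
    unfolding wick_def by (cases "a = c"; cases "a = d") (use False in simp_all)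
  ultimately show ?thesis by simp
qed

section \<open>The Gaussian matrix ensemble and the fourth moment of the permanent\<close>

lemma finite_indices[simp]: "finite (indices k)"
  by (simp add: indices_def)

lemma space_gauss: "space (gauss k) = cmatrices k"
  by (simp add: gauss_def cmatrices_def space_PiM)

lemma prob_space_gauss: "prob_space (gauss k)"
  unfolding gauss_def by (intro prob_space_PiM prob_space_std_complex_gaussian)

lemma measurable_entry:
  assumes "i \<in> {1..k}" "j \<in> {1..k}"
  shows "(\<lambda>X. X (i, j)) \<in> borel_measurable (gauss k)"
proof -
  have "(\<lambda>X. X (i, j)) \<in> gauss k \<rightarrow>\<^sub>M std_complex_gaussian"
    unfolding gauss_def using assms by (intro measurable_component_singleton) (auto simp: indices_def)
  then show ?thesis using measurable_cong_sets[OF refl sets_std_complex_gaussian] by blast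
qed

lemma measurable_Per[measurable]: "Per k \<in> borel_measurable (gauss k)"
  unfolding Per_def[abs_def]
  by (intro borel_measurable_sum borel_measurable_prod measurable_entry)
    (auto dest: permutes_in_image)

text \<open>The rows are independent and each contributes one four-factor expectation. The exponents
  of entry (i, j) count how many of \<open>\<sigma>\<close>, \<open>\<tau>\<close>, respectively of
  \<open>\<alpha>\<close>, \<open>\<beta>\<close>, send i to j.\<close>

lemma gauss_row_monomial:
  assumes "\<And>i. i \<in> {1..k} \<Longrightarrow> \<sigma> i \<in> {1..k} \<and> \<tau> i \<in> {1..k} \<and> \<alpha> i \<in> {1..k} \<and> \<beta> i \<in> {1..k}"
  shows "has_bochner_integral (gauss k)
    (\<lambda>X. \<Prod>i = 1..k. X (i, \<sigma> i) * X (i, \<tau> i) * (cnj (X (i, \<alpha> i)) * cnj (X (i, \<beta> i))))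
    (complex_of_real (\<Prod>i = 1..k. wick (\<sigma> i) (\<tau> i) (\<alpha> i) (\<beta> i)))"
proof -
  define p where "p e = of_bool (snd e = \<sigma> (fst e)) + (of_bool (snd e = \<tau> (fst e)) :: nat)" for e :: "nat \<times> nat"
  define q where "q e = of_bool (snd e = \<alpha> (fst e)) + (of_bool (snd e = \<beta> (fst e)) :: nat)" for e :: "nat \<times> nat"
  have cart: "(\<Prod>e\<in>indices k. f e) = (\<Prod>i = 1..k. \<Prod>j = 1..k. f (i, j))" for f :: "nat \<times> nat \<Rightarrow> complex"
    unfolding indices_def by (simp add: prod.cartesian_product)
  have "has_bochner_integral (gauss k) (\<lambda>X. \<Prod>e\<in>indices k. X e ^ p e * cnj (X e) ^ q e)
      (\<Prod>e\<in>indices k. if p e = q e then fact (p e) else 0)"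
    unfolding gauss_def by (rule PiM_gaussian_moments) (auto simp: p_def q_def)
  also have "(\<lambda>X. \<Prod>e\<in>indices k. X e ^ p e * cnj (X e) ^ q e) =
      (\<lambda>X. \<Prod>i = 1..k. X (i, \<sigma> i) * X (i, \<tau> i) * (cnj (X (i, \<alpha> i)) * cnj (X (i, \<beta> i))))"
    unfolding cart
  proof (intro ext prod.cong refl)
    fix X :: cmatrix and i assume "i \<in> {1..k}"
    have one: "(\<Prod>j = 1..k. f j ^ of_bool (j = a)) = f a" if "a \<in> {1..k}" for a and f :: "nat \<Rightarrow> complex"
      using that by (simp add: of_bool_def if_distrib[where f = "(^) _"] prod.delta cong: if_cong)
    show "(\<Prod>j = 1..k. X (i, j) ^ p (i, j) * cnj (X (i, j)) ^ q (i, j))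
      = X (i, \<sigma> i) * X (i, \<tau> i) * (cnj (X (i, \<alpha> i)) * cnj (X (i, \<beta> i)))"
      using assms[OF \<open>i \<in> {1..k}\<close>]
      by (simp only: p_def q_def fst_conv snd_conv power_add prod.distrib one)
  qed
  also have "(\<Prod>e\<in>indices k. if p e = q e then fact (p e) else 0)
      = (\<Prod>i = 1..k. complex_of_real (wick (\<sigma> i) (\<tau> i) (\<alpha> i) (\<beta> i)))"
    unfolding cart p_def q_def fst_conv snd_conv
    using assms by (intro prod.cong refl prod_gaussian_moments_eq_wick) auto
  finally show ?thesis by simp
qed

text \<open>Expanding Per^2 times its conjugate square gives a sum over quadruples of permutations,
  whose expectation is the sum of Wick products bounded above. The value is real, so taking real
  parts returns to the real integral.\<close>

lemma Per_fourth_moment: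
  "(\<integral>\<^sup>+X. ennreal (cmod (Per k X) ^ 4) \<partial>gauss k) \<le> ennreal ((real k + 1) * (fact k)\<^sup>2)"
proof -
  let ?P = "{\<pi>. \<pi> permutes {1..k}}"
  let ?w = "\<Sum>\<sigma>\<in>?P. \<Sum>\<tau>\<in>?P. \<Sum>\<alpha>\<in>?P. \<Sum>\<beta>\<in>?P. \<Prod>i = 1..k. wick (\<sigma> i) (\<tau> i) (\<alpha> i) (\<beta> i)"
  have expand: "complex_of_real (cmod (Per k X) ^ 4) = (\<Sum>\<sigma>\<in>?P. \<Sum>\<tau>\<in>?P. \<Sum>\<alpha>\<in>?P. \<Sum>\<beta>\<in>?P.
      \<Prod>i = 1..k. X (i, \<sigma> i) * X (i, \<tau> i) * (cnj (X (i, \<alpha> i)) * cnj (X (i, \<beta> i))))" for X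
  proof -
    have "complex_of_real (cmod (Per k X) ^ 4) = complex_of_real ((cmod (Per k X))\<^sup>2) * complex_of_real ((cmod (Per k X))\<^sup>2)"
      unfolding of_real_mult[symmetric] power_add[symmetric] by simp
    also have "\<dots> = Per k X * Per k X * (cnj (Per k X) * cnj (Per k X))"
      unfolding complex_norm_square by (simp add: algebra_simps)
    also have "\<dots> = (\<Sum>\<sigma>\<in>?P. \<Sum>\<tau>\<in>?P. (\<Prod>i = 1..k. X (i, \<sigma> i)) * (\<Prod>i = 1..k. X (i, \<tau> i))) *
        (\<Sum>\<alpha>\<in>?P. \<Sum>\<beta>\<in>?P. (\<Prod>i = 1..k. cnj (X (i, \<alpha> i))) * (\<Prod>i = 1..k. cnj (X (i, \<beta> i))))"
      by (simp add: Per_def sum_product)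
    also have "\<dots> = (\<Sum>\<sigma>\<in>?P. \<Sum>\<tau>\<in>?P. \<Sum>\<alpha>\<in>?P. \<Sum>\<beta>\<in>?P.
      \<Prod>i = 1..k. X (i, \<sigma> i) * X (i, \<tau> i) * (cnj (X (i, \<alpha> i)) * cnj (X (i, \<beta> i))))"
      unfolding sum_distrib_right unfolding sum_distrib_left prod.distrib ..
    finally show ?thesis .
  qed
  have "has_bochner_integral (gauss k) (\<lambda>X. complex_of_real (cmod (Per k X) ^ 4))
    (\<Sum>\<sigma>\<in>?P. \<Sum>\<tau>\<in>?P. \<Sum>\<alpha>\<in>?P. \<Sum>\<beta>\<in>?P.
      complex_of_real (\<Prod>i = 1..k. wick (\<sigma> i) (\<tau> i) (\<alpha> i) (\<beta> i)))"
    unfolding expand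
    by (intro has_bochner_integral_sum gauss_row_monomial) (auto dest: permutes_in_image)
  then have "has_bochner_integral (gauss k) (\<lambda>X. complex_of_real (cmod (Per k X) ^ 4)) (complex_of_real ?w)"
    by (simp only: of_real_sum)
  from has_bochner_integral_bounded_linear[OF bounded_linear_Re this]
  have "has_bochner_integral (gauss k) (\<lambda>X. cmod (Per k X) ^ 4) ?w"
    by (simp only: Re_complex_of_real)
  then have "(\<integral>\<^sup>+X. ennreal (cmod (Per k X) ^ 4) \<partial>gauss k) = ennreal ?w"
    by (subst nn_integral_eq_integral) (auto simp: has_bochner_integral_iff)
  also have "\<dots> \<le> ennreal ((real k + 1) * (fact k)\<^sup>2)"
    using sum_wick_permutes_le[of "{1..k}"] by (intro ennreal_leI) (simp add: algebra_simps)
  finally show ?thesis .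
qed

section \<open>Minors and the first row of a Gaussian matrix\<close>

text \<open>A minor reads off i.i.d. entries along an injective index map. The index set
  \<open>K\<close> is kept general so as to cover both the full matrix and the matrix without its
  first row.\<close>

lemma minor_distr:
  assumes K: "{2..k} \<times> {1..k} \<subseteq> K"
  shows "distr (PiM K (\<lambda>_. std_complex_gaussian)) (gauss (k - 1)) (minor k i) = gauss (k - 1)"
proof -
  define f where "f = (\<lambda>(a :: nat, b). (a + 1, if b < i then b else b + 1 :: nat))"
  have "minor k i = (\<lambda>\<omega>. \<lambda>e\<in>indices (k - 1). \<omega> (f e))"
    unfolding minor_def by (intro ext) (auto simp: restrict_def f_def)
  moreover have "inj_on f (indices (k - 1))"
    by (rule inj_onI) (auto simp: f_def split: if_splits)
  moreover have "f \<in> indices (k - 1) \<rightarrow> K"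
    by (rule Pi_I, rule subsetD[OF K]) (auto simp: f_def indices_def split: if_splits)
  ultimately show ?thesis
    using distr_PiM_reindex[of K "\<lambda>_. std_complex_gaussian" f "indices (k - 1)"]
    by (simp add: gauss_def prob_space_std_complex_gaussian)
qed

lemma measurable_minor:
  assumes K: "{2..k} \<times> {1..k} \<subseteq> K"
  shows "minor k i \<in> PiM K (\<lambda>_. std_complex_gaussian) \<rightarrow>\<^sub>M gauss (k - 1)"
proof -
  have "(\<lambda>\<omega>. \<lambda>(a, b)\<in>indices (k - 1). \<omega> (a + 1, if b < i then b else b + 1))
      \<in> PiM K (\<lambda>_. std_complex_gaussian) \<rightarrow>\<^sub>M gauss (k - 1)"
    unfolding gauss_def
    unfolding split_beta'
    by (intro measurable_restrict measurable_component_singleton subsetD[OF K]) (auto simp: indices_def)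
  then show ?thesis by (simp add: minor_def[abs_def])
qed

lemma measurable_minor_gauss[measurable]: "minor k i \<in> gauss k \<rightarrow>\<^sub>M gauss (k - 1)"
  unfolding gauss_def[of k] by (intro measurable_minor) (auto simp: indices_def)

lemma minor_distr_gauss: "distr (gauss k) (gauss (k - 1)) (minor k i) = gauss (k - 1)"
  unfolding gauss_def[of k] by (intro minor_distr) (auto simp: indices_def)

text \<open>No minor involves the first row, so the row can be integrated with the other rows fixed.
  Orthogonality removes the cross terms, so dependence between the minors is harmless, and each of
  the \<open>k\<close> remaining terms has the same integral.\<close>

lemma gauss_row_linear_form:
  assumes g[measurable]: "g \<in> borel_measurable (gauss (k - 1))" and k: "1 \<le> k"
  shows "(\<integral>\<^sup>+X. ennreal ((cmod (\<Sum>i = 1..k. X (1, i) * g (minor k i X)))\<^sup>2) \<partial>gauss k)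
    = of_nat k * (\<integral>\<^sup>+Y. ennreal ((cmod (g Y))\<^sup>2) \<partial>gauss (k - 1))"
proof -
  let ?G = "\<lambda>_ :: nat \<times> nat. std_complex_gaussian"
  let ?R = "{1 :: nat} \<times> {1..k}" and ?S = "{2..k} \<times> {1..k}"
  interpret product_prob_space ?G "indices k" by (rule product_prob_space_std_complex_gaussian)
  let ?F = "\<lambda>X. ennreal ((cmod (\<Sum>i = 1..k. X (1, i) * g (minor k i X)))\<^sup>2)"
  have ind: "indices k = ?S \<union> ?R" using k by (auto simp: indices_def)
  have F: "?F \<in> borel_measurable (gauss k)"
  proof -
    have "(\<lambda>X. X (1, i) * g (minor k i X)) \<in> borel_measurable (gauss k)" if "i \<in> {1..k}" for i
      using that k
      by (intro borel_measurable_times measurable_entry measurable_compose[OF measurable_minor_gauss g]) auto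
    then have "(\<lambda>X. \<Sum>i = 1..k. X (1, i) * g (minor k i X)) \<in> borel_measurable (gauss k)"
      by (rule borel_measurable_sum)
    then show ?thesis by measurable
  qed
  have merge_minor: "minor k i (merge ?S ?R (y, x)) = minor k i y" for x y i
    unfolding minor_def
    by (intro restrict_ext) (auto simp: indices_def merge_def)
  have merge_row: "merge ?S ?R (y, x) (1, i) = x (1, i)" if "i \<in> {1..k}" for x y i
    using that by (simp add: merge_def)
  have sum_row: "(\<Sum>e\<in>?R. h e) = (\<Sum>i = 1..k. h (1, i))"
    "(\<Sum>e\<in>?R. h' e) = (\<Sum>i = 1..k. h' (1, i))"
    for h :: "nat \<times> nat \<Rightarrow> complex" and h' :: "nat \<times> nat \<Rightarrow> real"
    using sum.cartesian_product[of "\<lambda>a b. h (a, b)" "{1..k}" "{1}"]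
      sum.cartesian_product[of "\<lambda>a b. h' (a, b)" "{1..k}" "{1}"] by simp_all
  have g_meas: "(\<lambda>y. ennreal ((cmod (g (minor k i y)))\<^sup>2)) \<in> borel_measurable (PiM ?S ?G)" for i
  proof (rule measurable_compose[OF measurable_minor])
    show "(\<lambda>Y. ennreal ((cmod (g Y))\<^sup>2)) \<in> borel_measurable (gauss (k - 1))" by measurable
  qed simp
  \<comment> \<open>Fubini: the lower rows \<open>y\<close> outside, the first row \<open>x\<close>
    inside.\<close>
  have "(\<integral>\<^sup>+X. ?F X \<partial>gauss k) = (\<integral>\<^sup>+y. \<integral>\<^sup>+x. ?F (merge ?S ?R (y, x)) \<partial>PiM ?R ?G \<partial>PiM ?S ?G)"
    unfolding gauss_def ind
    by (rule product_nn_integral_fold) (use F in \<open>auto simp: gauss_def ind\<close>)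
  also have "\<dots> = (\<integral>\<^sup>+y. \<integral>\<^sup>+x. ennreal ((cmod (\<Sum>e\<in>?R. x e * g (minor k (snd e) y)))\<^sup>2) \<partial>PiM ?R ?G \<partial>PiM ?S ?G)"
    by (simp only: merge_minor merge_row sum_row snd_conv cong: sum.cong)
  also have "\<dots> = (\<integral>\<^sup>+y. ennreal (\<Sum>e\<in>?R. (cmod (g (minor k (snd e) y)))\<^sup>2) \<partial>PiM ?S ?G)"
    by (intro nn_integral_cong PiM_gaussian_linear_form) simp
  also have "\<dots> = (\<integral>\<^sup>+y. (\<Sum>i = 1..k. ennreal ((cmod (g (minor k i y)))\<^sup>2)) \<partial>PiM ?S ?G)"
    by (simp only: sum_row snd_conv) simp
  also have "\<dots> = (\<Sum>i = 1..k. \<integral>\<^sup>+y. ennreal ((cmod (g (minor k i y)))\<^sup>2) \<partial>PiM ?S ?G)"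
    by (intro nn_integral_sum g_meas)
  also have "\<dots> = (\<Sum>i = 1..k. \<integral>\<^sup>+Y. ennreal ((cmod (g Y))\<^sup>2) \<partial>gauss (k - 1))"
  proof (intro sum.cong refl)
    fix i
    have "(\<integral>\<^sup>+Y. ennreal ((cmod (g Y))\<^sup>2) \<partial>gauss (k - 1))
        = (\<integral>\<^sup>+Y. ennreal ((cmod (g Y))\<^sup>2) \<partial>distr (PiM ?S ?G) (gauss (k - 1)) (minor k i))"
      by (subst minor_distr) auto
    also have "\<dots> = (\<integral>\<^sup>+y. ennreal ((cmod (g (minor k i y)))\<^sup>2) \<partial>PiM ?S ?G)"
      by (rule nn_integral_distr[OF measurable_minor[OF order_refl]]) measurable
    finally show "(\<integral>\<^sup>+y. ennreal ((cmod (g (minor k i y)))\<^sup>2) \<partial>PiM ?S ?G)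
      = (\<integral>\<^sup>+Y. ennreal ((cmod (g Y))\<^sup>2) \<partial>gauss (k - 1))" by simp
  qed
  finally show ?thesis by simp
qed

lemma measurable_row_norm: "(\<lambda>X. \<Sum>i = 1..k. (cmod (X (1, i)))\<^sup>2) \<in> borel_measurable (gauss k)"
proof (rule borel_measurable_sum)
  fix i assume i: "i \<in> {1..k}"
  then have [measurable]: "(\<lambda>X. X (1, i)) \<in> borel_measurable (gauss k)"
    by (intro measurable_entry) auto
  show "(\<lambda>X. (cmod (X (1, i)))\<^sup>2) \<in> borel_measurable (gauss k)" by measurable
qed

text \<open>Chernoff bound: for the squared row norm N, E exp(N / 2) = 2^k by independence.\<close>

lemma gauss_row_norm_tail:
  "measure (gauss k) {X \<in> space (gauss k). s < (\<Sum>i = 1..k. (cmod (X (1, i)))\<^sup>2)}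
    \<le> 2 ^ k * exp (- s / 2)"
proof (cases "k = 0")
  case True
  interpret prob_space "gauss k" by (rule prob_space_gauss)
  show ?thesis
  proof (cases "s < 0")
    case True
    have "measure (gauss k) {X \<in> space (gauss k). s < (\<Sum>i = 1..k. (cmod (X (1, i)))\<^sup>2)} \<le> 1"
      by (rule prob_le_1)
    also have "1 \<le> exp (- s / 2)" using True by simp
    finally show ?thesis using \<open>k = 0\<close> by simp
  next
    case False
    then show ?thesis using \<open>k = 0\<close> by simp
  qed
next
  case False
  let ?G = "\<lambda>_ :: nat \<times> nat. std_complex_gaussian"
  interpret product_prob_space ?G "indices k" by (rule product_prob_space_std_complex_gaussian)
  interpret gauss: prob_space "gauss k" by (rule prob_space_gauss)
  let ?N = "\<lambda>X. \<Sum>i = 1..k. (cmod (X (1, i)))\<^sup>2"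
  let ?A = "{X \<in> space (gauss k). s < ?N X}"
  have [measurable]: "?N \<in> borel_measurable (gauss k)"
    by (rule measurable_row_norm)
  \<comment> \<open>Padding with 1 outside the first row turns exp(N / 2) into a product over all
    entries, as required by the product integral.\<close>
  define f where "f e z = (if fst e = 1 then ennreal (exp ((cmod z)\<^sup>2 / 2)) else 1)" for e :: "nat \<times> nat" and z
  have f_meas: "f e \<in> borel_measurable std_complex_gaussian" for e
    unfolding f_def by measurable
  have split: "(\<Prod>e\<in>indices k. if fst e = 1 then h (snd e) else 1) = (\<Prod>i = 1..k. h i)"
    for h :: "nat \<Rightarrow> ennreal"
  proof -
    have "(\<Prod>e\<in>indices k. if fst e = 1 then h (snd e) else 1)
        = (\<Prod>i = 1..k. \<Prod>j = 1..k. if i = 1 then h j else 1)"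
      unfolding indices_def prod.cartesian_product by (intro prod.cong) auto
    also have "\<dots> = (\<Prod>i = 1..k. if i = 1 then (\<Prod>j = 1..k. h j) else 1)"
      by (intro prod.cong) auto
    also have "\<dots> = (\<Prod>j = 1..k. h j)" using False by (subst prod.delta) auto
    finally show ?thesis .
  qed
  have exp_N: "(\<Prod>e\<in>indices k. f e (X e)) = ennreal (exp (?N X / 2))" for X
  proof -
    have "(\<Prod>e\<in>indices k. f e (X e))
        = (\<Prod>e\<in>indices k. if fst e = 1 then ennreal (exp ((cmod (X (1, snd e)))\<^sup>2 / 2)) else 1)"
      unfolding f_def by (intro prod.cong refl) (auto simp: indices_def)
    also have "\<dots> = ennreal (exp (?N X / 2))"
      by (subst split) (simp add: prod_ennreal exp_sum sum_divide_distrib)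
    finally show ?thesis .
  qed
  have "emeasure (gauss k) ?A = (\<integral>\<^sup>+X. indicator ?A X \<partial>gauss k)"
    by (rule nn_integral_indicator[symmetric]) measurable
  also have "\<dots> \<le> (\<integral>\<^sup>+X. ennreal (exp (- s / 2)) * (\<Prod>e\<in>indices k. f e (X e)) \<partial>gauss k)"
  proof (rule nn_integral_mono)
    fix X :: cmatrix
    have "1 \<le> exp (- s / 2) * exp (?N X / 2)" if "s < ?N X"
      using that unfolding exp_add[symmetric] one_le_exp_iff by linarith
    then show "indicator ?A X \<le> ennreal (exp (- s / 2)) * (\<Prod>e\<in>indices k. f e (X e))"
      unfolding exp_N by (cases "s < ?N X") (auto simp: ennreal_mult[symmetric] indicator_def)
  qed
  also have "\<dots> = ennreal (exp (- s / 2)) * (\<integral>\<^sup>+X. (\<Prod>e\<in>indices k. f e (X e)) \<partial>gauss k)"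
    unfolding exp_N by (intro nn_integral_cmult) measurable
  also have "(\<integral>\<^sup>+X. (\<Prod>e\<in>indices k. f e (X e)) \<partial>gauss k) = (\<Prod>e\<in>indices k. integral\<^sup>N std_complex_gaussian (f e))"
    unfolding gauss_def by (intro product_nn_integral_prod f_meas) auto
  also have "\<dots> = (\<Prod>e\<in>indices k. if fst e = 1 then 2 else 1)"
    by (intro prod.cong refl) (simp add: f_def[abs_def] gaussian_exp_moment M.emeasure_space_1[simplified])
  also have "\<dots> = 2 ^ k" using split[of "\<lambda>_. 2"] by simp
  also have "\<dots> = ennreal (2 ^ k)" using ennreal_power[of 2 k] by simp
  finally have "ennreal (measure (gauss k) ?A) \<le> ennreal (2 ^ k * exp (- s / 2))"
    unfolding gauss.emeasure_eq_measure ennreal_mult[symmetric, OF exp_ge_zero zero_le_power[OF zero_le_numeral]]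
    by (simp only: mult.commute)
  then show ?thesis by simp
qed

text \<open>The event contains a product of discs of squared radius 1/k, each of positive
  probability.\<close>

lemma gauss_row_norm_le_1_pos:
  assumes "1 \<le> k"
  shows "0 < measure (gauss k) {X \<in> space (gauss k). (\<Sum>i = 1..k. (cmod (X (1, i)))\<^sup>2) \<le> 1}"
proof -
  let ?G = "\<lambda>_ :: nat \<times> nat. std_complex_gaussian"
  let ?D = "{z. (cmod z)\<^sup>2 \<le> 1 / real k}"
  interpret gauss: prob_space "gauss k" by (rule prob_space_gauss)
  interpret product_prob_space ?G "indices k" by (rule product_prob_space_std_complex_gaussian)
  interpret finite_product_prob_space ?G "indices k" by standard simp
  let ?N = "\<lambda>X. \<Sum>i = 1..k. (cmod (X (1, i)))\<^sup>2"
  have [measurable]: "?N \<in> borel_measurable (gauss k)"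
    by (rule measurable_row_norm)
  have "0 < (\<Prod>e\<in>indices k. measure std_complex_gaussian ?D)"
    using assms by (intro prod_pos ballI gaussian_disc_pos) auto
  also have "\<dots> = measure (gauss k) (indices k \<rightarrow>\<^sub>E ?D)"
    unfolding gauss_def by (subst prob_times) auto
  also have "\<dots> \<le> measure (gauss k) {X \<in> space (gauss k). ?N X \<le> 1}"
  proof (rule gauss.finite_measure_mono)
    show "indices k \<rightarrow>\<^sub>E ?D \<subseteq> {X \<in> space (gauss k). ?N X \<le> 1}"
    proof
      fix X assume X: "X \<in> indices k \<rightarrow>\<^sub>E ?D"
      have "?N X \<le> (\<Sum>i = 1..k. 1 / real k)"
        using X assms by (intro sum_mono) (auto simp: indices_def PiE_iff)
      then show "X \<in> {X \<in> space (gauss k). ?N X \<le> 1}"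
        using X assms by (auto simp: space_gauss cmatrices_def)
    qed
  qed measurable
  finally show ?thesis .
qed

section \<open>Laplace expansion of the permanent along the first row\<close>

text \<open>The permutation sending row 1 to column \<open>i\<close> and the remaining rows as
  \<open>\<pi>\<close> does, with columns renumbered to skip \<open>i\<close> exactly as in
  \<open>minor\<close>.\<close>

definition insert_column :: "nat \<Rightarrow> nat \<Rightarrow> (nat \<Rightarrow> nat) \<Rightarrow> nat \<Rightarrow> nat" where
  "insert_column k i \<pi> a = (if a = 1 then i else if a \<in> {2..k} then
    (if \<pi> (a - 1) < i then \<pi> (a - 1) else \<pi> (a - 1) + 1) else a)"

text \<open>Injectivity is checked directly; surjectivity follows by counting, as k (k - 1)! =
  k!.\<close>

lemma bij_betw_insert_column:
  assumes k: "1 \<le> k"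
  shows "bij_betw (\<lambda>(i, \<pi>). insert_column k i \<pi>)
    ({1..k} \<times> {\<pi>. \<pi> permutes {1..k - 1}}) {\<sigma>. \<sigma> permutes {1..k}}"
proof -
  let ?D = "{1..k} \<times> {\<pi>. \<pi> permutes {1..k - 1}}" and ?f = "\<lambda>(i, \<pi>). insert_column k i \<pi>"
  have inj: "inj_on ?f ?D"
  proof (rule inj_onI, clarify)
    fix i \<pi> j \<rho>
    assume \<pi>: "\<pi> permutes {1..k - 1}" and \<rho>: "\<rho> permutes {1..k - 1}"
      and eq: "insert_column k i \<pi> = insert_column k j \<rho>"
    have ij: "i = j" using fun_cong[OF eq, of 1] by (simp add: insert_column_def)
    have "\<pi> b = \<rho> b" for b
    proof (cases "b \<in> {1..k - 1}")
      case True
      then have "b + 1 \<noteq> 1" "b + 1 \<in> {2..k}" by auto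
      then show ?thesis
        using fun_cong[OF eq, of "b + 1"] ij by (auto simp: insert_column_def split: if_splits)
    next
      case False
      then show ?thesis using \<pi> \<rho> by (simp add: permutes_not_in)
    qed
    then show "i = j \<and> \<pi> = \<rho>" using ij by auto
  qed
  have into: "?f ` ?D \<subseteq> {\<sigma>. \<sigma> permutes {1..k}}"
  proof clarify
    fix i \<pi> assume i: "i \<in> {1..k}" and \<pi>: "\<pi> permutes {1..k - 1}"
    have range: "\<pi> (a - 1) \<in> {1..k - 1}" if "a \<in> {2..k}" for a
      using that permutes_in_image[OF \<pi>, of "a - 1"] by auto
    have "inj_on (insert_column k i \<pi>) {1..k}"
    proof (rule inj_onI)
      fix a b assume a: "a \<in> {1..k}" and b: "b \<in> {1..k}"
        and eq: "insert_column k i \<pi> a = insert_column k i \<pi> b"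
      have pi_eq: "a = b" if "a \<in> {2..k}" "b \<in> {2..k}" "\<pi> (a - 1) = \<pi> (b - 1)"
      proof -
        have "a - 1 = b - 1" using permutes_inj[OF \<pi>] that(3) by (rule injD)
        then show ?thesis using that by auto
      qed
      consider "a = 1" "b = 1" | "a = 1" "b \<in> {2..k}" | "a \<in> {2..k}" "b = 1" | "a \<in> {2..k}" "b \<in> {2..k}"
        using a b by fastforce
      then show "a = b"
        using eq pi_eq by cases (auto simp: insert_column_def split: if_splits)
    qed
    moreover have "insert_column k i \<pi> ` {1..k} \<subseteq> {1..k}"
    proof
      fix y assume "y \<in> insert_column k i \<pi> ` {1..k}"
      then obtain a where a: "a \<in> {1..k}" "y = insert_column k i \<pi> a" by auto
      show "y \<in> {1..k}"
      proof (cases "a = 1")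
        case True
        then show ?thesis using a i by (simp add: insert_column_def)
      next
        case False
        then have "a \<in> {2..k}" using a by auto
        with range[OF this] show ?thesis using a False by (auto simp: insert_column_def)
      qed
    qed
    ultimately have "bij_betw (insert_column k i \<pi>) {1..k} {1..k}"
      by (simp add: bij_betw_def endo_inj_surj)
    then show "insert_column k i \<pi> permutes {1..k}"
      by (rule bij_imp_permutes) (use k in \<open>auto simp: insert_column_def\<close>)
  qed
  have card_perms: "card {\<sigma>. \<sigma> permutes {1..m}} = fact m" for m :: nat
    by (rule card_permutations) auto
  have "card (?f ` ?D) = k * fact (k - 1)"
    unfolding card_image[OF inj] card_cartesian_product card_perms by simp
  also have "\<dots> = card {\<sigma>. \<sigma> permutes {1..k}}"
    unfolding card_perms using k by (simp add: fact_reduce)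
  finally have "?f ` ?D = {\<sigma>. \<sigma> permutes {1..k}}"
    by (intro card_subset_eq into) (auto intro: finite_permutations)
  with inj show ?thesis by (simp add: bij_betw_def)
qed

lemma Per_expand_first_row:
  assumes k: "1 \<le> k"
  shows "Per k X = (\<Sum>i = 1..k. X (1, i) * Per (k - 1) (minor k i X))"
proof -
  let ?P = "{\<pi>. \<pi> permutes {1..k - 1}}"
  have "Per k X = (\<Sum>(i, \<pi>)\<in>{1..k} \<times> ?P. \<Prod>a = 1..k. X (a, insert_column k i \<pi> a))"
    unfolding Per_def split_beta'
    using sum.reindex_bij_betw[OF bij_betw_insert_column[OF k],
        of "\<lambda>\<sigma>. \<Prod>a = 1..k. X (a, \<sigma> a)", symmetric]
    by (simp only: split_beta')
  also have "\<dots> = (\<Sum>i = 1..k. \<Sum>\<pi>\<in>?P. \<Prod>a = 1..k. X (a, insert_column k i \<pi> a))"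
    by (simp add: sum.cartesian_product)
  also have "\<dots> = (\<Sum>i = 1..k. \<Sum>\<pi>\<in>?P. X (1, i) * (\<Prod>a = 1..k - 1. minor k i X (a, \<pi> a)))"
  proof (intro sum.cong refl)
    fix i \<pi> assume "i \<in> {1..k}" "\<pi> \<in> ?P"
    have "(\<Prod>a = 1..k. X (a, insert_column k i \<pi> a))
        = X (1, insert_column k i \<pi> 1) * (\<Prod>a = 1 + 1..k - 1 + 1. X (a, insert_column k i \<pi> a))"
      using k prod.atLeast_Suc_atMost[of 1 k "\<lambda>a. X (a, insert_column k i \<pi> a)"] by simp
    also have "(\<Prod>a = 1 + 1..k - 1 + 1. X (a, insert_column k i \<pi> a))
        = (\<Prod>a = 1..k - 1. X (a + 1, insert_column k i \<pi> (a + 1)))"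
      by (rule prod.shift_bounds_cl_nat_ivl)
    also have "\<dots> = (\<Prod>a = 1..k - 1. minor k i X (a, \<pi> a))"
    proof (intro prod.cong refl)
      fix a assume a: "a \<in> {1..k - 1}"
      then have "\<pi> a \<in> {1..k - 1}" using \<open>\<pi> \<in> ?P\<close> by (simp only: mem_Collect_eq permutes_in_image)
      then show "X (a + 1, insert_column k i \<pi> (a + 1)) = minor k i X (a, \<pi> a)"
        using a by (auto simp: minor_def insert_column_def indices_def)
    qed
    finally show "(\<Prod>a = 1..k. X (a, insert_column k i \<pi> a))
      = X (1, i) * (\<Prod>a = 1..k - 1. minor k i X (a, \<pi> a))"
      by (simp add: insert_column_def)
  qed
  also have "\<dots> = (\<Sum>i = 1..k. X (1, i) * Per (k - 1) (minor k i X))"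
    by (simp add: Per_def sum_distrib_left)
  finally show ?thesis .
qed

lemma minor_in_cmatrices: "minor k i X \<in> cmatrices (k - 1)"
  by (auto simp: minor_def cmatrices_def)

lemma Per_1: "Per 1 X = X (1, 1)"
  by (simp add: Per_expand_first_row) (simp add: Per_def)

section \<open>Semantics of the test\<close>

lemma bind_alg_assoc: "bind_alg (bind_alg p f) g = bind_alg p (\<lambda>x. bind_alg (f x) g)"
  by (induction p) auto

lemma bind_alg_Return: "bind_alg p Return = p"
  by (induction p) auto

text \<open>For bodies that only query and compute: once the oracles are fixed they act as a pure
  function \<open>f\<close>. The assumption ranges over all continuations so that the induction can
  use the rest of the loop as one.\<close>

lemma outcome_bind_for_loop:
  fixes g :: "'s \<Rightarrow> 'b alg"
  assumes "\<And>i s (g :: 's \<Rightarrow> 'b alg).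
    i \<in> set is \<Longrightarrow> outcome \<O> (bind_alg (body i s) g) = outcome \<O> (g (f i s))"
  shows "outcome \<O> (bind_alg (for_loop is body s) g) = outcome \<O> (g (fold f is s))"
  using assms by (induction "is" arbitrary: s) (auto simp: bind_alg_assoc)

lemma outcome_bind_factorial:
  "outcome \<O> (bind_alg (factorial k) g) = outcome \<O> (g (fact k))"
proof -
  have "fold (\<lambda>i f. real i * f) [1..<k + 1] 1 = fact k"
    by (induction k) auto
  then show ?thesis
    unfolding factorial_def
    by (subst outcome_bind_for_loop[where f = "\<lambda>i f. real i * f"]) (auto simp: compute_def)
qed

definition repetitions :: "nat \<Rightarrow> real \<Rightarrow> real \<Rightarrow> nat" where
  "repetitions n \<delta> c = nat \<lceil>192 * (real n)\<^sup>2 / (\<delta> ^ 4 * c)\<rceil>"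

definition row_expansion :: "nat \<Rightarrow> oracles \<Rightarrow> cmatrix \<Rightarrow> complex" where
  "row_expansion k \<O> X =
    (if k = 1 then X (1, 1) else \<Sum>i = 1..k. X (1, i) * \<O> (k - 1) (minor k i X))"

definition linearity_ok :: "nat \<Rightarrow> nat \<Rightarrow> real \<Rightarrow> oracles \<Rightarrow> cmatrix \<Rightarrow> bool" where
  "linearity_ok n k \<delta> \<O> X \<longleftrightarrow>
    (cmod (\<O> k X - row_expansion k \<O> X))\<^sup>2 \<le> (real n)\<^sup>2 * \<delta>\<^sup>2 * fact k"

definition tail_ok :: "nat \<Rightarrow> real \<Rightarrow> oracles \<Rightarrow> cmatrix \<Rightarrow> bool" where
  "tail_ok k T \<O> X \<longleftrightarrow> (cmod (\<O> k X))\<^sup>2 \<le> T\<^sup>2 * fact k"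

lemma outcome_bind_LinearityTest:
  "outcome \<O> (bind_alg (LinearityTest n k \<delta>) g) =
    Giry_Monad.bind (gauss k)
      (\<lambda>X. outcome \<O> (g (if linearity_ok n k \<delta> \<O> X then Accept else Reject)))"
proof -
  \<comment> \<open>The bound \<open>m\<close> is separated from \<open>k\<close>, which also occurs
    in the summand, to make the induction possible.\<close>
  have sum: "fold (\<lambda>i s. s + X (1, i) * \<O> (k - 1) (minor k i X)) [1..<m + 1] 0
      = (\<Sum>i = 1..m. X (1, i) * \<O> (k - 1) (minor k i X))" for X :: cmatrix and m
    by (induction m) auto
  show ?thesis
  proof (cases "k = 1")
    case True
    then show ?thesis
      by (simp add: LinearityTest_def sample_def query_def compute_def bind_alg_assoc
          outcome_bind_factorial linearity_ok_def row_expansion_def)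
  next
    case False
    show ?thesis
      using False sum[where m = k]
      by (simp add: LinearityTest_def sample_def query_def compute_def bind_alg_assoc
          outcome_bind_factorial linearity_ok_def row_expansion_def
          outcome_bind_for_loop[where f = "\<lambda>i s. s + _ (1, i) * \<O> (k - 1) (minor k i _)"]
          del: upt_Suc One_nat_def)
  qed
qed

lemma outcome_bind_TailTest:
  "outcome \<O> (bind_alg (TailTest k T) g) =
    Giry_Monad.bind (gauss k) (\<lambda>X. outcome \<O> (g (if tail_ok k T \<O> X then Accept else Reject)))"
  by (simp add: TailTest_def sample_def query_def compute_def bind_alg_assoc
      outcome_bind_factorial tail_ok_def)

text \<open>The first conjunct provides the measurability needed to evaluate the Giry bind, and lets
  the rejection probability be read off as \<open>1 - x\<close>.\<close>

definition accepts_with_prob :: "oracles \<Rightarrow> verdict alg \<Rightarrow> real \<Rightarrow> bool" where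
  "accepts_with_prob \<O> p x \<longleftrightarrow>
    outcome \<O> p \<in> space (prob_algebra (count_space UNIV)) \<and> measure (outcome \<O> p) {Accept} = x"

text \<open>
  The verdict transformer \<open>p\<close> keeps \<open>Reject\<close>, and keeps \<open>Accept\<close> with probability \<open>a\<close>.
  Quantifying over the continuation \<open>g\<close> makes this compositional without associativity of the
  measure-theoretic bind.
\<close>

definition filters_with_prob :: "oracles \<Rightarrow> (verdict \<Rightarrow> verdict alg) \<Rightarrow> real \<Rightarrow> bool" where
  "filters_with_prob \<O> p a \<longleftrightarrow>
    (\<forall>g x y. accepts_with_prob \<O> (g Accept) x \<longrightarrow> accepts_with_prob \<O> (g Reject) y \<longrightarrow>
      accepts_with_prob \<O> (bind_alg (p Accept) g) (a * x + (1 - a) * y) \<and>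
      accepts_with_prob \<O> (bind_alg (p Reject) g) y)"

lemma accepts_with_prob_Return:
  "accepts_with_prob \<O> (Return Accept) 1" "accepts_with_prob \<O> (Return Reject) 0"
  by (auto simp: accepts_with_prob_def space_prob_algebra measure_return prob_space_return)

lemma filters_with_prob_Return: "filters_with_prob \<O> Return 1"
  by (simp add: filters_with_prob_def)

lemma filters_with_prob_Tick:
  "filters_with_prob \<O> p a \<Longrightarrow> filters_with_prob \<O> (\<lambda>r. Tick (p r)) a"
  by (simp add: filters_with_prob_def accepts_with_prob_def)

lemma filters_with_prob_bind:
  assumes p: "filters_with_prob \<O> p a" and q: "filters_with_prob \<O> q b"
  shows "filters_with_prob \<O> (\<lambda>r. bind_alg (p r) q) (a * b)"
  unfolding filters_with_prob_def
proof (intro allI impI)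
  fix g x y assume *: "accepts_with_prob \<O> (g Accept) x" "accepts_with_prob \<O> (g Reject) y"
  have "accepts_with_prob \<O> (bind_alg (q Accept) g) (b * x + (1 - b) * y)"
    "accepts_with_prob \<O> (bind_alg (q Reject) g) y"
    using q * by (auto simp: filters_with_prob_def)
  with p[unfolded filters_with_prob_def, rule_format, of "\<lambda>r. bind_alg (q r) g"]
  have "accepts_with_prob \<O> (bind_alg (bind_alg (p Accept) q) g)
      (a * (b * x + (1 - b) * y) + (1 - a) * y)"
    "accepts_with_prob \<O> (bind_alg (bind_alg (p Reject) q) g) y"
    by (auto simp: bind_alg_assoc)
  then show "accepts_with_prob \<O> (bind_alg (bind_alg (p Accept) q) g)
      (a * b * x + (1 - a * b) * y) \<and>
    accepts_with_prob \<O> (bind_alg (bind_alg (p Reject) q) g) y"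
    by (simp add: algebra_simps)
qed

lemma filters_with_prob_for_loop:
  assumes "\<And>i. i \<in> set is \<Longrightarrow> filters_with_prob \<O> (body i) (a i)"
  shows "filters_with_prob \<O> (for_loop is body) (\<Prod>i\<leftarrow>is. a i)"
  using assms
proof (induction "is")
  case Nil
  have "for_loop [] body = Return" by auto
  then show ?case by (simp add: filters_with_prob_Return)
next
  case (Cons i "is")
  have "for_loop (i # is) body = (\<lambda>r. Tick (bind_alg (body i r) (for_loop is body)))" by auto
  then show ?case using Cons
    by (auto intro!: filters_with_prob_Tick filters_with_prob_bind)
qed

text \<open>The continuation sees the sample only through the Boolean \<open>P X\<close>. The kernel
  therefore factors through a discrete two-point space, so measurability of \<open>P\<close> makes
  it measurable for every admissible \<open>g\<close>.\<close>

lemma filters_with_prob_test: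
  assumes test: "\<And>g :: verdict \<Rightarrow> verdict alg. outcome \<O> (bind_alg test g) =
      Giry_Monad.bind (gauss k) (\<lambda>X. outcome \<O> (g (if P X then Accept else Reject)))"
    and P[measurable]: "Measurable.pred (gauss k) P"
  shows "filters_with_prob \<O>
    (\<lambda>r. bind_alg test (\<lambda>t. compute (if t = Reject then Reject else r)))
    (measure (gauss k) {X \<in> space (gauss k). P X})"
  unfolding filters_with_prob_def
proof (intro allI impI)
  interpret prob_space "gauss k" by (rule prob_space_gauss)
  fix g x y
  assume "accepts_with_prob \<O> (g Accept) x" "accepts_with_prob \<O> (g Reject) y"
  then have g: "outcome \<O> (g r) \<in> space (prob_algebra (count_space UNIV))"
    and x: "measure (outcome \<O> (g Accept)) {Accept} = x"
    and y: "measure (outcome \<O> (g Reject)) {Accept} = y" for r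
    by (cases r; simp add: accepts_with_prob_def)+
  define h where "h V r = (if (if V then Accept else Reject) = Reject then Reject else r)"
    for V r
  have meas: "(\<lambda>X. outcome \<O> (g (h (P X) r))) \<in> gauss k \<rightarrow>\<^sub>M prob_algebra (count_space UNIV)"
    for r
  proof -
    have "(\<lambda>V. outcome \<O> (g (h V r))) \<in> count_space UNIV \<rightarrow>\<^sub>M prob_algebra (count_space UNIV)"
      using g by auto
    from measurable_compose[OF P this] show ?thesis .
  qed
  have out: "outcome \<O> (bind_alg (bind_alg test (\<lambda>t. compute (if t = Reject then Reject else r))) g)
      = Giry_Monad.bind (gauss k) (\<lambda>X. outcome \<O> (g (h (P X) r)))" for r
    by (simp add: bind_alg_assoc test compute_def h_def)
  have prob: "Giry_Monad.bind (gauss k) (\<lambda>X. outcome \<O> (g (h (P X) r)))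
      \<in> space (prob_algebra (count_space UNIV))" for r
  proof -
    have "gauss k \<in> space (prob_algebra (gauss k))"
      by (simp add: space_prob_algebra prob_space_axioms)
    from prob_space_bind'[OF this meas[of r]] sets_bind'[OF this meas[of r]] show ?thesis
      by (simp add: space_prob_algebra)
  qed
  have meas': "(\<lambda>X. outcome \<O> (g (h (P X) r))) \<in> gauss k \<rightarrow>\<^sub>M subprob_algebra (count_space UNIV)"
    for r
    using meas by (rule measurable_prob_algebraD)
  have val: "measure (Giry_Monad.bind (gauss k) (\<lambda>X. outcome \<O> (g (h (P X) r)))) {Accept}
      = (\<integral>X. measure (outcome \<O> (g (h (P X) r))) {Accept} \<partial>gauss k)" for r
    by (rule measure_bind[OF meas']) auto
  have "(\<integral>X. measure (outcome \<O> (g (h (P X) Reject))) {Accept} \<partial>gauss k) = y"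
    by (simp add: h_def y prob_space)
  moreover have "(\<integral>X. measure (outcome \<O> (g (h (P X) Accept))) {Accept} \<partial>gauss k)
      = (\<integral>X. y + (x - y) * indicator {X \<in> space (gauss k). P X} X \<partial>gauss k)"
    by (rule Bochner_Integration.integral_cong) (auto simp: h_def x y)
  moreover have "\<dots> = y + (x - y) * measure (gauss k) {X \<in> space (gauss k). P X}"
    by (subst Bochner_Integration.integral_add) (auto simp: prob_space emeasure_eq_measure)
  ultimately show "accepts_with_prob \<O>
      (bind_alg (bind_alg test (\<lambda>t. compute (if t = Reject then Reject else Accept))) g)
      (measure (gauss k) {X \<in> space (gauss k). P X} * x +
       (1 - measure (gauss k) {X \<in> space (gauss k). P X}) * y) \<and>
    accepts_with_prob \<O>
      (bind_alg (bind_alg test (\<lambda>t. compute (if t = Reject then Reject else Reject))) g) y"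
    using prob val out[of Accept] out[of Reject]
    by (simp add: accepts_with_prob_def algebra_simps)
qed

definition linearity_prob :: "nat \<Rightarrow> nat \<Rightarrow> real \<Rightarrow> oracles \<Rightarrow> real" where
  "linearity_prob n k \<delta> \<O> = measure (gauss k) {X \<in> space (gauss k). linearity_ok n k \<delta> \<O> X}"

definition tail_prob :: "nat \<Rightarrow> real \<Rightarrow> oracles \<Rightarrow> real" where
  "tail_prob k T \<O> = measure (gauss k) {X \<in> space (gauss k). tail_ok k T \<O> X}"

text \<open>Every run draws a fresh sample, so the probabilities of passing multiply.\<close>

lemma accepts_with_prob_PTest:
  assumes "\<And>k. k \<in> {1..n} \<Longrightarrow> Measurable.pred (gauss k) (linearity_ok n k \<delta> \<O>)"
    and "\<And>k. k \<in> {1..n} \<Longrightarrow>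
      Measurable.pred (gauss k) (tail_ok k (4 * real n / (\<delta> * sqrt c)) \<O>)"
  shows "accepts_with_prob \<O> (PTest n \<delta> c)
    (\<Prod>k = 1..n. (linearity_prob n k \<delta> \<O> * tail_prob k (4 * real n / (\<delta> * sqrt c)) \<O>)
      ^ repetitions n \<delta> c)"
proof -
  let ?T = "4 * real n / (\<delta> * sqrt c)"
  let ?d = "nat \<lceil>192 * (real n)\<^sup>2 / (\<delta> ^ 4 * c)\<rceil>"
  have run: "filters_with_prob \<O> (run_times d test) (measure (gauss k) {X \<in> space (gauss k). P X} ^ d)"
    if "\<And>g :: verdict \<Rightarrow> verdict alg. outcome \<O> (bind_alg test g) =
      Giry_Monad.bind (gauss k) (\<lambda>X. outcome \<O> (g (if P X then Accept else Reject)))"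
      "Measurable.pred (gauss k) P" for test k P d
  proof -
    have "filters_with_prob \<O> (run_times d test)
        (\<Prod>i\<leftarrow>[0..<d]. measure (gauss k) {X \<in> space (gauss k). P X})"
      unfolding run_times_def using filters_with_prob_test[OF that]
      by (auto intro: filters_with_prob_for_loop)
    then show ?thesis by (simp add: map_replicate_const)
  qed
  have "filters_with_prob \<O>
    (for_loop [1..<n + 1] (\<lambda>k r. bind_alg (run_times ?d (LinearityTest n k \<delta>) r)
        (run_times ?d (TailTest k ?T))))
    (\<Prod>k\<leftarrow>[1..<n + 1]. linearity_prob n k \<delta> \<O> ^ ?d * tail_prob k ?T \<O> ^ ?d)"
    unfolding linearity_prob_def tail_prob_def
    using assms
    by (intro filters_with_prob_for_loop filters_with_prob_bind run
      outcome_bind_LinearityTest outcome_bind_TailTest) auto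
  \<comment> \<open>With continuation \<open>Return\<close>, which accepts with probability 1 on
    \<open>Accept\<close> and 0 on \<open>Reject\<close>, the filter probability is the acceptance
    probability.\<close>
  then have "accepts_with_prob \<O> (bind_alg (for_loop [1..<n + 1] (\<lambda>k r. bind_alg (run_times ?d (LinearityTest n k \<delta>) r)
        (run_times ?d (TailTest k ?T))) Accept) Return)
    (\<Prod>k\<leftarrow>[1..<n + 1]. linearity_prob n k \<delta> \<O> ^ ?d * tail_prob k ?T \<O> ^ ?d)"
    unfolding filters_with_prob_def using accepts_with_prob_Return by fastforce
  moreover have "(\<Prod>k\<leftarrow>[1..<n + 1]. linearity_prob n k \<delta> \<O> ^ ?d * tail_prob k ?T \<O> ^ ?d)
     = (\<Prod>k = 1..n. (linearity_prob n k \<delta> \<O> * tail_prob k ?T \<O>) ^ ?d)"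
    by (subst prod.distinct_set_conv_list[symmetric])
      (simp_all add: power_mult_distrib atLeastLessThanSuc_atLeastAtMost del: upt_Suc)
  ultimately show ?thesis
    by (simp add: PTest_def compute_def bind_alg_Return repetitions_def accepts_with_prob_def)
qed

lemma accepts_with_prob_Reject:
  assumes "accepts_with_prob \<O> p x"
  shows "measure (outcome \<O> p) {Reject} = 1 - x"
proof -
  interpret prob_space "outcome \<O> p"
    using assms by (simp add: accepts_with_prob_def space_prob_algebra)
  have s: "sets (outcome \<O> p) = UNIV"
    using assms by (simp add: accepts_with_prob_def space_prob_algebra)
  have sp: "space (outcome \<O> p) = UNIV"
    using sets_eq_imp_space_eq[of "outcome \<O> p" "count_space UNIV"] s by simp
  have "{Reject} = space (outcome \<O> p) - {Accept}"
    unfolding sp using verdict.exhaust by auto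
  then show ?thesis
    using assms by (simp only: prob_compl s UNIV_I) (simp add: accepts_with_prob_def)
qed

section \<open>Running time\<close>

text \<open>At unit cost each query is charged one step, so the query bound becomes an instance of
  the time bound.\<close>

lemma queries_le_runtime: "queries \<O> p \<le> runtime 1 \<O> p"
proof (induction p)
  case (Sample k f)
  have "(SUP X\<in>cmatrices k. queries \<O> (f X)) \<le> (SUP X\<in>cmatrices k. runtime 1 \<O> (f X))"
    using Sample by (intro SUP_mono) auto
  also have "\<dots> \<le> 1 + \<dots>" by simp
  finally show ?case by simp
next
  case (Tick p)
  have "runtime 1 \<O> p \<le> 1 + runtime 1 \<O> p" by simp
  with Tick have "queries \<O> p \<le> 1 + runtime 1 \<O> p" by (rule order_trans)
  then show ?case by simp
next
  case (Query k X f)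
  then show ?case by (simp add: one_enat_def add_left_mono)
qed simp

lemma runtime_bind_le:
  assumes "runtime \<tau> \<O> p \<le> enat A" "\<And>a. runtime \<tau> \<O> (g a) \<le> enat B"
  shows "runtime \<tau> \<O> (bind_alg p g) \<le> enat (A + B)"
proof -
  have "runtime \<tau> \<O> (bind_alg p g) \<le> runtime \<tau> \<O> p + enat B"
  proof (induction p)
    case (Return a)
    show ?case using assms(2)[of a] by simp
  next
    case (Sample k f)
    have "(SUP X\<in>cmatrices k. runtime \<tau> \<O> (bind_alg (f X) g))
        \<le> (SUP X\<in>cmatrices k. runtime \<tau> \<O> (f X)) + enat B"
    proof (rule SUP_least)
      fix X assume "X \<in> cmatrices k"
      then have "runtime \<tau> \<O> (f X) \<le> (SUP X\<in>cmatrices k. runtime \<tau> \<O> (f X))"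
        by (rule SUP_upper)
      then show "runtime \<tau> \<O> (bind_alg (f X) g)
          \<le> (SUP X\<in>cmatrices k. runtime \<tau> \<O> (f X)) + enat B"
        using Sample[OF rangeI, of X] by (meson add_right_mono order_trans)
    qed
    then show ?case by (simp add: add.assoc add_left_mono)
  qed (auto simp: add.assoc intro: add_left_mono)
  also have "\<dots> \<le> enat A + enat B" by (intro add_right_mono assms)
  finally show ?thesis by simp
qed

lemma runtime_for_loop_le:
  assumes "\<And>i s. i \<in> set is \<Longrightarrow> runtime \<tau> \<O> (body i s) \<le> enat A"
  shows "runtime \<tau> \<O> (for_loop is body s) \<le> enat (length is * (A + 1))"
  using assms
proof (induction "is" arbitrary: s)
  case (Cons i "is")
  have "runtime \<tau> \<O> (bind_alg (body i s) (for_loop is body)) \<le> enat (A + length is * (A + 1))"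
    using Cons by (intro runtime_bind_le) auto
  then have "1 + runtime \<tau> \<O> (bind_alg (body i s) (for_loop is body))
      \<le> 1 + enat (A + length is * (A + 1))"
    by (rule add_left_mono)
  then show ?case by (simp add: one_enat_def algebra_simps)
qed (simp add: zero_enat_def)

lemma runtime_compute: "runtime \<tau> \<O> (compute v) \<le> enat 1"
  by (simp add: compute_def one_enat_def)

lemma runtime_query: "runtime \<tau> \<O> (query k X) \<le> enat \<tau>"
  by (simp add: query_def)

lemma runtime_sample: "runtime \<tau> \<O> (sample k) \<le> enat 1"
  by (auto simp: sample_def one_enat_def zero_enat_def[symmetric] SUP_constant bot_enat_def)

lemma runtime_factorial: "runtime \<tau> \<O> (factorial k) \<le> enat (2 * k)"
proof -
  have "runtime \<tau> \<O> (factorial k) \<le> enat (length [1..<k + 1] * (1 + 1))"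
    unfolding factorial_def by (intro runtime_for_loop_le runtime_compute)
  then show ?thesis by (simp add: mult_2 del: upt_Suc)
qed

lemma runtime_LinearityTest:
  assumes "1 \<le> k"
  shows "runtime \<tau> \<O> (LinearityTest n k \<delta>) \<le> enat (k * (2 * \<tau> + 6))"
proof -
  have loop: "runtime \<tau> \<O> (for_loop [1..<k + 1]
      (\<lambda>i s. bind_alg (query (k - 1) (minor k i X)) (\<lambda>y. compute (s + X (1, i) * y))) 0)
      \<le> enat (k * (\<tau> + 2))" for X
  proof -
    have "runtime \<tau> \<O> (for_loop [1..<k + 1]
      (\<lambda>i s. bind_alg (query (k - 1) (minor k i X)) (\<lambda>y. compute (s + X (1, i) * y))) 0)
      \<le> enat (length [1..<k + 1] * ((\<tau> + 1) + 1))"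
      by (intro runtime_for_loop_le runtime_bind_le runtime_query runtime_compute)
    then show ?thesis by (simp del: upt_Suc)
  qed
  have w: "runtime \<tau> \<O> (if k = 1 then compute (X (1, 1)) else for_loop [1..<k + 1]
      (\<lambda>i s. bind_alg (query (k - 1) (minor k i X)) (\<lambda>y. compute (s + X (1, i) * y))) 0)
      \<le> enat (k * (\<tau> + 2))" for X
    using loop[of X] order_trans[OF runtime_compute, of "enat (k * (\<tau> + 2))" \<tau> \<O> "X (1, 1)"]
    by (auto simp del: upt_Suc)
  have "runtime \<tau> \<O> (LinearityTest n k \<delta>) \<le> enat (1 + (\<tau> + (k * (\<tau> + 2) + (2 * k + 1))))"
    unfolding LinearityTest_def
    by (intro runtime_bind_le runtime_sample runtime_query w runtime_factorial runtime_compute)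
  also have "1 + (\<tau> + (k * (\<tau> + 2) + (2 * k + 1))) \<le> k * (2 * \<tau> + 6)"
  proof -
    have "\<tau> \<le> k * \<tau>" using assms by simp
    then show ?thesis using assms unfolding distrib_left by linarith
  qed
  finally show ?thesis by simp
qed

lemma runtime_TailTest:
  assumes "1 \<le> k"
  shows "runtime \<tau> \<O> (TailTest k T) \<le> enat (k * (\<tau> + 4))"
proof -
  have "runtime \<tau> \<O> (TailTest k T) \<le> enat (1 + (\<tau> + (2 * k + 1)))"
    unfolding TailTest_def
    by (intro runtime_bind_le runtime_sample runtime_query runtime_factorial runtime_compute)
  also have "1 + (\<tau> + (2 * k + 1)) \<le> k * (\<tau> + 4)"
  proof -
    have "\<tau> \<le> k * \<tau>" using assms by simp
    then show ?thesis using assms unfolding distrib_left by linarith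
  qed
  finally show ?thesis by simp
qed

lemma runtime_run_times:
  assumes "runtime \<tau> \<O> test \<le> enat A"
  shows "runtime \<tau> \<O> (run_times d test r) \<le> enat (d * (A + 2))"
proof -
  have "runtime \<tau> \<O> (run_times d test r) \<le> enat (length [0..<d] * ((A + 1) + 1))"
    unfolding run_times_def
    by (intro runtime_for_loop_le runtime_bind_le assms runtime_compute)
  then show ?thesis by simp
qed

lemma runtime_PTest:
  fixes n :: nat and \<delta> c :: real
  defines "d \<equiv> repetitions n \<delta> c"
  shows "runtime \<tau> \<O> (PTest n \<delta> c) \<le> enat (2 + n * (d * (n * (2 * \<tau> + 6) + 2) + d * (n * (\<tau> + 4) + 2) + 1))"
proof -
  define T where "T = 4 * real n / (\<delta> * sqrt c)"
  have lin: "runtime \<tau> \<O> (run_times d (LinearityTest n k \<delta>) r) \<le> enat (d * (n * (2 * \<tau> + 6) + 2))"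
    if "k \<in> set [1..<n + 1]" for k r
    using that by (intro runtime_run_times order_trans[OF runtime_LinearityTest]) auto
  have tail: "runtime \<tau> \<O> (run_times d (TailTest k T) r) \<le> enat (d * (n * (\<tau> + 4) + 2))"
    if "k \<in> set [1..<n + 1]" for k r
    using that by (intro runtime_run_times order_trans[OF runtime_TailTest]) auto
  have "runtime \<tau> \<O> (PTest n \<delta> c) = 1 + (1 + runtime \<tau> \<O> (for_loop [1..<n + 1]
      (\<lambda>k r. bind_alg (run_times d (LinearityTest n k \<delta>) r) (run_times d (TailTest k T))) Accept))"
    by (simp add: PTest_def compute_def d_def repetitions_def T_def del: upt_Suc)
  also have "\<dots> \<le> 1 + (1 + enat (length [1..<n + 1] *
      ((d * (n * (2 * \<tau> + 6) + 2) + d * (n * (\<tau> + 4) + 2)) + 1)))"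
    by (intro add_left_mono runtime_for_loop_le runtime_bind_le lin tail)
  finally show ?thesis
    by (simp add: one_enat_def del: upt_Suc)
qed

text \<open>Rounding up adds at most 1, and z = n^2 / (\<delta>^4 c) is at least 1; hence 193 in
  place of 192.\<close>

lemma repetitions_bounds:
  assumes "0 < \<delta>" "\<delta> \<le> 1" "0 < c" "c \<le> 1" "1 \<le> n"
  shows "192 * (real n)\<^sup>2 / (\<delta> ^ 4 * c) \<le> repetitions n \<delta> c"
    and "repetitions n \<delta> c \<le> 193 * (real n)\<^sup>2 / (\<delta> ^ 4 * c)"
    and "1 \<le> repetitions n \<delta> c"
proof -
  define z where "z = (real n)\<^sup>2 / (\<delta> ^ 4 * c)"
  have "\<delta> ^ 4 * c \<le> 1" using assms by (intro mult_le_one power_le_one) auto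
  moreover have "1 \<le> (real n)\<^sup>2" using assms by simp
  ultimately have "\<delta> ^ 4 * c \<le> (real n)\<^sup>2" by linarith
  then have z: "1 \<le> z" using assms by (simp add: z_def)
  have d: "repetitions n \<delta> c = nat \<lceil>192 * z\<rceil>" by (simp add: repetitions_def z_def)
  show "192 * (real n)\<^sup>2 / (\<delta> ^ 4 * c) \<le> repetitions n \<delta> c"
    using real_nat_ceiling_ge[of "192 * z"] unfolding d by (simp add: z_def)
  have "repetitions n \<delta> c \<le> 193 * z"
    unfolding d using z by linarith
  then show "repetitions n \<delta> c \<le> 193 * (real n)\<^sup>2 / (\<delta> ^ 4 * c)"
    by (simp add: z_def)
  show "1 \<le> repetitions n \<delta> c"
    unfolding d using z by linarith
qed

lemma runtime_PTest_le:
  assumes "0 < \<delta>" "\<delta> \<le> 1" "0 < c" "c \<le> 1" "1 \<le> n"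
  shows "ereal_of_enat (runtime \<tau> \<O> (PTest n \<delta> c))
    \<le> ereal (193 * (3 * \<tau> + 17) * (real n ^ 4 / (\<delta> ^ 4 * c)))"
proof -
  let ?d = "repetitions n \<delta> c"
  let ?N = "2 + n * (?d * (n * (2 * \<tau> + 6) + 2) + ?d * (n * (\<tau> + 4) + 2) + 1)"
  have "1 \<le> ?d" using repetitions_bounds(3)[OF assms] .
  then have 1: "1 \<le> ?d * n ^ 2" using assms(5) by simp
  have 2: "n \<le> ?d * n ^ 2" using \<open>1 \<le> ?d\<close> \<open>1 \<le> n\<close> by (auto simp: power2_eq_square)
  have 3: "n * ?d \<le> ?d * n ^ 2" using \<open>1 \<le> n\<close> by (auto simp: power2_eq_square)
  \<comment> \<open>All lower-order terms are absorbed into \<open>?d * n ^ 2\<close>, which gives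
    10 + 4 + 1 + 2 = 17.\<close>
  have "?N = ?d * n ^ 2 * (3 * \<tau> + 10) + 4 * (n * ?d) + n + 2"
    by (simp add: algebra_simps power2_eq_square)
  also have "\<dots> \<le> ?d * n ^ 2 * (3 * \<tau> + 10) + 4 * (?d * n ^ 2) + ?d * n ^ 2 + 2 * (?d * n ^ 2)"
    using 1 2 3 by linarith
  also have "\<dots> = ?d * (n ^ 2 * (3 * \<tau> + 17))"
    by (simp add: algebra_simps)
  finally have "real ?N \<le> real (?d * (n ^ 2 * (3 * \<tau> + 17)))" by (rule of_nat_mono)
  also have "\<dots> = real ?d * (real n ^ 2 * (3 * \<tau> + 17))" by simp
  also have "\<dots> \<le> 193 * (real n)\<^sup>2 / (\<delta> ^ 4 * c) * (real n ^ 2 * (3 * \<tau> + 17))"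
    using repetitions_bounds(2)[OF assms] by (intro mult_right_mono) auto
  also have "\<dots> = 193 * (3 * \<tau> + 17) * (real n ^ 4 / (\<delta> ^ 4 * c))"
    by (simp add: power2_eq_square power4_eq_xxxx)
  finally have *: "real ?N \<le> 193 * (3 * \<tau> + 17) * (real n ^ 4 / (\<delta> ^ 4 * c))" .
  have "ereal_of_enat (runtime \<tau> \<O> (PTest n \<delta> c)) \<le> ereal_of_enat (enat ?N)"
    using runtime_PTest by (simp only: ereal_of_enat_le_iff)
  also have "\<dots> = ereal (real ?N)" by simp
  also have "\<dots> \<le> ereal (193 * (3 * \<tau> + 17) * (real n ^ 4 / (\<delta> ^ 4 * c)))"
    using * by (simp only: ereal_less_eq)
  finally show ?thesis by simp
qed

text \<open>The case \<open>\<tau> = 1\<close> of the time bound, with 193 (3 + 17) = 3860. For n =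
  0 the loop is empty and no query is made, while the running time is still 2.\<close>

lemma queries_PTest:
  assumes "0 < \<delta>" "\<delta> \<le> 1" "0 < c" "c \<le> 1"
  shows "ereal_of_enat (queries \<O> (PTest n \<delta> c)) \<le> ereal (3860 * (real n ^ 4 / (\<delta> ^ 4 * c)))"
proof (cases "1 \<le> n")
  case True
  have "ereal_of_enat (queries \<O> (PTest n \<delta> c)) \<le> ereal_of_enat (runtime 1 \<O> (PTest n \<delta> c))"
    using queries_le_runtime by (simp only: ereal_of_enat_le_iff)
  also have "\<dots> \<le> ereal (193 * (3 * real 1 + 17) * (real n ^ 4 / (\<delta> ^ 4 * c)))"
    using runtime_PTest_le[OF assms True, of 1] by simp
  finally show ?thesis by simp
next
  case False
  then have "n = 0" by simp
  then show ?thesis by (simp add: PTest_def compute_def)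
qed

section \<open>Soundness\<close>

lemma measurable_row_expansion:
  assumes "1 \<le> k" "k \<noteq> 1 \<Longrightarrow> \<O> (k - 1) \<in> borel_measurable (gauss (k - 1))"
  shows "row_expansion k \<O> \<in> borel_measurable (gauss k)"
proof (cases "k = 1")
  case True
  then show ?thesis unfolding row_expansion_def[abs_def] using measurable_entry[of 1 k 1] by simp
next
  case False
  have "(\<lambda>X. \<Sum>i = 1..k. X (1, i) * \<O> (k - 1) (minor k i X)) \<in> borel_measurable (gauss k)"
    using assms False
    by (intro borel_measurable_sum borel_measurable_times measurable_entry
        measurable_compose[OF measurable_minor_gauss]) auto
  then show ?thesis unfolding row_expansion_def[abs_def] using False by simp
qed

lemma pred_linearity_ok:
  assumes "1 \<le> k" "k \<noteq> 1 \<Longrightarrow> \<O> (k - 1) \<in> borel_measurable (gauss (k - 1))"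
    and [measurable]: "\<O> k \<in> borel_measurable (gauss k)"
  shows "Measurable.pred (gauss k) (linearity_ok n k \<delta> \<O>)"
proof -
  have [measurable]: "row_expansion k \<O> \<in> borel_measurable (gauss k)"
    using assms by (intro measurable_row_expansion)
  show ?thesis unfolding linearity_ok_def[abs_def] by measurable
qed

lemma pred_tail_ok:
  assumes [measurable]: "\<O> k \<in> borel_measurable (gauss k)"
  shows "Measurable.pred (gauss k) (tail_ok k T \<O>)"
  unfolding tail_ok_def[abs_def] by measurable

definition tests_ok :: "nat \<Rightarrow> nat \<Rightarrow> real \<Rightarrow> real \<Rightarrow> oracles \<Rightarrow> cmatrix \<Rightarrow> bool" where
  "tests_ok n k \<delta> c \<O> X \<longleftrightarrow>
    linearity_ok n k \<delta> \<O> X \<and> tail_ok k (4 * real n / (\<delta> * sqrt c)) \<O> X"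

lemma pred_tests_ok:
  assumes "1 \<le> k" "k \<noteq> 1 \<Longrightarrow> \<O> (k - 1) \<in> borel_measurable (gauss (k - 1))"
    and "\<O> k \<in> borel_measurable (gauss k)"
  shows "Measurable.pred (gauss k) (tests_ok n k \<delta> c \<O>)"
proof -
  note [measurable] = pred_linearity_ok[of k \<O>, OF assms] pred_tail_ok[of \<O> k, OF assms(3)]
  show ?thesis unfolding tests_ok_def[abs_def] by measurable
qed

text \<open>Young's inequality; the difference of the two sides is a perfect square over
  \<open>v\<close>. The free weight keeps the induction on \<open>k\<close> from losing a constant
  factor at each level.\<close>

lemma weighted_square_add:
  fixes a b v :: real
  assumes "0 < v"
  shows "(a + b)\<^sup>2 \<le> (1 + v) * (a\<^sup>2 + b\<^sup>2 / v)"
proof -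
  have "(1 + v) * (a\<^sup>2 + b\<^sup>2 / v) - (a + b)\<^sup>2 = (v * a - b)\<^sup>2 / v"
    using assms by (simp add: field_simps power2_eq_square)
  then show ?thesis using assms by (smt (verit) divide_nonneg_pos zero_le_power2)
qed

text \<open>Union bound over the minors, each of which is distributed as
  \<open>gauss (k - 1)\<close>.\<close>

lemma minors_bad_prob:
  assumes k: "1 \<le> k" and P[measurable]: "Measurable.pred (gauss (k - 1)) P"
    and bad: "measure (gauss (k - 1)) {Y \<in> space (gauss (k - 1)). \<not> P Y} \<le> \<epsilon>"
  shows "measure (gauss k) {X \<in> space (gauss k). \<exists>i\<in>{1..k}. \<not> P (minor k i X)} \<le> real k * \<epsilon>"
proof -
  interpret prob_space "gauss k" by (rule prob_space_gauss)
  have eq: "{X \<in> space (gauss k). \<exists>i\<in>{1..k}. \<not> P (minor k i X)}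
      = (\<Union>i\<in>{1..k}. {X \<in> space (gauss k). \<not> P (minor k i X)})" by auto
  have "prob (\<Union>i\<in>{1..k}. {X \<in> space (gauss k). \<not> P (minor k i X)})
      \<le> (\<Sum>i\<in>{1..k}. prob {X \<in> space (gauss k). \<not> P (minor k i X)})"
    by (rule finite_measure_subadditive_finite) auto
  also have "\<dots> \<le> (\<Sum>i\<in>{1..k}. \<epsilon>)"
  proof (rule sum_mono)
    fix i
    have "measure (gauss (k - 1)) {Y \<in> space (gauss (k - 1)). \<not> P Y}
        = measure (distr (gauss k) (gauss (k - 1)) (minor k i)) {Y \<in> space (gauss (k - 1)). \<not> P Y}"
      by (simp only: minor_distr_gauss)
    also have "\<dots> = prob (minor k i -` {Y \<in> space (gauss (k - 1)). \<not> P Y} \<inter> space (gauss k))"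
      by (rule measure_distr) measurable
    also have "minor k i -` {Y \<in> space (gauss (k - 1)). \<not> P Y} \<inter> space (gauss k)
        = {X \<in> space (gauss k). \<not> P (minor k i X)}"
      using measurable_space[OF measurable_minor_gauss] by auto
    finally show "prob {X \<in> space (gauss k). \<not> P (minor k i X)} \<le> \<epsilon>" using bad by simp
  qed
  finally show ?thesis unfolding eq by simp
qed

text \<open>Cauchy-Schwarz with the fourth moment, in the form z \<le> l / 2 + z^2 / (2 l). Leaving
  \<open>l\<close> free avoids square roots of probabilities.\<close>

lemma Per_square_on_event:
  assumes B[measurable]: "B \<in> sets (gauss k)" and l: "0 < l"
  shows "(\<integral>\<^sup>+X. ennreal (indicator B X * (cmod (Per k X))\<^sup>2) \<partial>gauss k)
    \<le> ennreal ((l * measure (gauss k) B + (real k + 1) * (fact k)\<^sup>2 / l) / 2)"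
proof -
  interpret prob_space "gauss k" by (rule prob_space_gauss)
  have "(\<integral>\<^sup>+X. ennreal (indicator B X * (cmod (Per k X))\<^sup>2) \<partial>gauss k)
      \<le> (\<integral>\<^sup>+X. ennreal (l / 2) * indicator B X + ennreal (1 / (2 * l)) * ennreal (cmod (Per k X) ^ 4) \<partial>gauss k)"
  proof (rule nn_integral_mono)
    fix X
    define z where "z = (cmod (Per k X))\<^sup>2"
    have z: "cmod (Per k X) ^ 4 = z\<^sup>2" by (simp add: z_def power_mult[symmetric])
    have "z \<le> l / 2 + 1 / (2 * l) * z\<^sup>2"
    proof -
      have "l / 2 + 1 / (2 * l) * z\<^sup>2 - z = (z - l)\<^sup>2 / (2 * l)"
        using l by (simp add: field_simps power2_eq_square)
      then show ?thesis using l by (smt (verit) divide_nonneg_pos zero_le_power2)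
    qed
    then show "ennreal (indicator B X * (cmod (Per k X))\<^sup>2)
      \<le> ennreal (l / 2) * indicator B X + ennreal (1 / (2 * l)) * ennreal (cmod (Per k X) ^ 4)"
      unfolding z z_def[symmetric] using l
      by (cases "X \<in> B") (auto simp: ennreal_mult[symmetric] ennreal_plus[symmetric] simp del: ennreal_plus intro!: ennreal_leI)
  qed
  also have "\<dots> = ennreal (l / 2) * emeasure (gauss k) B + ennreal (1 / (2 * l)) * (\<integral>\<^sup>+X. ennreal (cmod (Per k X) ^ 4) \<partial>gauss k)"
    by (simp add: nn_integral_add nn_integral_cmult)
  also have "\<dots> \<le> ennreal (l / 2) * emeasure (gauss k) B + ennreal (1 / (2 * l)) * ennreal ((real k + 1) * (fact k)\<^sup>2)"
    by (intro add_left_mono mult_left_mono Per_fourth_moment) auto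
  also have "\<dots> = ennreal ((l * measure (gauss k) B + (real k + 1) * (fact k)\<^sup>2 / l) / 2)"
    using l by (simp add: emeasure_eq_measure ennreal_mult[symmetric] ennreal_plus[symmetric] add_divide_distrib del: ennreal_plus)
  finally show ?thesis .
qed

text \<open>The linearity test compares the oracle with its row expansion, and by Laplace expansion
  that differs from the permanent by a linear form in the errors of the minors. The errors are cut
  off to 0 at failing minors, which changes nothing here but makes the second moment of the form
  accessible to induction.\<close>

lemma tests_ok_error_le:
  assumes k: "2 \<le> k" and \<delta>: "0 < \<delta>" and c: "0 < c"
    and ok: "tests_ok n k \<delta> c \<O> X"
    and minors: "\<forall>i\<in>{1..k}. tests_ok n (k - 1) \<delta> c \<O> (minor k i X)"
  shows "cmod (\<O> k X - Per k X) \<le> real n * \<delta> * sqrt (fact k) +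
    cmod (\<Sum>i = 1..k. X (1, i) * (if tests_ok n (k - 1) \<delta> c \<O> (minor k i X)
      then \<O> (k - 1) (minor k i X) - Per (k - 1) (minor k i X) else 0))"
proof -
  have "(cmod (\<O> k X - row_expansion k \<O> X))\<^sup>2 \<le> (real n)\<^sup>2 * \<delta>\<^sup>2 * fact k"
    using ok by (simp add: tests_ok_def linearity_ok_def)
  also have "\<dots> = (real n * \<delta> * sqrt (fact k))\<^sup>2"
    by (simp add: power_mult_distrib)
  finally have 1: "cmod (\<O> k X - row_expansion k \<O> X) \<le> real n * \<delta> * sqrt (fact k)"
    by (rule power2_le_imp_le) (use \<delta> in auto)
  have "row_expansion k \<O> X - Per k X = (\<Sum>i = 1..k. X (1, i) * \<O> (k - 1) (minor k i X))
      - (\<Sum>i = 1..k. X (1, i) * Per (k - 1) (minor k i X))"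
    using k Per_expand_first_row[of k X] by (simp add: row_expansion_def)
  also have "\<dots> = (\<Sum>i = 1..k. X (1, i) * (\<O> (k - 1) (minor k i X) - Per (k - 1) (minor k i X)))"
    by (simp add: sum_subtractf algebra_simps)
  also have "\<dots> = (\<Sum>i = 1..k. X (1, i) * (if tests_ok n (k - 1) \<delta> c \<O> (minor k i X)
      then \<O> (k - 1) (minor k i X) - Per (k - 1) (minor k i X) else 0))"
    using minors by (intro sum.cong) auto
  finally have 2: "row_expansion k \<O> X - Per k X = (\<Sum>i = 1..k. X (1, i) * (if tests_ok n (k - 1) \<delta> c \<O> (minor k i X)
      then \<O> (k - 1) (minor k i X) - Per (k - 1) (minor k i X) else 0))" .
  have "cmod (\<O> k X - Per k X) \<le> cmod (\<O> k X - row_expansion k \<O> X) + cmod (row_expansion k \<O> X - Per k X)"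
    by norm
  then show ?thesis using 1 unfolding 2 by linarith
qed

text \<open>
  If all minors pass the tests, linearity transfers the error of \<open>\<O> (k - 1)\<close>, which the first row
  averages out.  Otherwise only \<open>|\<O> k| \<le> T \<surd>k!\<close> and the fourth moment of the permanent are
  available, but the probability of a bad minor is small enough for both.
\<close>

lemma soundness_step:
  assumes k: "2 \<le> k" "k \<le> n" and \<delta>: "0 < \<delta>" and c: "0 < c" "c \<le> 1"
    and O1[measurable]: "\<O> k \<in> borel_measurable (gauss k)"
    and O2[measurable]: "\<O> (k - 1) \<in> borel_measurable (gauss (k - 1))"
    and ok1[measurable]: "Measurable.pred (gauss k) (tests_ok n k \<delta> c \<O>)"
    and ok2[measurable]: "Measurable.pred (gauss (k - 1)) (tests_ok n (k - 1) \<delta> c \<O>)"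
    and bad: "measure (gauss (k - 1)) {Y \<in> space (gauss (k - 1)). \<not> tests_ok n (k - 1) \<delta> c \<O> Y}
      \<le> \<delta> ^ 4 * c / (96 * real n)"
    and IH: "(\<integral>\<^sup>+Y. ennreal (of_bool (tests_ok n (k - 1) \<delta> c \<O> Y) * (cmod (\<O> (k - 1) Y - Per (k - 1) Y))\<^sup>2)
        \<partial>gauss (k - 1)) \<le> ennreal ((2 * real n * real (k - 1) * \<delta>)\<^sup>2 * fact (k - 1))"
  shows "(\<integral>\<^sup>+X. ennreal (of_bool (tests_ok n k \<delta> c \<O> X) * (cmod (\<O> k X - Per k X))\<^sup>2) \<partial>gauss k)
    \<le> ennreal ((2 * real n * real k * \<delta>)\<^sup>2 * fact k)"
proof -
  interpret prob_space "gauss k" by (rule prob_space_gauss)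
  define D where "D = (real n * \<delta>)\<^sup>2 * fact k"
  \<comment> \<open>The optimal weight: the linear form \<open>S\<close> has second moment at most
    \<open>v\<^sup>2 * D\<close>, and (1 + v) (D + v^2 D / v) is exactly (1 + v)^2 D.\<close>
  define v where "v = 2 * real (k - 1)"
  have v: "0 < v" "1 + v = 2 * real k - 1" using k by (auto simp: v_def of_nat_diff)
  have D0: "0 \<le> D" by (simp add: D_def)
  have n: "1 \<le> real n" using k by simp
  define B where "B = {X \<in> space (gauss k). \<exists>i\<in>{1..k}. \<not> tests_ok n (k - 1) \<delta> c \<O> (minor k i X)}"
  have B[measurable]: "B \<in> sets (gauss k)" unfolding B_def by measurable
  have "prob B \<le> real k * (\<delta> ^ 4 * c / (96 * real n))"
    unfolding B_def using k by (intro minors_bad_prob bad ok2) auto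
  also have "\<dots> \<le> real n * (\<delta> ^ 4 * c / (96 * real n))"
    using k c by (intro mult_right_mono) auto
  finally have PB: "prob B \<le> \<delta> ^ 4 * c / 96" using n by simp
  \<comment> \<open>Here \<open>T\<close> is the bound on the squared modulus of the oracle value,
    not the threshold itself.\<close>
  define T where "T = (4 * real n / (\<delta> * sqrt c))\<^sup>2 * fact k"
  define g where "g Y = (if tests_ok n (k - 1) \<delta> c \<O> Y then \<O> (k - 1) Y - Per (k - 1) Y else 0)" for Y
  have g[measurable]: "g \<in> borel_measurable (gauss (k - 1))" unfolding g_def[abs_def] by measurable
  define S where "S X = (\<Sum>i = 1..k. X (1, i) * g (minor k i X))" for X
  have S[measurable]: "S \<in> borel_measurable (gauss k)"
    unfolding S_def[abs_def] using k
    by (intro borel_measurable_sum borel_measurable_times measurable_entry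
        measurable_compose[OF measurable_minor_gauss g]) auto
  \<comment> \<open>Each summand is nonnegative, so the bounds for good and for bad minors can be
    added into one bound, integrated only once.\<close>
  have pointwise: "of_bool (tests_ok n k \<delta> c \<O> X) * (cmod (\<O> k X - Per k X))\<^sup>2
      \<le> (1 + v) * D + (1 + v) / v * (cmod (S X))\<^sup>2 + 2 * T * indicator B X
        + 2 * (indicator B X * (cmod (Per k X))\<^sup>2)" if X: "X \<in> space (gauss k)" for X
  proof (cases "tests_ok n k \<delta> c \<O> X")
    case ok: True
    show ?thesis
    proof (cases "X \<in> B")
      case True
      have "(cmod (\<O> k X))\<^sup>2 \<le> T" using ok by (simp add: T_def tests_ok_def tail_ok_def)
      moreover have "(cmod (\<O> k X - Per k X))\<^sup>2 \<le> (cmod (\<O> k X) + cmod (Per k X))\<^sup>2"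
        by (intro power_mono norm_triangle_ineq4) auto
      moreover have "\<dots> \<le> 2 * (cmod (\<O> k X))\<^sup>2 + 2 * (cmod (Per k X))\<^sup>2"
        using weighted_square_add[of 1 "cmod (\<O> k X)" "cmod (Per k X)"] by simp
      moreover have "0 \<le> (1 + v) * D + (1 + v) / v * (cmod (S X))\<^sup>2"
        using v(1) D0 by simp
      ultimately have "(cmod (\<O> k X - Per k X))\<^sup>2 \<le> (1 + v) * D + (1 + v) / v * (cmod (S X))\<^sup>2 + 2 * T
          + 2 * (cmod (Per k X))\<^sup>2" by linarith
      then show ?thesis using True ok by simp
    next
      case False
      then have "cmod (\<O> k X - Per k X) \<le> real n * \<delta> * sqrt (fact k) + cmod (S X)"
        using tests_ok_error_le[OF k(1) \<delta> c(1) ok] X by (simp add: B_def S_def g_def)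
      then have "(cmod (\<O> k X - Per k X))\<^sup>2 \<le> (real n * \<delta> * sqrt (fact k) + cmod (S X))\<^sup>2"
        by (intro power_mono) auto
      also have "\<dots> \<le> (1 + v) * ((real n * \<delta> * sqrt (fact k))\<^sup>2 + (cmod (S X))\<^sup>2 / v)"
        by (rule weighted_square_add[OF v(1)])
      also have "\<dots> = (1 + v) * D + (1 + v) / v * (cmod (S X))\<^sup>2"
        by (simp add: D_def power_mult_distrib algebra_simps)
      finally show ?thesis using False ok by simp
    qed
  next
    case False
    then show ?thesis using v(1) D0 by (simp add: T_def)
  qed
  have Sint: "(\<integral>\<^sup>+X. ennreal ((cmod (S X))\<^sup>2) \<partial>gauss k) \<le> ennreal (v\<^sup>2 * D)"
  proof -
    have "(\<integral>\<^sup>+X. ennreal ((cmod (S X))\<^sup>2) \<partial>gauss k) = of_nat k * (\<integral>\<^sup>+Y. ennreal ((cmod (g Y))\<^sup>2) \<partial>gauss (k - 1))"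
      unfolding S_def using k by (intro gauss_row_linear_form g) auto
    also have "(\<integral>\<^sup>+Y. ennreal ((cmod (g Y))\<^sup>2) \<partial>gauss (k - 1))
        = (\<integral>\<^sup>+Y. ennreal (of_bool (tests_ok n (k - 1) \<delta> c \<O> Y) * (cmod (\<O> (k - 1) Y - Per (k - 1) Y))\<^sup>2) \<partial>gauss (k - 1))"
      by (intro nn_integral_cong) (simp add: g_def)
    also have "of_nat k * \<dots> \<le> of_nat k * ennreal ((2 * real n * real (k - 1) * \<delta>)\<^sup>2 * fact (k - 1))"
      by (intro mult_left_mono IH) auto
    also have "\<dots> = ennreal (real k * ((2 * real n * real (k - 1) * \<delta>)\<^sup>2 * fact (k - 1)))"
      by (simp add: ennreal_mult ennreal_of_nat_eq_real_of_nat)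
    also have "real k * ((2 * real n * real (k - 1) * \<delta>)\<^sup>2 * fact (k - 1)) = v\<^sup>2 * D"
    proof -
      have "fact k = real k * fact (k - 1)" using k by (simp add: fact_reduce)
      then show ?thesis unfolding v_def D_def power_mult_distrib by (simp only: mult_ac)
    qed
    finally show ?thesis .
  qed
  have Tint: "T * prob B \<le> D / 4"
  proof -
    have "T * prob B \<le> T * (\<delta> ^ 4 * c / 96)"
      using PB by (intro mult_left_mono) (auto simp: T_def)
    also have "\<dots> = D / 6"
      using \<delta> c by (simp add: T_def D_def power_mult_distrib power_divide field_simps power2_eq_square power4_eq_xxxx)
    finally show ?thesis using D0 by simp
  qed
  \<comment> \<open>This balances the two terms at order \<delta>^2 k!: \<open>l * prob B\<close> is
    at most \<delta>^2 k! n / 12, and the other term at most \<delta>^2 k! / 4 because k + 1 \<le> 2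
    n.\<close>
  define l where "l = 8 * real n * fact k / \<delta>\<^sup>2"
  have l: "0 < l" using \<delta> n by (simp add: l_def)
  have Pint: "(l * prob B + (real k + 1) * (fact k)\<^sup>2 / l) / 2 \<le> D / 4"
  proof -
    have "l * prob B \<le> l * (\<delta> ^ 4 * 1 / 96)"
    proof (rule mult_left_mono)
      have "\<delta> ^ 4 * c \<le> \<delta> ^ 4 * 1" using c \<delta> by (intro mult_left_mono) auto
      then show "prob B \<le> \<delta> ^ 4 * 1 / 96" using PB by linarith
    qed (use l in simp)
    also have "\<dots> = \<delta>\<^sup>2 * fact k * (real n / 12)"
      using \<delta> by (simp add: l_def field_simps power2_eq_square power4_eq_xxxx)
    finally have 1: "l * prob B \<le> \<delta>\<^sup>2 * fact k * (real n / 12)" .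
    have "(real k + 1) * (fact k)\<^sup>2 / l = \<delta>\<^sup>2 * fact k * ((real k + 1) / (8 * real n))"
      using \<delta> n by (simp add: l_def field_simps power2_eq_square)
    also have "\<dots> \<le> \<delta>\<^sup>2 * fact k * (1 / 4)"
    proof (rule mult_left_mono)
      show "(real k + 1) / (8 * real n) \<le> 1 / 4" using k n by (simp add: field_simps)
    qed simp
    finally have 2: "(real k + 1) * (fact k)\<^sup>2 / l \<le> \<delta>\<^sup>2 * fact k * (1 / 4)" .
    have "l * prob B + (real k + 1) * (fact k)\<^sup>2 / l \<le> \<delta>\<^sup>2 * fact k * (real n / 12 + 1 / 4)"
      using add_mono[OF 1 2] by (simp only: distrib_left)
    also have "\<dots> \<le> \<delta>\<^sup>2 * fact k * ((real n)\<^sup>2 / 2)"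
    proof (rule mult_left_mono)
      have "real n \<le> (real n)\<^sup>2" using n by (simp add: power2_eq_square)
      then show "real n / 12 + 1 / 4 \<le> (real n)\<^sup>2 / 2" using n by linarith
    qed simp
    also have "\<dots> = D / 2" by (simp add: D_def power_mult_distrib)
    finally have "(l * prob B + (real k + 1) * (fact k)\<^sup>2 / l) / 2 \<le> D / 2 / 2"
      by (rule divide_right_mono) simp
    then show ?thesis by simp
  qed
  have "(\<integral>\<^sup>+X. ennreal (of_bool (tests_ok n k \<delta> c \<O> X) * (cmod (\<O> k X - Per k X))\<^sup>2) \<partial>gauss k)
      \<le> (\<integral>\<^sup>+X. ennreal ((1 + v) * D) + ennreal ((1 + v) / v) * ennreal ((cmod (S X))\<^sup>2)
        + ennreal (2 * T) * indicator B X + 2 * ennreal (indicator B X * (cmod (Per k X))\<^sup>2) \<partial>gauss k)"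
  proof (rule nn_integral_mono)
    fix X assume X: "X \<in> space (gauss k)"
    have "ennreal (of_bool (tests_ok n k \<delta> c \<O> X) * (cmod (\<O> k X - Per k X))\<^sup>2)
        \<le> ennreal ((1 + v) * D + (1 + v) / v * (cmod (S X))\<^sup>2 + 2 * T * indicator B X
        + 2 * (indicator B X * (cmod (Per k X))\<^sup>2))"
      by (intro ennreal_leI pointwise X)
    also have "\<dots> = ennreal ((1 + v) * D) + ennreal ((1 + v) / v * (cmod (S X))\<^sup>2)
        + ennreal (2 * T * indicator B X) + ennreal (2 * (indicator B X * (cmod (Per k X))\<^sup>2))"
      using v(1) D0 by (simp add: T_def)
    also have "\<dots> = ennreal ((1 + v) * D) + ennreal ((1 + v) / v) * ennreal ((cmod (S X))\<^sup>2)
        + ennreal (2 * T) * indicator B X + 2 * ennreal (indicator B X * (cmod (Per k X))\<^sup>2)"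
    proof -
      have "ennreal ((1 + v) / v * (cmod (S X))\<^sup>2) = ennreal ((1 + v) / v) * ennreal ((cmod (S X))\<^sup>2)"
        using v(1) by (intro ennreal_mult) auto
      moreover have "ennreal (2 * T * indicator B X) = ennreal (2 * T) * indicator B X"
        by (simp add: indicator_def)
      moreover have "ennreal (2 * (indicator B X * (cmod (Per k X))\<^sup>2))
          = 2 * ennreal (indicator B X * (cmod (Per k X))\<^sup>2)"
        by (subst ennreal_mult) auto
      ultimately show ?thesis by (simp only:)
    qed
    finally show "ennreal (of_bool (tests_ok n k \<delta> c \<O> X) * (cmod (\<O> k X - Per k X))\<^sup>2)
      \<le> ennreal ((1 + v) * D) + ennreal ((1 + v) / v) * ennreal ((cmod (S X))\<^sup>2)
        + ennreal (2 * T) * indicator B X + 2 * ennreal (indicator B X * (cmod (Per k X))\<^sup>2)" .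
  qed
  also have "\<dots> = ennreal ((1 + v) * D) + ennreal ((1 + v) / v) * (\<integral>\<^sup>+X. ennreal ((cmod (S X))\<^sup>2) \<partial>gauss k)
      + ennreal (2 * T) * emeasure (gauss k) B + 2 * (\<integral>\<^sup>+X. ennreal (indicator B X * (cmod (Per k X))\<^sup>2) \<partial>gauss k)"
    by (simp add: nn_integral_add nn_integral_cmult emeasure_space_1)
  also have "\<dots> \<le> ennreal ((1 + v) * D) + ennreal ((1 + v) / v) * ennreal (v\<^sup>2 * D)
      + ennreal (2 * T) * ennreal (prob B) + 2 * ennreal (D / 4)"
    using Per_square_on_event[OF B l] ennreal_leI[OF Pint]
    by (intro add_mono mult_left_mono Sint order_refl) (auto simp: emeasure_eq_measure)
  also have "\<dots> = ennreal ((1 + v) * D + (1 + v) / v * (v\<^sup>2 * D) + 2 * T * prob B + 2 * (D / 4))"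
  proof -
    have "0 \<le> T" by (simp add: T_def)
    have "ennreal ((1 + v) / v) * ennreal (v\<^sup>2 * D) = ennreal ((1 + v) / v * (v\<^sup>2 * D))"
      using v(1) D0 by (intro ennreal_mult[symmetric]) auto
    moreover have "ennreal (2 * T) * ennreal (prob B) = ennreal (2 * T * prob B)"
      using \<open>0 \<le> T\<close> by (intro ennreal_mult[symmetric]) auto
    moreover have "2 * ennreal (D / 4) = ennreal (2 * (D / 4))"
      using D0 by (subst ennreal_mult) auto
    moreover have "0 \<le> (1 + v) * D" "0 \<le> (1 + v) / v * (v\<^sup>2 * D)" "0 \<le> 2 * T * prob B" "0 \<le> 2 * (D / 4)"
      using v(1) D0 \<open>0 \<le> T\<close> by auto
    ultimately show ?thesis by (simp only: ennreal_plus add_nonneg_nonneg)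
  qed
  also have "\<dots> \<le> ennreal ((2 * real n * real k * \<delta>)\<^sup>2 * fact k)"
  proof (rule ennreal_leI)
    \<comment> \<open>The oracle and the permanent contribute at most D / 2 each on the bad event,
      so the total is ((2k - 1)^2 + 1) D.\<close>
    have "(1 + v) * D + (1 + v) / v * (v\<^sup>2 * D) + 2 * T * prob B + 2 * (D / 4)
        \<le> (1 + v) * D + (1 + v) / v * (v\<^sup>2 * D) + D"
      using Tint by simp
    also have "\<dots> = ((1 + v)\<^sup>2 + 1) * D"
      using v(1) by (simp add: field_simps power2_eq_square)
    also have "\<dots> \<le> (2 * real k)\<^sup>2 * D"
      unfolding v(2) using k D0 by (intro mult_right_mono) (auto simp: power2_eq_square algebra_simps)
    also have "\<dots> = (2 * real n * real k * \<delta>)\<^sup>2 * fact k"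
      by (simp add: D_def power_mult_distrib)
    finally show "(1 + v) * D + (1 + v) / v * (v\<^sup>2 * D) + 2 * T * prob B + 2 * (D / 4)
      \<le> (2 * real n * real k * \<delta>)\<^sup>2 * fact k" .
  qed
  finally show ?thesis .
qed

text \<open>At size 1 the linearity test compares the oracle with the permanent itself, so the bound
  holds pointwise.\<close>

lemma soundness_base:
  assumes n: "1 \<le> n"
  shows "(\<integral>\<^sup>+X. ennreal (of_bool (tests_ok n 1 \<delta> c \<O> X) * (cmod (\<O> 1 X - Per 1 X))\<^sup>2) \<partial>gauss 1)
    \<le> ennreal ((2 * real n * real 1 * \<delta>)\<^sup>2 * fact 1)"
proof -
  interpret prob_space "gauss 1" by (rule prob_space_gauss)
  have "(\<integral>\<^sup>+X. ennreal (of_bool (tests_ok n 1 \<delta> c \<O> X) * (cmod (\<O> 1 X - Per 1 X))\<^sup>2) \<partial>gauss 1)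
      \<le> (\<integral>\<^sup>+X. ennreal ((2 * real n * real 1 * \<delta>)\<^sup>2 * fact 1) \<partial>gauss 1)"
  proof (intro nn_integral_mono ennreal_leI)
    fix X
    have "of_bool (tests_ok n 1 \<delta> c \<O> X) * (cmod (\<O> 1 X - Per 1 X))\<^sup>2 \<le> (real n)\<^sup>2 * \<delta>\<^sup>2"
      unfolding Per_1 by (auto simp: tests_ok_def linearity_ok_def row_expansion_def)
    also have "\<dots> \<le> (2 * real n * real 1 * \<delta>)\<^sup>2 * fact 1"
      by (simp add: power_mult_distrib)
    finally show "of_bool (tests_ok n 1 \<delta> c \<O> X) * (cmod (\<O> 1 X - Per 1 X))\<^sup>2
        \<le> (2 * real n * real 1 * \<delta>)\<^sup>2 * fact 1" .
  qed
  also have "\<dots> = ennreal ((2 * real n * real 1 * \<delta>)\<^sup>2 * fact 1)"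
    by (simp only: nn_integral_const emeasure_space_1 mult_1_right)
  finally show ?thesis .
qed

lemma soundness:
  assumes \<delta>: "0 < \<delta>" "\<delta> \<le> 1" and c: "0 < c" "c \<le> 1"
    and meas: "\<And>k. k \<in> {1..n} \<Longrightarrow> \<O> k \<in> borel_measurable (gauss k)"
    and k: "k \<in> {1..n}"
    and accept: "measure (outcome \<O> (PTest n \<delta> c)) {Reject} < 1 - exp (- real n)"
  shows "1 - \<delta> ^ 4 * c / (64 * real n) \<le> (\<integral>X. of_bool (tests_ok n k \<delta> c \<O> X) \<partial>gauss k)"
    and "(\<integral>\<^sup>+X. ennreal (of_bool (tests_ok n k \<delta> c \<O> X) * (cmod (\<O> k X - Per k X))\<^sup>2) \<partial>gauss k)
      \<le> ennreal ((2 * real n * real k * \<delta>)\<^sup>2 * fact k)"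
proof -
  define T where "T = 4 * real n / (\<delta> * sqrt c)"
  define d where "d = repetitions n \<delta> c"
  define a where "a j = linearity_prob n j \<delta> \<O> * tail_prob j T \<O>" for j
  have n: "1 \<le> n" using k by auto
  note d_bounds = repetitions_bounds[OF \<delta> c n, folded d_def]
  have lin[measurable]: "Measurable.pred (gauss j) (linearity_ok n j \<delta> \<O>)" if "j \<in> {1..n}" for j
    using that by (intro pred_linearity_ok meas) auto
  have tail[measurable]: "Measurable.pred (gauss j) (tail_ok j T' \<O>)" if "j \<in> {1..n}" for j T'
    using that by (intro pred_tail_ok meas) auto
  have ok[measurable]: "Measurable.pred (gauss j) (tests_ok n j \<delta> c \<O>)" if "j \<in> {1..n}" for j
    using that by (intro pred_tests_ok meas) auto
  have unit: "0 \<le> linearity_prob n j \<delta> \<O>" "linearity_prob n j \<delta> \<O> \<le> 1"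
    "0 \<le> tail_prob j T \<O>" "tail_prob j T \<O> \<le> 1" for j
    unfolding linearity_prob_def tail_prob_def using prob_space.prob_le_1[OF prob_space_gauss] by auto
  have a: "0 \<le> a j" "a j \<le> 1" "a j \<le> linearity_prob n j \<delta> \<O>" "a j \<le> tail_prob j T \<O>" for j
    unfolding a_def using unit[of j] by (auto intro: mult_le_one mult_left_le mult_left_le_one_le)
  have "accepts_with_prob \<O> (PTest n \<delta> c) (\<Prod>j = 1..n. a j ^ d)"
    unfolding a_def T_def d_def using lin tail by (rule accepts_with_prob_PTest)
  from accepts_with_prob_Reject[OF this] accept
  have A: "exp (- real n) < (\<Prod>j = 1..n. a j ^ d)" by simp
  \<comment> \<open>A product of numbers in [0, 1] above exp (- n) has every factor above exp (- n).
    With \<open>a j \<le> exp (- (1 - a j))\<close> this yields d (1 - a j) < n, and the size of d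
    does the rest.\<close>
  have a_large: "1 - a j \<le> \<delta> ^ 4 * c / (192 * real n)" if j: "j \<in> {1..n}" for j
  proof -
    have "(\<Prod>j = 1..n. a j ^ d) = a j ^ d * (\<Prod>i\<in>{1..n} - {j}. a i ^ d)"
      using j by (intro prod.remove) auto
    also have "\<dots> \<le> a j ^ d"
      using a by (intro mult_left_le prod_le_1 power_le_one zero_le_power conjI) auto
    also have "\<dots> \<le> exp (- (1 - a j)) ^ d"
      using a exp_ge_add_one_self[of "- (1 - a j)"] by (intro power_mono) auto
    also have "\<dots> = exp (- (real d * (1 - a j)))"
      by (simp add: exp_of_nat_mult[symmetric] algebra_simps)
    finally have "real d * (1 - a j) < real n" using A by (smt (verit) exp_less_cancel_iff)
    moreover have "192 * (real n)\<^sup>2 / (\<delta> ^ 4 * c) * (1 - a j) \<le> real d * (1 - a j)"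
      using d_bounds(1) a by (intro mult_right_mono) auto
    ultimately have "192 * (real n)\<^sup>2 / (\<delta> ^ 4 * c) * (1 - a j) \<le> real n" by linarith
    then have "real n * (192 * real n / (\<delta> ^ 4 * c) * (1 - a j)) \<le> real n * 1"
      by (simp add: power2_eq_square mult_ac)
    then have "192 * real n / (\<delta> ^ 4 * c) * (1 - a j) \<le> 1"
      using n by (subst (asm) mult_le_cancel_left_pos) auto
    moreover have "0 < \<delta> ^ 4 * c" "0 < real n" using \<delta> c n by auto
    ultimately show ?thesis by (simp add: field_simps)
  qed
  have bad: "measure (gauss j) {X \<in> space (gauss j). \<not> tests_ok n j \<delta> c \<O> X} \<le> \<delta> ^ 4 * c / (96 * real n)"
    if j: "j \<in> {1..n}" for j
  proof -
    interpret prob_space "gauss j" by (rule prob_space_gauss)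
    note [measurable] = lin[OF j] tail[OF j] ok[OF j]
    have eq: "{X \<in> space (gauss j). \<not> tests_ok n j \<delta> c \<O> X}
      = {X \<in> space (gauss j). \<not> linearity_ok n j \<delta> \<O> X} \<union> {X \<in> space (gauss j). \<not> tail_ok j T \<O> X}"
      by (auto simp: tests_ok_def T_def)
    have "prob {X \<in> space (gauss j). \<not> tests_ok n j \<delta> c \<O> X}
      \<le> prob {X \<in> space (gauss j). \<not> linearity_ok n j \<delta> \<O> X} + prob {X \<in> space (gauss j). \<not> tail_ok j T \<O> X}"
      unfolding eq by (intro measure_Un_le) measurable
    also have "prob {X \<in> space (gauss j). \<not> linearity_ok n j \<delta> \<O> X} = 1 - linearity_prob n j \<delta> \<O>"
      unfolding linearity_prob_def by (rule prob_neg) measurable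
    also have "prob {X \<in> space (gauss j). \<not> tail_ok j T \<O> X} = 1 - tail_prob j T \<O>"
      unfolding tail_prob_def by (rule prob_neg) measurable
    also have "1 - linearity_prob n j \<delta> \<O> + (1 - tail_prob j T \<O>) \<le> 2 * (\<delta> ^ 4 * c / (192 * real n))"
      using a_large[OF j] a(3,4)[of j] by linarith
    also have "2 * (\<delta> ^ 4 * c / (192 * real n)) = \<delta> ^ 4 * c / (96 * real n)" by simp
    finally show ?thesis .
  qed
  have "(\<integral>X. of_bool (tests_ok n k \<delta> c \<O> X) \<partial>gauss k) = 1 - measure (gauss k) {X \<in> space (gauss k). \<not> tests_ok n k \<delta> c \<O> X}"
  proof -
    interpret prob_space "gauss k" by (rule prob_space_gauss)
    note [measurable] = ok[OF k]
    have "(\<integral>X. of_bool (tests_ok n k \<delta> c \<O> X) \<partial>gauss k) = (\<integral>X. indicator {X \<in> space (gauss k). tests_ok n k \<delta> c \<O> X} X \<partial>gauss k)"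
      by (intro Bochner_Integration.integral_cong) (auto simp: indicator_def)
    also have "\<dots> = prob {X \<in> space (gauss k). tests_ok n k \<delta> c \<O> X}" by simp
    also have "\<dots> = 1 - prob {X \<in> space (gauss k). \<not> tests_ok n k \<delta> c \<O> X}"
      by (subst prob_neg) auto
    finally show ?thesis .
  qed
  moreover have "\<delta> ^ 4 * c / (96 * real n) \<le> \<delta> ^ 4 * c / (64 * real n)"
    using \<delta> c n by (intro divide_left_mono) auto
  ultimately show "1 - \<delta> ^ 4 * c / (64 * real n) \<le> (\<integral>X. of_bool (tests_ok n k \<delta> c \<O> X) \<partial>gauss k)"
    using bad[OF k] by linarith
  have "1 \<le> k" using k by simp
  then show "(\<integral>\<^sup>+X. ennreal (of_bool (tests_ok n k \<delta> c \<O> X) * (cmod (\<O> k X - Per k X))\<^sup>2) \<partial>gauss k)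
      \<le> ennreal ((2 * real n * real k * \<delta>)\<^sup>2 * fact k)"
    using k
  proof (induction k rule: dec_induct)
    case base
    show ?case by (rule soundness_base[OF n])
  next
    case (step j)
    then have "j \<in> {1..n}" "Suc j \<in> {1..n}" by auto
    have IH: "(\<integral>\<^sup>+Y. ennreal (of_bool (tests_ok n j \<delta> c \<O> Y) * (cmod (\<O> j Y - Per j Y))\<^sup>2) \<partial>gauss j)
        \<le> ennreal ((2 * real n * real j * \<delta>)\<^sup>2 * fact j)"
      using step.IH \<open>j \<in> {1..n}\<close> by blast
    have pred: "Suc j - 1 = j" by simp
    have "2 \<le> Suc j" "Suc j \<le> n" using step by auto
    from soundness_step[OF this \<delta>(1) c, where \<O> = \<O>, unfolded pred,
        OF meas[OF \<open>Suc j \<in> _\<close>] meas[OF \<open>j \<in> _\<close>] ok[OF \<open>Suc j \<in> _\<close>] ok[OF \<open>j \<in> _\<close>]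
          bad[OF \<open>j \<in> _\<close>] IH]
    show ?case .
  qed
qed

section \<open>Completeness\<close>

text \<open>Of the allowance n \<delta> sqrt(k!), the error of \<open>\<O> k\<close> uses one
  \<delta> sqrt(k!). The minors get the other n - 1: by Cauchy-Schwarz the row has l1 norm at most
  sqrt k (n - 1), and sqrt k times sqrt((k - 1)!) is sqrt(k!).\<close>

lemma linearity_ok_of_row_norm:
  assumes k: "2 \<le> k" "k \<le> n" and \<delta>: "0 < \<delta>"
    and approx: "(cmod (\<O> k X - Per k X))\<^sup>2 \<le> \<delta>\<^sup>2 * fact k"
      "\<And>Y. Y \<in> cmatrices (k - 1) \<Longrightarrow> (cmod (\<O> (k - 1) Y - Per (k - 1) Y))\<^sup>2 \<le> \<delta>\<^sup>2 * fact (k - 1)"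
    and row: "(\<Sum>i = 1..k. (cmod (X (1, i)))\<^sup>2) \<le> (real n - 1)\<^sup>2"
  shows "linearity_ok n k \<delta> \<O> X"
proof -
  have root: "z \<le> \<delta> * sqrt (fact m)" if "z\<^sup>2 \<le> \<delta>\<^sup>2 * fact m" for z m
    using \<delta> that by (intro power2_le_imp_le[of z]) (auto simp: power_mult_distrib)
  have "(\<Sum>i = 1..k. 1 * cmod (X (1, i)))\<^sup>2 \<le> (\<Sum>i = 1..k. 1\<^sup>2) * (\<Sum>i = 1..k. (cmod (X (1, i)))\<^sup>2)"
    by (rule Cauchy_Schwarz_ineq_sum)
  also have "\<dots> \<le> real k * (real n - 1)\<^sup>2"
    using row by (simp add: mult_left_mono)
  also have "\<dots> = (sqrt (real k) * (real n - 1))\<^sup>2"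
    by (simp add: power_mult_distrib)
  finally have row1: "(\<Sum>i = 1..k. cmod (X (1, i))) \<le> sqrt (real k) * (real n - 1)"
    using k by (intro power2_le_imp_le[of "\<Sum>i = 1..k. cmod (X (1, i))"]) auto
  have "Per k X - row_expansion k \<O> X
      = (\<Sum>i = 1..k. X (1, i) * (Per (k - 1) (minor k i X) - \<O> (k - 1) (minor k i X)))"
    using k Per_expand_first_row[of k X] by (simp add: row_expansion_def sum_subtractf right_diff_distrib)
  also have "cmod \<dots> \<le> (\<Sum>i = 1..k. cmod (X (1, i)) * (\<delta> * sqrt (fact (k - 1))))"
    using root approx(2)[OF minor_in_cmatrices]
    by (intro sum_norm_le) (auto simp: norm_mult norm_minus_commute intro!: mult_left_mono)
  also have "\<dots> = (\<Sum>i = 1..k. cmod (X (1, i))) * (\<delta> * sqrt (fact (k - 1)))"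
    by (simp add: sum_distrib_right)
  also have "\<dots> \<le> sqrt (real k) * (real n - 1) * (\<delta> * sqrt (fact (k - 1)))"
    using \<delta> by (intro mult_right_mono row1) auto
  also have "\<dots> = (real n - 1) * \<delta> * sqrt (real k * fact (k - 1))"
    by (simp add: real_sqrt_mult)
  also have "real k * fact (k - 1) = fact k" using k by (simp add: fact_reduce)
  finally have "cmod (Per k X - row_expansion k \<O> X) \<le> (real n - 1) * \<delta> * sqrt (fact k)" .
  moreover have "cmod (\<O> k X - Per k X) \<le> \<delta> * sqrt (fact k)"
    by (rule root[OF approx(1)])
  moreover have "cmod (\<O> k X - row_expansion k \<O> X)
      \<le> cmod (\<O> k X - Per k X) + cmod (Per k X - row_expansion k \<O> X)" by norm
  ultimately have "cmod (\<O> k X - row_expansion k \<O> X) \<le> real n * \<delta> * sqrt (fact k)"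
    by (simp add: algebra_simps)
  then have "(cmod (\<O> k X - row_expansion k \<O> X))\<^sup>2 \<le> (real n * \<delta> * sqrt (fact k))\<^sup>2"
    by (intro power_mono) auto
  then show ?thesis by (simp add: linearity_ok_def power_mult_distrib)
qed

definition approximates_Per :: "nat \<Rightarrow> real \<Rightarrow> oracles \<Rightarrow> bool" where
  "approximates_Per n \<delta> \<O> \<longleftrightarrow>
    (\<forall>k\<in>{1..n}. \<forall>X\<in>cmatrices k. (cmod (\<O> k X - Per k X))\<^sup>2 \<le> \<delta>\<^sup>2 * fact k) \<and>
    (\<forall>k\<in>{1..n}. \<O> k \<in> borel_measurable (gauss k))"

lemma approximates_PerD:
  assumes "approximates_Per n \<delta> \<O>" "k \<in> {1..n}"
  shows "X \<in> cmatrices k \<Longrightarrow> (cmod (\<O> k X - Per k X))\<^sup>2 \<le> \<delta>\<^sup>2 * fact k"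
    and "\<O> k \<in> borel_measurable (gauss k)"
  using assms by (auto simp: approximates_Per_def)

lemma linearity_prob_1:
  assumes ap: "approximates_Per n \<delta> \<O>" and n: "1 \<le> n"
  shows "linearity_prob n 1 \<delta> \<O> = 1"
proof -
  interpret prob_space "gauss 1" by (rule prob_space_gauss)
  have "linearity_ok n 1 \<delta> \<O> X" if "X \<in> space (gauss 1)" for X
  proof -
    have "(cmod (\<O> 1 X - Per 1 X))\<^sup>2 \<le> \<delta>\<^sup>2 * fact 1"
      using that n by (intro approximates_PerD[OF ap]) (auto simp: space_gauss)
    also have "\<dots> \<le> (real n)\<^sup>2 * \<delta>\<^sup>2"
      using n mult_right_mono[of 1 "(real n)\<^sup>2" "\<delta>\<^sup>2"] by simp
    finally show ?thesis by (simp add: linearity_ok_def row_expansion_def Per_1[unfolded One_nat_def])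
  qed
  then have "{X \<in> space (gauss 1). linearity_ok n 1 \<delta> \<O> X} = space (gauss 1)" by auto
  then show ?thesis unfolding linearity_prob_def by (simp only: prob_space)
qed

lemma linearity_prob_ge_row_norm:
  assumes ap: "approximates_Per n \<delta> \<O>" and k: "2 \<le> k" "k \<le> n" and \<delta>: "0 < \<delta>" and s: "s \<le> (real n - 1)\<^sup>2"
  shows "measure (gauss k) {X \<in> space (gauss k). (\<Sum>i = 1..k. (cmod (X (1, i)))\<^sup>2) \<le> s} \<le> linearity_prob n k \<delta> \<O>"
proof -
  interpret prob_space "gauss k" by (rule prob_space_gauss)
  have kn: "k \<in> {1..n}" "k - 1 \<in> {1..n}" using k by auto
  have [measurable]: "Measurable.pred (gauss k) (linearity_ok n k \<delta> \<O>)"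
    using ap kn by (intro pred_linearity_ok) (auto simp: approximates_Per_def)
  show ?thesis
    unfolding linearity_prob_def
  proof (rule finite_measure_mono)
    show "{X \<in> space (gauss k). (\<Sum>i = 1..k. (cmod (X (1, i)))\<^sup>2) \<le> s} \<subseteq> {X \<in> space (gauss k). linearity_ok n k \<delta> \<O> X}"
    proof clarify
      fix X assume X: "X \<in> space (gauss k)" "(\<Sum>i = 1..k. (cmod (X (1, i)))\<^sup>2) \<le> s"
      show "linearity_ok n k \<delta> \<O> X"
        using ap kn X s by (intro linearity_ok_of_row_norm k \<delta>) (auto simp: approximates_Per_def space_gauss)
    qed
  qed measurable
qed

text \<open>A lower bound depending on \<open>k\<close> alone, hence uniform in the oracles and in
  \<open>\<delta>\<close>. For \<open>k \<ge> 2\<close> it uses (n - 1)^2 \<ge> 1; size 1 is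
  separate because n may be 1.\<close>

lemma linearity_prob_ge_unit_row:
  assumes ap: "approximates_Per n \<delta> \<O>" and k: "k \<in> {1..n}" and \<delta>: "0 < \<delta>"
  shows "measure (gauss k) {X \<in> space (gauss k). (\<Sum>i = 1..k. (cmod (X (1, i)))\<^sup>2) \<le> 1} \<le> linearity_prob n k \<delta> \<O>"
proof (cases "k = 1")
  case True
  then show ?thesis using linearity_prob_1[OF ap] k prob_space.prob_le_1[OF prob_space_gauss] by simp
next
  case False
  then have "1 \<le> (real n - 1)\<^sup>2" using k by (intro one_le_power) auto
  with False k show ?thesis by (intro linearity_prob_ge_row_norm ap \<delta>) auto
qed

lemma linearity_prob_large:
  assumes ap: "approximates_Per n \<delta> \<O>" and k: "k \<in> {1..n}" and \<delta>: "0 < \<delta>"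
  shows "1 - 2 ^ n * exp (- (real n - 1)\<^sup>2 / 2) \<le> linearity_prob n k \<delta> \<O>"
proof (cases "k = 1")
  case True
  then show ?thesis using linearity_prob_1[OF ap] k by simp
next
  case False
  interpret prob_space "gauss k" by (rule prob_space_gauss)
  note [measurable] = measurable_row_norm[of k]
  let ?N = "\<lambda>X. \<Sum>i = 1..k. (cmod (X (1, i)))\<^sup>2"
  let ?s = "(real n - 1)\<^sup>2"
  have eq: "{X \<in> space (gauss k). ?s < ?N X} = {X \<in> space (gauss k). \<not> ?N X \<le> ?s}" by auto
  have "1 - prob {X \<in> space (gauss k). ?N X \<le> ?s} = prob {X \<in> space (gauss k). ?s < ?N X}"
    unfolding eq by (rule prob_neg[symmetric]) measurable
  also have "\<dots> \<le> 2 ^ k * exp (- ?s / 2)" by (rule gauss_row_norm_tail)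
  also have "\<dots> \<le> 2 ^ n * exp (- ?s / 2)" using k by (intro mult_right_mono power_increasing) auto
  finally have "1 - 2 ^ n * exp (- ?s / 2) \<le> prob {X \<in> space (gauss k). ?N X \<le> ?s}" by simp
  also have "\<dots> \<le> linearity_prob n k \<delta> \<O>"
    using False k by (intro linearity_prob_ge_row_norm ap \<delta>) auto
  finally show ?thesis .
qed

text \<open>The oracle is within sqrt(k!) of the permanent, so a failure forces |Per| \<ge> (T - 1)
  sqrt(k!), which Markov's inequality for the fourth moment makes rare.\<close>

lemma tail_prob_ge:
  assumes ap: "approximates_Per n \<delta> \<O>" and k: "k \<in> {1..n}" and \<delta>: "0 < \<delta>" "\<delta> \<le> 1" and T: "1 < T"
  shows "1 - (real n + 1) / (T - 1) ^ 4 \<le> tail_prob k T \<O>"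
proof -
  interpret prob_space "gauss k" by (rule prob_space_gauss)
  have [measurable]: "Measurable.pred (gauss k) (tail_ok k T \<O>)"
    using ap k by (intro pred_tail_ok) (auto simp: approximates_Per_def)
  let ?A = "{X \<in> space (gauss k). \<not> tail_ok k T \<O> X}"
  let ?q = "(T - 1) ^ 4 * (fact k)\<^sup>2"
  have q: "0 < ?q" using T by simp
  have large: "?q \<le> cmod (Per k X) ^ 4" if X: "X \<in> ?A" for X
  proof -
    have "(cmod (\<O> k X - Per k X))\<^sup>2 \<le> \<delta>\<^sup>2 * fact k"
      using ap k X by (auto simp: approximates_Per_def space_gauss)
    also have "\<dots> \<le> 1 * fact k"
      using \<delta> by (intro mult_right_mono power_le_one) auto
    also have "\<dots> = (sqrt (fact k))\<^sup>2" by simp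
    finally have 1: "cmod (\<O> k X - Per k X) \<le> sqrt (fact k)" by (rule power2_le_imp_le) simp
    have "(T * sqrt (fact k))\<^sup>2 \<le> (cmod (\<O> k X))\<^sup>2"
      using X by (simp add: tail_ok_def power_mult_distrib)
    then have 2: "T * sqrt (fact k) \<le> cmod (\<O> k X)" by (rule power2_le_imp_le) simp
    have "cmod (\<O> k X) \<le> cmod (\<O> k X - Per k X) + cmod (Per k X)" by norm
    then have "(T - 1) * sqrt (fact k) \<le> cmod (Per k X)" using 1 2 by (simp add: algebra_simps)
    then have "((T - 1) * sqrt (fact k)) ^ 4 \<le> cmod (Per k X) ^ 4"
      using T by (intro power_mono) auto
    moreover have "sqrt (fact k) ^ 4 = (fact k)\<^sup>2"
    proof -
      have "sqrt (fact k) ^ 4 = ((sqrt (fact k))\<^sup>2)\<^sup>2" by (simp only: power_mult[symmetric]) simp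
      then show ?thesis by simp
    qed
    ultimately show ?thesis by (simp add: power_mult_distrib)
  qed
  have "ennreal ?q * emeasure (gauss k) ?A = (\<integral>\<^sup>+X. ennreal ?q * indicator ?A X \<partial>gauss k)"
    by (rule nn_integral_cmult_indicator[symmetric]) measurable
  also have "\<dots> \<le> (\<integral>\<^sup>+X. ennreal (cmod (Per k X) ^ 4) \<partial>gauss k)"
    using large by (intro nn_integral_mono) (auto simp: indicator_def intro!: ennreal_leI)
  also have "\<dots> \<le> ennreal ((real k + 1) * (fact k)\<^sup>2)" by (rule Per_fourth_moment)
  finally have "ennreal (?q * prob ?A) \<le> ennreal ((real k + 1) * (fact k)\<^sup>2)"
    unfolding emeasure_eq_measure using q by (subst ennreal_mult) auto
  then have "?q * prob ?A \<le> (real k + 1) * (fact k)\<^sup>2" by (subst (asm) ennreal_le_iff) auto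
  then have "(T - 1) ^ 4 * prob ?A \<le> real k + 1"
    by (simp add: mult.commute mult.left_commute)
  also have "\<dots> \<le> real n + 1" using k by simp
  finally have "prob ?A \<le> (real n + 1) / (T - 1) ^ 4"
    using T by (simp add: field_simps)
  moreover have "prob ?A = 1 - tail_prob k T \<O>"
    unfolding tail_prob_def by (rule prob_neg) measurable
  ultimately show ?thesis by linarith
qed

lemma accept_prob_ge:
  assumes ap: "approximates_Per n \<delta> \<O>"
    and "0 \<le> \<alpha>" "0 \<le> \<beta>"
    and "\<And>k. k \<in> {1..n} \<Longrightarrow> \<alpha> \<le> linearity_prob n k \<delta> \<O>"
    and "\<And>k. k \<in> {1..n} \<Longrightarrow> \<beta> \<le> tail_prob k (4 * real n / (\<delta> * sqrt c)) \<O>"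
  shows "(\<alpha> * \<beta>) ^ (n * repetitions n \<delta> c) \<le> measure (outcome \<O> (PTest n \<delta> c)) {Accept}"
proof -
  have "accepts_with_prob \<O> (PTest n \<delta> c)
    (\<Prod>k = 1..n. (linearity_prob n k \<delta> \<O> * tail_prob k (4 * real n / (\<delta> * sqrt c)) \<O>)
      ^ repetitions n \<delta> c)"
    by (intro accepts_with_prob_PTest pred_linearity_ok pred_tail_ok approximates_PerD(2)[OF ap]) auto
  then have "measure (outcome \<O> (PTest n \<delta> c)) {Accept}
    = (\<Prod>k = 1..n. (linearity_prob n k \<delta> \<O> * tail_prob k (4 * real n / (\<delta> * sqrt c)) \<O>)
      ^ repetitions n \<delta> c)"
    by (simp add: accepts_with_prob_def)
  also have "\<dots> \<ge> (\<Prod>k = 1..n. (\<alpha> * \<beta>) ^ repetitions n \<delta> c)"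
    using assms by (intro prod_mono conjI power_mono mult_mono zero_le_power mult_nonneg_nonneg)
      (auto intro: order_trans)
  also have "(\<Prod>k = 1..n. (\<alpha> * \<beta>) ^ repetitions n \<delta> c) = (\<alpha> * \<beta>) ^ (n * repetitions n \<delta> c)"
    by (simp add: power_mult[symmetric] mult.commute)
  finally show ?thesis .
qed

text \<open>The expression times c bounds the total failure probability of all runs. The first term
  tends to 0, its exponent being -n^2 / 4 + O(n); the second tends to 193 / 256.\<close>

lemma eventually_reject_prob_small:
  "eventually (\<lambda>n::nat. 193 * real n ^ 3 * 2 ^ n * exp (- (real n - 1)\<^sup>2 / 2 + (real n)\<^sup>2 / 4) +
    193 * (real n + 1) / (256 * real n * (1 - 1 / (4 * real n)) ^ 4) \<le> 1) sequentially"
proof -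
  have "((\<lambda>n::nat. 193 * real n ^ 3 * 2 ^ n * exp (- (real n - 1)\<^sup>2 / 2 + (real n)\<^sup>2 / 4) +
    193 * (real n + 1) / (256 * real n * (1 - 1 / (4 * real n)) ^ 4)) \<longlongrightarrow> 193 / 256) sequentially"
    by real_asymp
  then show ?thesis
    by (rule eventually_mono[OF order_tendstoD(2)[of _ _ _ 1]]) auto
qed

lemma completeness_large:
  assumes ap: "approximates_Per n \<delta> \<O>"
    and \<delta>: "0 < \<delta>" "\<delta> \<le> 1" and c: "0 < c" "c \<le> 1" and n: "1 \<le> n"
    and large: "4 * sqrt (ln (1 / (c * \<delta>))) \<le> real n"
    and small: "193 * real n ^ 3 * 2 ^ n * exp (- (real n - 1)\<^sup>2 / 2 + (real n)\<^sup>2 / 4) +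
      193 * (real n + 1) / (256 * real n * (1 - 1 / (4 * real n)) ^ 4) \<le> 1"
  shows "1 - c \<le> measure (outcome \<O> (PTest n \<delta> c)) {Accept}"
proof -
  define T where "T = 4 * real n / (\<delta> * sqrt c)"
  define d where "d = repetitions n \<delta> c"
  define r where "r = (1 - 1 / (4 * real n)) ^ 4"
  define P where "P = 2 ^ n * exp (- (real n - 1)\<^sup>2 / 2)"
  define Q where "Q = (real n + 1) / (T - 1) ^ 4"
  note d_bounds = repetitions_bounds[OF \<delta> c n, folded d_def]
  have n1: "1 \<le> real n" using n by simp
  have r: "0 < r" unfolding r_def using n1 by (intro zero_less_power) (simp add: field_simps)
  have dc: "0 < \<delta> * sqrt c" "\<delta> * sqrt c \<le> 1"
    using \<delta> c by (auto intro!: mult_le_one)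
  have T: "4 * real n \<le> T" unfolding T_def using dc n1 by (simp add: field_simps)
  have T4: "T ^ 4 = 256 * real n ^ 4 / (\<delta> ^ 4 * c\<^sup>2)"
  proof -
    have "sqrt c ^ 4 = ((sqrt c)\<^sup>2)\<^sup>2" by (simp only: power_mult[symmetric]) simp
    then have "sqrt c ^ 4 = c\<^sup>2" using c by simp
    then show ?thesis by (simp add: T_def power_divide power_mult_distrib)
  qed
  \<comment> \<open>As T \<ge> 4 n, passing from T to T - 1 costs only the factor \<open>r\<close>
    in the fourth power, and \<open>r\<close> tends to 1.\<close>
  have "T * (1 - 1 / (4 * real n)) \<le> T - 1"
    using T n1 by (simp add: field_simps)
  then have "(T * (1 - 1 / (4 * real n))) ^ 4 \<le> (T - 1) ^ 4"
    using T n1 by (intro power_mono mult_nonneg_nonneg) (auto simp: field_simps)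
  then have Tr: "T ^ 4 * r \<le> (T - 1) ^ 4" by (simp add: power_mult_distrib r_def)
  have T0: "0 < T ^ 4" using T n1 by (intro zero_less_power) linarith
  have "Q \<le> (real n + 1) / (T ^ 4 * r)"
    unfolding Q_def using Tr T0 r by (intro divide_left_mono) (auto intro!: mult_pos_pos)
  also have "\<dots> = (real n + 1) * (\<delta> ^ 4 * c\<^sup>2) / (256 * real n ^ 4 * r)"
    unfolding T4 using \<delta> c n1 r by (simp add: field_simps)
  finally have Q: "Q \<le> (real n + 1) * (\<delta> ^ 4 * c\<^sup>2) / (256 * real n ^ 4 * r)" .
  have Q0: "0 \<le> Q" and P0: "0 \<le> P" unfolding Q_def P_def using T n1 by auto
  have nd: "real n * real d \<le> 193 * real n ^ 3 / (\<delta> ^ 4 * c)"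
    using mult_left_mono[OF d_bounds(2), of "real n"] by (simp add: power2_eq_square power3_eq_cube mult_ac)
  have ndQ: "real n * real d * Q \<le> c * (193 * (real n + 1) / (256 * real n * r))"
  proof -
    have "real n * real d * Q \<le> 193 * real n ^ 3 / (\<delta> ^ 4 * c) * ((real n + 1) * (\<delta> ^ 4 * c\<^sup>2) / (256 * real n ^ 4 * r))"
      using Q0 \<delta> c by (intro mult_mono nd Q) auto
    also have "\<dots> = c * (193 * (real n + 1) / (256 * real n * r))"
      using \<delta> c n1 r by (simp add: divide_simps power2_eq_square power3_eq_cube power4_eq_xxxx)
    finally show ?thesis .
  qed
  \<comment> \<open>Here the lower bound on n enters: it gives (1 / (c \<delta>))^4 \<le> exp(n^2 /
    4), which pays both for the number of repetitions and for the target c. Half of the Gaussian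
    decay exp(- n^2 / 2) remains.\<close>
  have exp_bound: "1 / (\<delta> ^ 4 * c) \<le> c * exp ((real n)\<^sup>2 / 4)"
  proof -
    have cd: "0 < c * \<delta>" "c * \<delta> \<le> 1" using \<delta> c by (auto intro!: mult_le_one)
    have ln0: "0 \<le> ln (1 / (c * \<delta>))" using cd by simp
    have "16 * ln (1 / (c * \<delta>)) = (4 * sqrt (ln (1 / (c * \<delta>))))\<^sup>2"
      using ln0 by (simp add: power_mult_distrib)
    also have "\<dots> \<le> (real n)\<^sup>2" using large ln0 by (intro power_mono) auto
    finally have "4 * ln (1 / (c * \<delta>)) \<le> (real n)\<^sup>2 / 4" by simp
    then have "exp (4 * ln (1 / (c * \<delta>))) \<le> exp ((real n)\<^sup>2 / 4)" by simp
    moreover have "exp (4 * ln (1 / (c * \<delta>))) = (1 / (c * \<delta>)) ^ 4"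
      using cd exp_of_nat_mult[of 4 "ln (1 / (c * \<delta>))"] by simp
    ultimately have "c * (1 / (c * \<delta>)) ^ 4 \<le> c * exp ((real n)\<^sup>2 / 4)"
      using c by (intro mult_left_mono) auto
    moreover have "1 / (\<delta> ^ 4 * c) \<le> c * (1 / (c * \<delta>)) ^ 4"
    proof -
      have "c * (1 / (c * \<delta>)) ^ 4 = 1 / (\<delta> ^ 4 * c) * (1 / c\<^sup>2)"
        using \<delta> c by (simp add: field_simps power2_eq_square power4_eq_xxxx)
      moreover have "1 \<le> 1 / c\<^sup>2" using c by (simp add: power_le_one)
      ultimately show ?thesis
        using mult_left_mono[of 1 "1 / c\<^sup>2" "1 / (\<delta> ^ 4 * c)"] \<delta> c by simp
    qed
    ultimately show ?thesis by linarith
  qed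
  have ndP: "real n * real d * P \<le> c * (193 * real n ^ 3 * 2 ^ n * exp (- (real n - 1)\<^sup>2 / 2 + (real n)\<^sup>2 / 4))"
  proof -
    have "real n * real d * P \<le> 193 * real n ^ 3 / (\<delta> ^ 4 * c) * P"
      using P0 by (intro mult_right_mono nd)
    also have "\<dots> = 193 * real n ^ 3 * P * (1 / (\<delta> ^ 4 * c))" by simp
    also have "\<dots> \<le> 193 * real n ^ 3 * P * (c * exp ((real n)\<^sup>2 / 4))"
      using P0 by (intro mult_left_mono exp_bound) auto
    also have "\<dots> = c * (193 * real n ^ 3 * 2 ^ n * (exp (- (real n - 1)\<^sup>2 / 2) * exp ((real n)\<^sup>2 / 4)))"
      by (simp add: P_def)
    finally show ?thesis by (simp only: exp_add)
  qed
  have "real n * real d * (P + Q) \<le> c * (193 * real n ^ 3 * 2 ^ n * exp (- (real n - 1)\<^sup>2 / 2 + (real n)\<^sup>2 / 4) +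
      193 * (real n + 1) / (256 * real n * r))"
    unfolding distrib_left[of "real n * real d"] distrib_left[of c] by (rule add_mono[OF ndP ndQ])
  also have "\<dots> \<le> c * 1"
    using small c by (intro mult_left_mono) (auto simp: r_def)
  finally have total: "real (n * d) * (P + Q) \<le> c" by simp
  have "1 \<le> real (n * d)" using n d_bounds(3) by (metis mult_le_mono nat_mult_1 of_nat_1 of_nat_le_iff)
  then have "1 * (P + Q) \<le> real (n * d) * (P + Q)" using P0 Q0 by (intro mult_right_mono) auto
  from order_trans[OF this total] have PQ: "P + Q \<le> 1" using c by simp
  \<comment> \<open>The union bound in multiplicative form, by Bernoulli's inequality and (1 - P) (1
    - Q) \<ge> 1 - (P + Q).\<close>
  have "1 - c \<le> 1 - real (n * d) * (P + Q)" by (rule diff_left_mono[OF total])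
  also have "\<dots> = 1 + real (n * d) * (- (P + Q))" by (simp only: mult_minus_right diff_conv_add_uminus)
  also have "\<dots> \<le> (1 + - (P + Q)) ^ (n * d)"
    using PQ by (intro Bernoulli_inequality) simp
  also have "\<dots> \<le> ((1 - P) * (1 - Q)) ^ (n * d)"
    using PQ mult_nonneg_nonneg[OF P0 Q0] by (intro power_mono) (auto simp: algebra_simps)
  also have "\<dots> \<le> measure (outcome \<O> (PTest n \<delta> c)) {Accept}"
    unfolding d_def
  proof (rule accept_prob_ge[OF ap])
    show "0 \<le> 1 - P" "0 \<le> 1 - Q" using PQ P0 Q0 by auto
    show "1 - P \<le> linearity_prob n k \<delta> \<O>" if "k \<in> {1..n}" for k
      unfolding P_def using that \<delta> by (intro linearity_prob_large ap) auto
    show "1 - Q \<le> tail_prob k (4 * real n / (\<delta> * sqrt c)) \<O>" if "k \<in> {1..n}" for k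
      unfolding Q_def T_def[symmetric] using that \<delta> T n1 by (intro tail_prob_ge[OF ap]) auto
  qed
  finally show ?thesis .
qed

text \<open>
  For bounded \<open>n\<close> the union bound is useless, but a large \<open>C\<close> forces \<open>c\<close> so close to \<open>1\<close> that any
  positive lower bound on the acceptance probability suffices.
\<close>

lemma completeness_small:
  "\<exists>C>0. \<forall>n \<delta> c \<O>. n \<le> N \<longrightarrow> 0 < \<delta> \<longrightarrow> \<delta> \<le> 1 \<longrightarrow> 0 < c \<longrightarrow> c \<le> 1 \<longrightarrow>
    C * sqrt (ln (1 / (c * \<delta>))) \<le> real n \<longrightarrow> approximates_Per n \<delta> \<O> \<longrightarrow>
    1 - c \<le> measure (outcome \<O> (PTest n \<delta> c)) {Accept}"
proof -
  define m where "m k = measure (gauss k) {X \<in> space (gauss k). (\<Sum>i = 1..k. (cmod (X (1, i)))\<^sup>2) \<le> 1}" for k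
  \<comment> \<open>The inserted 1 keeps the minimum defined for N = 0.\<close>
  define q where "q = Min (insert 1 (m ` {1..N}))"
  have m: "0 < m k" if "k \<in> {1..N}" for k
    unfolding m_def using that by (intro gauss_row_norm_le_1_pos) auto
  have q: "0 < q" "q \<le> 1" "\<And>k. k \<in> {1..N} \<Longrightarrow> q \<le> m k"
  proof -
    show "0 < q" unfolding q_def using m by (subst Min_gr_iff) auto
    show "q \<le> 1" unfolding q_def by (intro Min_le) auto
    show "q \<le> m k" if "k \<in> {1..N}" for k unfolding q_def using that by (intro Min_le) auto
  qed
  \<comment> \<open>A uniform bound on the repetitions: \<open>C\<close> will force c \<delta> \<ge>
    exp (-1), hence \<delta>^4 c \<ge> exp (-5).\<close>
  define D where "D = nat \<lceil>193 * (real N)\<^sup>2 * exp 5\<rceil>"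
  define p where "p = (q * (1 / 2)) ^ (N * D)"
  have p: "0 < p" "p \<le> 1" unfolding p_def using q by (auto intro!: power_le_one)
  \<comment> \<open>Chosen so that the hypothesis with n \<le> N gives ln (1 / (c \<delta>)) \<le>
    p; then 1 - c \<le> - ln c \<le> p. The summand 1 keeps \<open>C\<close> positive for N =
    0.\<close>
  define C where "C = (real N + 1) / sqrt p"
  have C: "0 < C" unfolding C_def using p by simp
  have "1 - c \<le> measure (outcome \<O> (PTest n \<delta> c)) {Accept}"
    if nN: "n \<le> N" and \<delta>: "0 < \<delta>" "\<delta> \<le> 1" and c: "0 < c" "c \<le> 1"
      and large: "C * sqrt (ln (1 / (c * \<delta>))) \<le> real n" and ap: "approximates_Per n \<delta> \<O>" for n \<delta> c \<O>
  proof -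
    have cd: "0 < c * \<delta>" "c * \<delta> \<le> 1" "c * \<delta> \<le> c" "c * \<delta> \<le> \<delta>"
      using \<delta> c by (auto intro!: mult_le_one mult_left_le mult_left_le_one_le)
    have ln0: "0 \<le> ln (1 / (c * \<delta>))" using cd by simp
    have "C * sqrt (ln (1 / (c * \<delta>))) \<le> real N + 1" using large nN by linarith
    then have "(real N + 1) * sqrt (ln (1 / (c * \<delta>))) \<le> (real N + 1) * sqrt p"
      using p by (simp add: C_def field_simps)
    then have "sqrt (ln (1 / (c * \<delta>))) \<le> sqrt p" by (subst (asm) mult_le_cancel_left_pos) auto
    then have lnp: "ln (1 / (c * \<delta>)) \<le> p" by simp
    have "- ln c \<le> - ln (c * \<delta>)" using cd c by simp
    also have "\<dots> \<le> p" using lnp cd by (simp add: ln_div)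
    finally have cp: "1 - c \<le> p" using ln_le_minus_one[OF c(1)] by linarith
    have nd: "n * repetitions n \<delta> c \<le> N * D"
    proof (cases "n = 0")
      case False
      then have n: "1 \<le> n" by simp
      have "exp (- 1) \<le> c * \<delta>"
      proof -
        have "- 1 \<le> ln (c * \<delta>)" using lnp p cd by (simp add: ln_div)
        then show ?thesis using cd by (simp add: ln_ge_iff)
      qed
      then have e: "exp (- 1) \<le> c" "exp (- 1) \<le> \<delta>" using cd by linarith+
      have "exp (- 1) ^ 4 * exp (- 1) \<le> \<delta> ^ 4 * c"
        using e \<delta> c by (intro mult_mono power_mono) auto
      moreover have "exp (- 1) ^ 4 * exp (- 1) = (exp (- 5) :: real)"
      proof -
        have "exp (- 1) ^ 4 = exp (- 4 :: real)" using exp_of_nat_mult[of 4 "- 1 :: real"] by simp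
        then show ?thesis by (simp only: exp_add[symmetric]) simp
      qed
      ultimately have "exp (- 5) \<le> \<delta> ^ 4 * c" by (simp only:)
      then have "1 / (\<delta> ^ 4 * c) \<le> 1 / exp (- 5)"
        using \<delta> c by (intro divide_left_mono) auto
      then have "1 / (\<delta> ^ 4 * c) \<le> exp 5" by (simp add: exp_minus inverse_eq_divide)
      then have "193 * (real n)\<^sup>2 * (1 / (\<delta> ^ 4 * c)) \<le> 193 * (real N)\<^sup>2 * exp 5"
        using nN \<delta> c by (intro mult_mono power_mono) auto
      then have "real (repetitions n \<delta> c) \<le> 193 * (real N)\<^sup>2 * exp 5"
        using repetitions_bounds(2)[OF \<delta> c n] by simp
      also have "\<dots> \<le> real D" unfolding D_def by (rule real_nat_ceiling_ge)
      finally show ?thesis using nN by (intro mult_le_mono) auto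
    qed simp
    have "1 - c \<le> (q * (1 / 2)) ^ (N * D)" using cp by (simp add: p_def)
    also have "\<dots> \<le> (q * (1 / 2)) ^ (n * repetitions n \<delta> c)"
      using q nd by (intro power_decreasing) auto
    also have "\<dots> \<le> measure (outcome \<O> (PTest n \<delta> c)) {Accept}"
    proof (rule accept_prob_ge[OF ap])
      show "q \<le> linearity_prob n k \<delta> \<O>" if "k \<in> {1..n}" for k
        using q(3)[of k] linearity_prob_ge_unit_row[OF ap that \<delta>(1)] that nN by (simp add: m_def)
      show "1 / 2 \<le> tail_prob k (4 * real n / (\<delta> * sqrt c)) \<O>" if k: "k \<in> {1..n}" for k
      proof -
        have n1: "1 \<le> real n" using k by simp
        have dc: "0 < \<delta> * sqrt c" "\<delta> * sqrt c \<le> 1"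
          using \<delta> c by (auto intro!: mult_le_one)
        have T: "4 * real n \<le> 4 * real n / (\<delta> * sqrt c)" using dc n1 by (simp add: field_simps)
        let ?T = "4 * real n / (\<delta> * sqrt c)"
        have T3: "3 * real n \<le> ?T - 1" using T n1 by linarith
        have "2 * (real n + 1) \<le> (3 * real n) ^ 2"
        proof -
          have "2 * (real n + 1) \<le> 9 * real n" using n1 by simp
          also have "\<dots> \<le> 9 * (real n)\<^sup>2"
            using self_le_power[OF n1, of 2] by (intro mult_left_mono) auto
          finally have "2 * (real n + 1) \<le> 9 * (real n)\<^sup>2" .
          then show ?thesis by (simp add: power_mult_distrib)
        qed
        also have "\<dots> \<le> (?T - 1) ^ 2" using T3 by (intro power_mono) auto
        also have "\<dots> \<le> (?T - 1) ^ 4" using T3 n1 by (intro power_increasing) auto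
        finally have *: "2 * (real n + 1) \<le> (?T - 1) ^ 4" .
        have "0 < (?T - 1) ^ 4" using T3 n1 by (intro zero_less_power) linarith
        then have "(real n + 1) / (?T - 1) ^ 4 \<le> 1 / 2"
          using * by (simp add: pos_divide_le_eq)
        moreover have "1 - (real n + 1) / (?T - 1) ^ 4 \<le> tail_prob k ?T \<O>"
          using T n1 k \<delta> by (intro tail_prob_ge[OF ap]) auto
        ultimately show ?thesis by linarith
      qed
    qed (use q in auto)
    finally show ?thesis .
  qed
  then show ?thesis using C by blast
qed

theorem mainTheorem1:
  "\<exists>C>0::real. \<forall>\<tau>::nat. \<exists>K>0::real.
    \<forall>(n::nat) (\<delta>::real) (c::real) (\<O>::oracles).
      0 < \<delta> \<and> \<delta> \<le> 1 \<and> 0 < c \<and> c \<le> 1 \<and>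
      real n \<ge> C * sqrt (ln (1 / (c * \<delta>))) \<and>
      (\<forall>k\<in>{1..n}. \<O> k \<in> borel_measurable (gauss k))
    \<longrightarrow>
      ((\<forall>k\<in>{1..n}. \<forall>X\<in>cmatrices k. (cmod (\<O> k X - Per k X))\<^sup>2 \<le> \<delta>\<^sup>2 * fact k)
        \<longrightarrow> measure (outcome \<O> (PTest n \<delta> c)) {Accept} \<ge> 1 - c)
      \<and>
      (\<forall>k\<in>{1..n}.
        (\<exists>ind :: cmatrix \<Rightarrow> real.
            ind \<in> borel_measurable (gauss k) \<and> (\<forall>X\<in>cmatrices k. ind X \<in> {0, 1}) \<and>
            (\<integral>X. ind X \<partial>gauss k) \<ge> 1 - \<delta> ^ 4 * c / (64 * real n) \<and>
            (\<integral>\<^sup>+X. ennreal (ind X * (cmod (\<O> k X - Per k X))\<^sup>2) \<partial>gauss k)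
              \<le> ennreal ((2 * real n * real k * \<delta>)\<^sup>2 * fact k))
        \<or> measure (outcome \<O> (PTest n \<delta> c)) {Reject} \<ge> 1 - exp (- real n))
      \<and>
      (ereal_of_enat (queries \<O> (PTest n \<delta> c)) \<le> ereal (K * (real n ^ 4 / (\<delta> ^ 4 * c))) \<and>
       (1 \<le> n \<longrightarrow>
         ereal_of_enat (runtime \<tau> \<O> (PTest n \<delta> c)) \<le> ereal (K * (real n ^ 4 / (\<delta> ^ 4 * c)))))"
proof -
  obtain N where N: "193 * real n ^ 3 * 2 ^ n * exp (- (real n - 1)\<^sup>2 / 2 + (real n)\<^sup>2 / 4) +
      193 * (real n + 1) / (256 * real n * (1 - 1 / (4 * real n)) ^ 4) \<le> 1" if "N \<le> n" for n
    using eventually_reject_prob_small unfolding eventually_sequentially by blast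
  obtain C where C: "0 < C" and small: "\<And>n \<delta> c \<O>. n \<le> N \<Longrightarrow> 0 < \<delta> \<Longrightarrow> \<delta> \<le> 1 \<Longrightarrow> 0 < c \<Longrightarrow> c \<le> 1 \<Longrightarrow>
      C * sqrt (ln (1 / (c * \<delta>))) \<le> real n \<Longrightarrow> approximates_Per n \<delta> \<O> \<Longrightarrow>
      1 - c \<le> measure (outcome \<O> (PTest n \<delta> c)) {Accept}"
    using completeness_small[of N] by blast
  show ?thesis
  \<comment> \<open>4 is the constant for n > N, \<open>C\<close> the one for n \<le> N.\<close>
  proof (rule exI[of _ "max 4 C"], intro conjI allI, goal_cases)
    case (2 \<tau>)
    show ?case
    \<comment> \<open>The summand 20 makes this constant dominate both 193 (3 \<tau> + 17) for the
      time and 3860 = 193 times 20 for the queries, even when \<open>\<tau> = 0\<close>.\<close>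
    proof (rule exI[of _ "193 * (3 * real \<tau> + 20)"], intro conjI allI impI)
      fix n :: nat and \<delta> c :: real and \<O> :: oracles
      assume A: "0 < \<delta> \<and> \<delta> \<le> 1 \<and> 0 < c \<and> c \<le> 1 \<and>
        real n \<ge> max 4 C * sqrt (ln (1 / (c * \<delta>))) \<and>
        (\<forall>k\<in>{1..n}. \<O> k \<in> borel_measurable (gauss k))"
      then have \<delta>: "0 < \<delta>" "\<delta> \<le> 1" and c: "0 < c" "c \<le> 1"
        and large: "max 4 C * sqrt (ln (1 / (c * \<delta>))) \<le> real n"
        and meas: "\<And>k. k \<in> {1..n} \<Longrightarrow> \<O> k \<in> borel_measurable (gauss k)"
        by blast+
      have ln0: "0 \<le> ln (1 / (c * \<delta>))" using \<delta> c by (simp add: mult_le_one)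
      have large_C: "C' * sqrt (ln (1 / (c * \<delta>))) \<le> real n" if "C' \<le> max 4 C" for C'
        using large mult_right_mono[OF that, of "sqrt (ln (1 / (c * \<delta>)))"] ln0 by simp
      show "1 - c \<le> measure (outcome \<O> (PTest n \<delta> c)) {Accept}"
        if "\<forall>k\<in>{1..n}. \<forall>X\<in>cmatrices k. (cmod (\<O> k X - Per k X))\<^sup>2 \<le> \<delta>\<^sup>2 * fact k"
      proof -
        have ap: "approximates_Per n \<delta> \<O>" using that meas by (simp add: approximates_Per_def)
        show ?thesis
        proof (cases "n \<le> N")
          case True
          then show ?thesis using \<delta> c ap by (intro small large_C) auto
        next
          case False
          then show ?thesis using \<delta> c ap by (intro completeness_large large_C N) auto
        qed
      qed
      show "\<forall>k\<in>{1..n}.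
          (\<exists>ind :: cmatrix \<Rightarrow> real.
              ind \<in> borel_measurable (gauss k) \<and> (\<forall>X\<in>cmatrices k. ind X \<in> {0, 1}) \<and>
              (\<integral>X. ind X \<partial>gauss k) \<ge> 1 - \<delta> ^ 4 * c / (64 * real n) \<and>
              (\<integral>\<^sup>+X. ennreal (ind X * (cmod (\<O> k X - Per k X))\<^sup>2) \<partial>gauss k)
                \<le> ennreal ((2 * real n * real k * \<delta>)\<^sup>2 * fact k))
          \<or> measure (outcome \<O> (PTest n \<delta> c)) {Reject} \<ge> 1 - exp (- real n)"
      proof (intro ballI disjCI)
        fix k assume k: "k \<in> {1..n}"
        assume "\<not> 1 - exp (- real n) \<le> measure (outcome \<O> (PTest n \<delta> c)) {Reject}"
        then have acc: "measure (outcome \<O> (PTest n \<delta> c)) {Reject} < 1 - exp (- real n)" by simp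
        have ok: "Measurable.pred (gauss k) (tests_ok n k \<delta> c \<O>)"
          using k by (intro pred_tests_ok meas) auto
        show "\<exists>ind :: cmatrix \<Rightarrow> real.
              ind \<in> borel_measurable (gauss k) \<and> (\<forall>X\<in>cmatrices k. ind X \<in> {0, 1}) \<and>
              (\<integral>X. ind X \<partial>gauss k) \<ge> 1 - \<delta> ^ 4 * c / (64 * real n) \<and>
              (\<integral>\<^sup>+X. ennreal (ind X * (cmod (\<O> k X - Per k X))\<^sup>2) \<partial>gauss k)
                \<le> ennreal ((2 * real n * real k * \<delta>)\<^sup>2 * fact k)"
        proof (intro exI[of _ "\<lambda>X. of_bool (tests_ok n k \<delta> c \<O> X)"] conjI ballI)
          show "(\<lambda>X. of_bool (tests_ok n k \<delta> c \<O> X) :: real) \<in> borel_measurable (gauss k)"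
            using ok by measurable
        qed (use soundness[OF \<delta> c meas k acc] in auto)
      qed
      have q0: "0 \<le> real n ^ 4 / (\<delta> ^ 4 * c)" using \<delta> c by simp
      have "ereal_of_enat (queries \<O> (PTest n \<delta> c)) \<le> ereal (3860 * (real n ^ 4 / (\<delta> ^ 4 * c)))"
        by (rule queries_PTest[OF \<delta> c])
      also have "\<dots> \<le> ereal (193 * (3 * real \<tau> + 20) * (real n ^ 4 / (\<delta> ^ 4 * c)))"
        unfolding ereal_less_eq by (intro mult_right_mono q0) simp
      finally show "ereal_of_enat (queries \<O> (PTest n \<delta> c))
          \<le> ereal (193 * (3 * real \<tau> + 20) * (real n ^ 4 / (\<delta> ^ 4 * c)))" .
      assume "1 \<le> n"
      have "ereal_of_enat (runtime \<tau> \<O> (PTest n \<delta> c)) \<le> ereal (193 * (3 * real \<tau> + 17) * (real n ^ 4 / (\<delta> ^ 4 * c)))"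
        by (rule runtime_PTest_le[OF \<delta> c \<open>1 \<le> n\<close>])
      also have "\<dots> \<le> ereal (193 * (3 * real \<tau> + 20) * (real n ^ 4 / (\<delta> ^ 4 * c)))"
        unfolding ereal_less_eq by (intro mult_right_mono q0) simp
      finally show "ereal_of_enat (runtime \<tau> \<O> (PTest n \<delta> c))
          \<le> ereal (193 * (3 * real \<tau> + 20) * (real n ^ 4 / (\<delta> ^ 4 * c)))" .
    qed simp_all
  qed simp
qed

end
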